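(* Let $f\in\mathbb{T}[x_0^{\pm1},\dots,x_d^{\pm1}]$ be a tropical Laurent polynomial such that the very affine tropical cycle $X=V(f)\subset\mathbb{R}^{d+1}$ is supported on a pointed fan. If $X$ satisfies tropical Poincaré duality over a (nonzero) commutative ring $R$, then the Newton polytope $\Delta(f)$ of $f$ is a simplex.
   Context: **Tropical hypersurfaces.** $\mathbb{T}=\mathbb{R}\cup\{-\infty\}$ with tropical operations $\max$ and $+$. A tropical Laurent polynomial $f=\text{"}\sum_ja_jx^j\text{"}$ defines the function $x\mapsto\max_j(a_j+\langle j,x\rangle)$ on $\mathbb{R}^{d+1}$, the maximum being over the finitely many $j\in\mathbb{Z}^{d+1}$ with $a_j\ne-\infty$. $\Delta(f)$ is the convex hull of these $j$. $V(f)$ is the set of points where the maximum is attained at least twice, equipped with its standard weights: each maximal cell, dual to an edge of the regular subdivision of $\Delta(f)$ induced by $f$, has as weight the lattice length of that edge. It is a $d$-dimensional balanced polyhedral complex. "Supported on a pointed fan" means that (with its vertex placed at the origin) $X$ is the support of a fan as below; the weights are viewed in $R$ and give a fundamental class for which TPD over $R$ is considered. **Fans.** Let $N\cong\mathbb{Z}^n$ be a lattice, $N_{\mathbb{R}}=N\otimes\mathbb{R}$. A rational polyhedral cone is a strictly convex cone generated by finitely many vectors of $N$; for a cone $\sigma$, $L_{\mathbb{Z}}(\sigma)=N\cap\mathrm{span}(\sigma)$ and $\dim\sigma=\mathrm{rank}\,L_{\mathbb{Z}}(\sigma)$. A (rational polyhedral) fan $\Sigma$ is a finite nonempty collection of such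 cones, closed under taking faces, any two meeting in a common face; fans are assumed pure dimensional (all maximal cones have the same dimension $d=\dim\Sigma$). Cones are also called faces. $\Sigma^i$ is the set of $i$-dimensional cones, $\tau\preceq\sigma$ means $\tau$ is a face of $\sigma$, and $v=\{0\}\in\Sigma$ is the vertex, the only compact cone. Fix an orientation of each cone; for $\tau\prec\sigma$ with $\dim\tau=\dim\sigma-1$ let $\mathcal{O}(\tau,\sigma)=\pm1$ be the relative orientation sign. **Tropical (co)homology.** $F_p^{\mathbb{Z}}(\sigma)=\sum_{\gamma\succeq\sigma}\bigwedge^pL_{\mathbb{Z}}(\gamma)\subseteq\bigwedge^pN$ (with $F_0^{\mathbb{Z}}(\sigma)=\mathbb{Z}$), $F_p^R(\sigma)=F_p^{\mathbb{Z}}(\sigma)\otimes_{\mathbb{Z}}R$, and for $\tau\preceq\sigma$ the map $\iota_{\sigma,\tau}:F_p^R(\sigma)\to F_p^R(\tau)$ is induced by inclusion. $F^p_R(\sigma)=\mathrm{Hom}_R(F_p^R(\sigma),R)$ with $\rho_{\tau,\sigma}:F_R^p(\tau)\to F_R^p(\sigma)$ dual to $\iota_{\sigma,\tau}$. $C_q^{BM}(\Sigma,F_p^R)=\bigoplus_{\sigma\in\Sigma^q}F_p^R(\sigma)$, with boundary having components $\mathcal{O}(\tau,\sigma)\iota_{\sigma,\tau}$; its homology is $H_q^{BM}(\Sigma,F_p^R)$. $C^q(\Sigma,F_R^p)=\bigoplus F_R^p(\sigma)$ over compact $\sigma\in\Sigma^q$, with coboundary having components $\mathcal{O}(\tau,\sigma)\rho_{\tau,\sigma}$;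 its cohomology is $H^q(\Sigma,F_R^p)$ (so $C^0=F_R^p(v)$ and $C^q=0$ for $q>0$). **Balancing.** For $\alpha\in\Sigma^d$, $\Lambda_\alpha\in F_d^R(\alpha)=\bigwedge^dL_{\mathbb{Z}}(\alpha)\otimes R\cong R$ is the image of the generator of $\bigwedge^dL_{\mathbb{Z}}(\alpha)$ compatible with the orientation of $\alpha$. An $R$-weight function is $w:\Sigma^d\to R$ with no $w(\alpha)$ a zero-divisor. $(\Sigma,w)$ is $R$-balanced if the fundamental chain $\mathrm{Ch}(\Sigma,w)=(w(\alpha)\Lambda_\alpha)_\alpha\in C_d^{BM}(\Sigma,F_d^R)$ is a cycle; its class is the fundamental class $[\Sigma,w]\in H_d^{BM}(\Sigma,F_d^R)$. **Cap product and duality.** For $y=y_1\wedge\dots\wedge y_m$ in $\bigwedge^mM$ ($M$ free of finite rank) and $x=x_1\wedge\dots\wedge x_p\in\bigwedge^pM^*$, $p\le m$, the contraction is $x\lrcorner y=(-1)^{p(p-1)/2}\sum_a\mathrm{sign}(a)\left(\prod_{i=1}^px_i(y_{a(i)})\right)y_{a(p+1)}\wedge\dots\wedge y_{a(m)}\in\bigwedge^{m-p}M$, summing over permutations $a\in S_m$ increasing on $1,\dots,p$ and on $p+1,\dots,m$. The cap product $\frown[\Sigma,w]:H^q(\Sigma,F_R^p)\to H_{d-q}^{BM}(\Sigma,F_{d-p}^R)$ is induced by $(u_\gamma)_{\gamma\in\Sigma^q}\mapsto\left(\sum_{\alpha\in\Sigma^d,\ \gamma,\tau\preceq\alpha}w(\alpha)\,\iota_{\alpha,\tau}(\rho_{\gamma,\alpha}(u_\gamma)\lrcorner\Lambda_\alpha)\right)_{\tau\in\Sigma^{d-q}}$;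 for $q=0$ it is $u\mapsto(\rho_{v,\alpha}(u)\lrcorner w(\alpha)\Lambda_\alpha)_{\alpha\in\Sigma^d}$. An $R$-balanced $(\Sigma,w)$ satisfies tropical Poincaré duality (TPD) over $R$ if $\frown[\Sigma,w]:H^q(\Sigma,F_R^p)\to H_{d-q}^{BM}(\Sigma,F_{d-p}^R)$ is an isomorphism for all $p,q\in\{0,\dots,d\}$.
   Formalization: The contraction in the cap product is read with the determinant det(x_i(y_{a(j)})), i.e. the natural pairing with y_{a(1)}∧…∧y_{a(p)}, in place of the product of the x_i(y_{a(i)}), since the printed sum over shuffles is not alternating in the x_i and so is not well defined. *)

theory Defs
  imports
    "HOL-Analysis.Analysis"
    "HOL-Combinatorics.Permutations"
    "HOL-Computational_Algebra.Group_Closure"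
    "HOL-Library.Function_Algebras"
    "HOL-Library.Poly_Mapping"
    "HOL-Library.Set_Algebras"
begin

section \<open>Rational polyhedral fans\<close>

definition int_lattice :: "(real^'n) set"
  where "int_lattice = {x. \<forall>i. x $ i \<in> \<int>}"

definition rational_cone :: "(real^'n) set \<Rightarrow> bool"
  where "rational_cone \<sigma> \<longleftrightarrow>
    (\<exists>G. finite G \<and> G \<subseteq> int_lattice \<and> \<sigma> = convex_cone hull G) \<and>
    (\<forall>x. x \<in> \<sigma> \<and> - x \<in> \<sigma> \<longrightarrow> x = 0)"

definition cone_lattice :: "(real^'n) set \<Rightarrow> (real^'n) set"
  where "cone_lattice \<sigma> = int_lattice \<inter> span \<sigma>"

text \<open>
  \<^const>\<open>dim\<close> of a rational cone is the rank of its lattice. \<^const>\<open>face_of\<close> admits the empty face,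
  which is not a face of a cone and is excluded explicitly.
\<close>

definition fan_dim :: "(real^'n) set set \<Rightarrow> nat"
  where "fan_dim \<Sigma> = Max (dim ` \<Sigma>)"

definition fan :: "(real^'n) set set \<Rightarrow> bool"
  where "fan \<Sigma> \<longleftrightarrow>
    finite \<Sigma> \<and> \<Sigma> \<noteq> {} \<and>
    (\<forall>\<sigma>\<in>\<Sigma>. rational_cone \<sigma>) \<and>
    (\<forall>\<sigma>\<in>\<Sigma>. \<forall>\<tau>. \<tau> face_of \<sigma> \<and> \<tau> \<noteq> {} \<longrightarrow> \<tau> \<in> \<Sigma>) \<and>
    (\<forall>\<sigma>\<in>\<Sigma>. \<forall>\<tau>\<in>\<Sigma>. \<sigma> \<inter> \<tau> face_of \<sigma> \<and> \<sigma> \<inter> \<tau> face_of \<tau>)"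

definition pure_fan :: "(real^'n) set set \<Rightarrow> bool"
  where "pure_fan \<Sigma> \<longleftrightarrow> fan \<Sigma> \<and>
    (\<forall>\<sigma>\<in>\<Sigma>. (\<forall>\<gamma>\<in>\<Sigma>. \<sigma> \<subseteq> \<gamma> \<longrightarrow> \<gamma> = \<sigma>) \<longrightarrow> dim \<sigma> = fan_dim \<Sigma>)"

definition cones :: "(real^'n) set set \<Rightarrow> nat \<Rightarrow> (real^'n) set set"
  where "cones \<Sigma> q = {\<sigma>\<in>\<Sigma>. dim \<sigma> = q}"

definition compact_cones :: "(real^'n) set set \<Rightarrow> nat \<Rightarrow> (real^'n) set set"
  where "compact_cones \<Sigma> q = {\<sigma>\<in>\<Sigma>. dim \<sigma> = q \<and> compact \<sigma>}"


section \<open>Exterior powers and orientations\<close>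

text \<open>
  The \<open>p\<close>-th exterior power of the lattice \<open>\<int>\<^sup>n\<close> is realised by Pluecker coordinates:
  \<open>v\<^sub>1 \<and> \<dots> \<and> v\<^sub>p\<close> is the function sending a tuple \<open>(j\<^sub>1, \<dots>, j\<^sub>p)\<close> of coordinate indices to the
  minor with entries \<open>v\<^sub>i $ j\<^sub>k\<close>, and sending tuples of any other length to 0.
  This embeds the exterior power in \<open>'n list \<Rightarrow> real\<close>. For a saturated sublattice \<open>L\<close> the
  subgroup \<open>ext_power p L\<close> is the exterior power of \<open>L\<close>.
\<close>

type_synonym 'n ext = "'n list \<Rightarrow> real"

definition wedge :: "(real^'n) list \<Rightarrow> 'n ext"
  where "wedge vs = (\<lambda>js. if length js = length vs
    then \<Sum>\<pi> | \<pi> permutes {..<length vs}.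
           of_int (sign \<pi>) * (\<Prod>i<length vs. (vs ! i) $ (js ! \<pi> i))
    else 0)"

definition ext_power :: "nat \<Rightarrow> (real^'n) set \<Rightarrow> 'n ext set"
  where "ext_power p L = group_closure {wedge vs |vs. length vs = p \<and> set vs \<subseteq> L}"

definition F_Z :: "(real^'n) set set \<Rightarrow> nat \<Rightarrow> (real^'n) set \<Rightarrow> 'n ext set"
  where "F_Z \<Sigma> p \<sigma> =
    group_closure (\<Union>\<gamma>\<in>{\<gamma>\<in>\<Sigma>. \<sigma> face_of \<gamma>}. ext_power p (cone_lattice \<gamma>))"

definition lattice_basis :: "(real^'n) set \<Rightarrow> (real^'n) list \<Rightarrow> bool"
  where "lattice_basis L vs \<longleftrightarrow>
    distinct vs \<and> independent (set vs) \<and> L = group_closure (set vs)"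

text \<open>
  An orientation of a cone is represented by an ordered basis of its lattice. The vertex has
  the empty basis, that is, the positive orientation of a point.
\<close>

definition fan_orientation ::
    "(real^'n) set set \<Rightarrow> ((real^'n) set \<Rightarrow> (real^'n) list) \<Rightarrow> bool"
  where "fan_orientation \<Sigma> b \<longleftrightarrow> (\<forall>\<sigma>\<in>\<Sigma>. lattice_basis (cone_lattice \<sigma>) (b \<sigma>))"

text \<open>
  For a facet \<open>\<tau>\<close> of \<open>\<sigma>\<close>: the sign is 1 iff an outward pointing vector followed by the oriented
  basis of \<open>\<tau>\<close> is an oriented basis of the span of \<open>\<sigma>\<close>.
\<close>

definition rel_sign ::
    "((real^'n) set \<Rightarrow> (real^'n) list) \<Rightarrow> (real^'n) set \<Rightarrow> (real^'n) set \<Rightarrow> int"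
  where "rel_sign b \<tau> \<sigma> =
    (if \<exists>x k. - x \<in> \<sigma> \<and> k > 0 \<and> wedge (x # b \<tau>) = (\<lambda>js. k * wedge (b \<sigma>) js) then 1 else -1)"


section \<open>Tensor products with the coefficient ring\<close>

text \<open>
  For an abelian group \<open>M\<close> (a subgroup of a type), \<open>M \<otimes> R\<close> is the set of cosets of formal sums
  \<open>\<Sum> r\<^sub>i [x\<^sub>i]\<close> with \<open>x\<^sub>i \<in> M\<close> and \<open>r\<^sub>i \<in> R\<close> modulo the additive relations in \<open>M\<close>; additivity in \<open>R\<close> is
  already built into formal sums. Cosets are added with the sum of sets from
  \<open>HOL-Library.Set_Algebras\<close>, so the zero of \<open>M \<otimes> R\<close> is \<open>tensor_rels M\<close>. A tensor product
  really is needed: \<open>F_Z \<Sigma> p \<sigma>\<close> is in general not saturated, so that tensoring does not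
  preserve the injectivity of inclusions.
\<close>

definition tensor_rels :: "'m::ab_group_add set \<Rightarrow> ('m \<Rightarrow>\<^sub>0 'r::comm_ring_1) set"
  where "tensor_rels M = group_closure
    {Poly_Mapping.single (x + y) r - Poly_Mapping.single x r - Poly_Mapping.single y r
      |x y r. x \<in> M \<and> y \<in> M}"

definition tensor :: "'m::ab_group_add set \<Rightarrow> ('m \<Rightarrow>\<^sub>0 'r::comm_ring_1) set set"
  where "tensor M = {t +o tensor_rels M |t. Poly_Mapping.keys t \<subseteq> M}"

definition pure_tensor ::
    "'m::ab_group_add set \<Rightarrow> 'm \<Rightarrow> 'r::comm_ring_1 \<Rightarrow> ('m \<Rightarrow>\<^sub>0 'r) set"
  where "pure_tensor M x r = Poly_Mapping.single x r +o tensor_rels M"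

text \<open>In the next three definitions adding \<open>tensor_rels M\<close> saturates a set to a coset.\<close>

definition tensor_scale ::
    "'m::ab_group_add set \<Rightarrow> 'r::comm_ring_1 \<Rightarrow> ('m \<Rightarrow>\<^sub>0 'r) set \<Rightarrow> ('m \<Rightarrow>\<^sub>0 'r) set"
  where "tensor_scale M r C = Poly_Mapping.map ((*) r) ` C + tensor_rels M"

definition tensor_sum ::
    "'m::ab_group_add set \<Rightarrow> ('i \<Rightarrow> ('m \<Rightarrow>\<^sub>0 'r::comm_ring_1) set) \<Rightarrow> 'i set \<Rightarrow> ('m \<Rightarrow>\<^sub>0 'r) set"
  where "tensor_sum M c I = sum c I + tensor_rels M"

text \<open>The map \<open>M' \<otimes> R \<rightarrow> M \<otimes> R\<close> induced by an inclusion \<open>M' \<subseteq> M\<close>.\<close>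

definition tensor_incl ::
    "'m::ab_group_add set \<Rightarrow> ('m \<Rightarrow>\<^sub>0 'r::comm_ring_1) set \<Rightarrow> ('m \<Rightarrow>\<^sub>0 'r) set"
  where "tensor_incl M C = C + tensor_rels M"

text \<open>
  \<open>Hom\<^sub>R(M \<otimes> R, R)\<close>. Functionals are extended by 0, so that they are determined by their
  values on \<open>M \<otimes> R\<close>.
\<close>

definition tensor_dual ::
    "'m::ab_group_add set \<Rightarrow> (('m \<Rightarrow>\<^sub>0 'r::comm_ring_1) set \<Rightarrow> 'r) set"
  where "tensor_dual M = {u.
    (\<forall>C\<in>tensor M. \<forall>D\<in>tensor M. u (C + D) = u C + u D) \<and>
    (\<forall>r. \<forall>C\<in>tensor M. u (tensor_scale M r C) = r * u C) \<and>
    (\<forall>C. C \<notin> tensor M \<longrightarrow> u C = 0)}"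


section \<open>Tropical homology and cohomology of a fan\<close>

type_synonym ('n, 'r) tens = "('n ext \<Rightarrow>\<^sub>0 'r) set"
type_synonym ('n, 'r) chain = "(real^'n) set \<Rightarrow> ('n, 'r) tens"
type_synonym ('n, 'r) cochain = "(real^'n) set \<Rightarrow> ('n, 'r) tens \<Rightarrow> 'r"

definition F_R :: "(real^'n) set set \<Rightarrow> nat \<Rightarrow> (real^'n) set \<Rightarrow> ('n, 'r::comm_ring_1) tens set"
  where "F_R \<Sigma> p \<sigma> = tensor (F_Z \<Sigma> p \<sigma>)"

definition iota :: "(real^'n) set set \<Rightarrow> nat \<Rightarrow> (real^'n) set \<Rightarrow> (real^'n) set \<Rightarrow>
    ('n, 'r::comm_ring_1) tens \<Rightarrow> ('n, 'r) tens"
  where "iota \<Sigma> p \<sigma> \<tau> C = tensor_incl (F_Z \<Sigma> p \<tau>) C"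

definition F_dual ::
    "(real^'n) set set \<Rightarrow> nat \<Rightarrow> (real^'n) set \<Rightarrow> (('n, 'r::comm_ring_1) tens \<Rightarrow> 'r) set"
  where "F_dual \<Sigma> p \<sigma> = tensor_dual (F_Z \<Sigma> p \<sigma>)"

definition rho :: "(real^'n) set set \<Rightarrow> nat \<Rightarrow> (real^'n) set \<Rightarrow> (real^'n) set \<Rightarrow>
    (('n, 'r::comm_ring_1) tens \<Rightarrow> 'r) \<Rightarrow> ('n, 'r) tens \<Rightarrow> 'r"
  where "rho \<Sigma> p \<tau> \<sigma> u = (\<lambda>C. if C \<in> F_R \<Sigma> p \<sigma> then u (iota \<Sigma> p \<sigma> \<tau> C) else 0)"

text \<open>
  A chain takes the junk value \<open>{}\<close> (which is not a coset) outside the cones of its degree, so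
  chains are added pointwise.
\<close>

definition BM_chains :: "(real^'n) set set \<Rightarrow> nat \<Rightarrow> nat \<Rightarrow> ('n, 'r::comm_ring_1) chain set"
  where "BM_chains \<Sigma> p q = {c.
    (\<forall>\<sigma>\<in>cones \<Sigma> q. c \<sigma> \<in> F_R \<Sigma> p \<sigma>) \<and> (\<forall>\<sigma>. \<sigma> \<notin> cones \<Sigma> q \<longrightarrow> c \<sigma> = {})}"

text \<open>The boundary map from degree \<open>q\<close> to degree \<open>q - 1\<close>, the target being 0 if \<open>q = 0\<close>.\<close>

definition BM_boundary :: "(real^'n) set set \<Rightarrow> ((real^'n) set \<Rightarrow> (real^'n) list) \<Rightarrow>
    nat \<Rightarrow> nat \<Rightarrow> ('n, 'r::comm_ring_1) chain \<Rightarrow> ('n, 'r) chain"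
  where "BM_boundary \<Sigma> b p q c = (\<lambda>\<tau>. if \<tau> \<in> \<Sigma> \<and> Suc (dim \<tau>) = q
    then tensor_sum (F_Z \<Sigma> p \<tau>)
      (\<lambda>\<sigma>. tensor_scale (F_Z \<Sigma> p \<tau>) (of_int (rel_sign b \<tau> \<sigma>)) (iota \<Sigma> p \<sigma> \<tau> (c \<sigma>)))
      {\<sigma>\<in>cones \<Sigma> q. \<tau> face_of \<sigma>}
    else {})"

definition BM_cycles :: "(real^'n) set set \<Rightarrow> ((real^'n) set \<Rightarrow> (real^'n) list) \<Rightarrow>
    nat \<Rightarrow> nat \<Rightarrow> ('n, 'r::comm_ring_1) chain set"
  where "BM_cycles \<Sigma> b p q = {c\<in>BM_chains \<Sigma> p q.
    \<forall>\<tau>\<in>\<Sigma>. Suc (dim \<tau>) = q \<longrightarrow> BM_boundary \<Sigma> b p q c \<tau> = tensor_rels (F_Z \<Sigma> p \<tau>)}"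

definition BM_boundaries :: "(real^'n) set set \<Rightarrow> ((real^'n) set \<Rightarrow> (real^'n) list) \<Rightarrow>
    nat \<Rightarrow> nat \<Rightarrow> ('n, 'r::comm_ring_1) chain set"
  where "BM_boundaries \<Sigma> b p q = BM_boundary \<Sigma> b p (Suc q) ` BM_chains \<Sigma> p (Suc q)"

definition cochains :: "(real^'n) set set \<Rightarrow> nat \<Rightarrow> nat \<Rightarrow> ('n, 'r::comm_ring_1) cochain set"
  where "cochains \<Sigma> p q = {u.
    (\<forall>\<sigma>\<in>compact_cones \<Sigma> q. u \<sigma> \<in> F_dual \<Sigma> p \<sigma>) \<and>
    (\<forall>\<sigma>. \<sigma> \<notin> compact_cones \<Sigma> q \<longrightarrow> u \<sigma> = 0)}"

definition coboundary :: "(real^'n) set set \<Rightarrow> ((real^'n) set \<Rightarrow> (real^'n) list) \<Rightarrow>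
    nat \<Rightarrow> nat \<Rightarrow> ('n, 'r::comm_ring_1) cochain \<Rightarrow> ('n, 'r) cochain"
  where "coboundary \<Sigma> b p q u = (\<lambda>\<sigma>. if \<sigma> \<in> compact_cones \<Sigma> (Suc q)
    then \<Sum>\<tau> | \<tau> \<in> compact_cones \<Sigma> q \<and> \<tau> face_of \<sigma>.
           (\<lambda>C. of_int (rel_sign b \<tau> \<sigma>) * rho \<Sigma> p \<tau> \<sigma> (u \<tau>) C)
    else 0)"

definition cocycles :: "(real^'n) set set \<Rightarrow> ((real^'n) set \<Rightarrow> (real^'n) list) \<Rightarrow>
    nat \<Rightarrow> nat \<Rightarrow> ('n, 'r::comm_ring_1) cochain set"
  where "cocycles \<Sigma> b p q = {u\<in>cochains \<Sigma> p q. coboundary \<Sigma> b p q u = 0}"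

definition coboundaries :: "(real^'n) set set \<Rightarrow> ((real^'n) set \<Rightarrow> (real^'n) list) \<Rightarrow>
    nat \<Rightarrow> nat \<Rightarrow> ('n, 'r::comm_ring_1) cochain set"
  where "coboundaries \<Sigma> b p q =
    (if q = 0 then {0} else coboundary \<Sigma> b p (q - 1) ` cochains \<Sigma> p (q - 1))"

definition mod_rel :: "'c::plus set \<Rightarrow> 'c set \<Rightarrow> ('c \<times> 'c) set"
  where "mod_rel Z B = {(c, c'). c \<in> Z \<and> c' \<in> Z \<and> (\<exists>x\<in>B. c' = c + x)}"

definition BM_homology :: "(real^'n) set set \<Rightarrow> ((real^'n) set \<Rightarrow> (real^'n) list) \<Rightarrow>
    nat \<Rightarrow> nat \<Rightarrow> ('n, 'r::comm_ring_1) chain set set"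
  where "BM_homology \<Sigma> b p q =
    BM_cycles \<Sigma> b p q // mod_rel (BM_cycles \<Sigma> b p q) (BM_boundaries \<Sigma> b p q)"

definition cohomology :: "(real^'n) set set \<Rightarrow> ((real^'n) set \<Rightarrow> (real^'n) list) \<Rightarrow>
    nat \<Rightarrow> nat \<Rightarrow> ('n, 'r::comm_ring_1) cochain set set"
  where "cohomology \<Sigma> b p q =
    cocycles \<Sigma> b p q // mod_rel (cocycles \<Sigma> b p q) (coboundaries \<Sigma> b p q)"


section \<open>Balancing, cap product and tropical Poincare duality\<close>

definition weight_function :: "(real^'n) set set \<Rightarrow> ((real^'n) set \<Rightarrow> 'r::comm_ring_1) \<Rightarrow> bool"
  where "weight_function \<Sigma> w \<longleftrightarrow>
    (\<forall>\<alpha>\<in>cones \<Sigma> (fan_dim \<Sigma>). \<forall>r. r * w \<alpha> = 0 \<longrightarrow> r = 0)"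

definition Lambda :: "(real^'n) set set \<Rightarrow> ((real^'n) set \<Rightarrow> (real^'n) list) \<Rightarrow>
    (real^'n) set \<Rightarrow> ('n, 'r::comm_ring_1) tens"
  where "Lambda \<Sigma> b \<alpha> = pure_tensor (F_Z \<Sigma> (fan_dim \<Sigma>) \<alpha>) (wedge (b \<alpha>)) 1"

definition fundamental_chain :: "(real^'n) set set \<Rightarrow> ((real^'n) set \<Rightarrow> (real^'n) list) \<Rightarrow>
    ((real^'n) set \<Rightarrow> 'r::comm_ring_1) \<Rightarrow> ('n, 'r) chain"
  where "fundamental_chain \<Sigma> b w = (\<lambda>\<alpha>. if \<alpha> \<in> cones \<Sigma> (fan_dim \<Sigma>)
    then tensor_scale (F_Z \<Sigma> (fan_dim \<Sigma>) \<alpha>) (w \<alpha>) (Lambda \<Sigma> b \<alpha>) else {})"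

definition balanced :: "(real^'n) set set \<Rightarrow> ((real^'n) set \<Rightarrow> (real^'n) list) \<Rightarrow>
    ((real^'n) set \<Rightarrow> 'r::comm_ring_1) \<Rightarrow> bool"
  where "balanced \<Sigma> b w \<longleftrightarrow>
    weight_function \<Sigma> w \<and>
    fundamental_chain \<Sigma> b w \<in> BM_cycles \<Sigma> b (fan_dim \<Sigma>) (fan_dim \<Sigma>)"

definition shuffle_perms :: "nat \<Rightarrow> nat \<Rightarrow> (nat \<Rightarrow> nat) set"
  where "shuffle_perms p m =
    {a. a permutes {..<m} \<and> strict_mono_on {..<p} a \<and> strict_mono_on {p..<m} a}"

text \<open>
  The contraction of \<open>\<Lambda>\<^sub>\<alpha> = y\<^sub>1 \<and> \<dots> \<and> y\<^sub>d\<close>, where \<open>y\<close> is the oriented basis of \<open>\<alpha>\<close>, by a functional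
  \<open>u\<close> on \<open>F_R \<Sigma> p \<alpha>\<close>. A decomposable functional \<open>x\<^sub>1 \<and> \<dots> \<and> x\<^sub>p\<close> pairs with
  \<open>z\<^sub>1 \<and> \<dots> \<and> z\<^sub>p\<close> to \<open>det (x\<^sub>i(z\<^sub>j))\<close>. For such functionals the sum below over shuffles \<open>a\<close> with
  the factor \<open>u (y\<^bsub>a(1)\<^esub> \<and> \<dots> \<and> y\<^bsub>a(p)\<^esub>)\<close> is the sum, with the factor
  \<open>x\<^sub>1(y\<^bsub>a(1)\<^esub>) \<cdots> x\<^sub>p(y\<^bsub>a(p)\<^esub>)\<close>, over all permutations \<open>a\<close> that increase on \<open>p+1, \<dots>, d\<close>.
\<close>

definition contract_Lambda :: "(real^'n) set set \<Rightarrow> ((real^'n) set \<Rightarrow> (real^'n) list) \<Rightarrow>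
    nat \<Rightarrow> (real^'n) set \<Rightarrow> (('n, 'r::comm_ring_1) tens \<Rightarrow> 'r) \<Rightarrow> ('n, 'r) tens"
  where "contract_Lambda \<Sigma> b p \<alpha> u =
    (let d = fan_dim \<Sigma>; M = F_Z \<Sigma> (d - p) \<alpha> in
      tensor_sum M
        (\<lambda>a. pure_tensor M
          (wedge (map (\<lambda>i. b \<alpha> ! a i) [p..<d]))
          ((-1) ^ (p * (p - 1) div 2) * of_int (sign a) *
            u (pure_tensor (F_Z \<Sigma> p \<alpha>) (wedge (map (\<lambda>i. b \<alpha> ! a i) [0..<p])) 1)))
        (shuffle_perms p d))"

definition cap :: "(real^'n) set set \<Rightarrow> ((real^'n) set \<Rightarrow> (real^'n) list) \<Rightarrow>
    ((real^'n) set \<Rightarrow> 'r::comm_ring_1) \<Rightarrow> nat \<Rightarrow> nat \<Rightarrow> ('n, 'r) cochain \<Rightarrow> ('n, 'r) chain"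
  where "cap \<Sigma> b w p q u =
    (let d = fan_dim \<Sigma> in
      (\<lambda>\<tau>. if \<tau> \<in> cones \<Sigma> (d - q)
        then tensor_sum (F_Z \<Sigma> (d - p) \<tau>)
          (\<lambda>(\<gamma>, \<alpha>). tensor_scale (F_Z \<Sigma> (d - p) \<tau>) (w \<alpha>)
            (iota \<Sigma> (d - p) \<alpha> \<tau> (contract_Lambda \<Sigma> b p \<alpha> (rho \<Sigma> p \<gamma> \<alpha> (u \<gamma>)))))
          {(\<gamma>, \<alpha>). \<gamma> \<in> compact_cones \<Sigma> q \<and> \<alpha> \<in> cones \<Sigma> d \<and> \<gamma> face_of \<alpha> \<and> \<tau> face_of \<alpha>}
        else {}))"

definition cap_class :: "(real^'n) set set \<Rightarrow> ((real^'n) set \<Rightarrow> (real^'n) list) \<Rightarrow>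
    ((real^'n) set \<Rightarrow> 'r::comm_ring_1) \<Rightarrow> nat \<Rightarrow> nat \<Rightarrow>
    ('n, 'r) cochain set \<Rightarrow> ('n, 'r) chain set"
  where "cap_class \<Sigma> b w p q K =
    (let d = fan_dim \<Sigma> in
      \<Union>u\<in>K. mod_rel (BM_cycles \<Sigma> b (d - p) (d - q)) (BM_boundaries \<Sigma> b (d - p) (d - q))
        `` {cap \<Sigma> b w p q u})"

text \<open>The cap product is \<open>R\<close>-linear, so it is an isomorphism iff it is bijective.\<close>

definition tropical_Poincare_duality ::
    "(real^'n) set set \<Rightarrow> ((real^'n) set \<Rightarrow> (real^'n) list) \<Rightarrow>
     ((real^'n) set \<Rightarrow> 'r::comm_ring_1) \<Rightarrow> bool"
  where "tropical_Poincare_duality \<Sigma> b w \<longleftrightarrow>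
    balanced \<Sigma> b w \<and>
    (\<forall>p\<le>fan_dim \<Sigma>. \<forall>q\<le>fan_dim \<Sigma>.
      bij_betw (cap_class \<Sigma> b w p q)
        (cohomology \<Sigma> b p q)
        (BM_homology \<Sigma> b (fan_dim \<Sigma> - p) (fan_dim \<Sigma> - q)))"


section \<open>Tropical hypersurfaces\<close>

text \<open>A Laurent polynomial is the family of its coefficients in \<open>\<real> \<union> {-\<infinity>}\<close>.\<close>

definition tropical_Laurent_polynomial :: "(int^'n \<Rightarrow> ereal) \<Rightarrow> bool"
  where "tropical_Laurent_polynomial f \<longleftrightarrow> finite {j. f j \<noteq> -\<infinity>} \<and> (\<forall>j. f j \<noteq> \<infinity>)"

definition exponents :: "(int^'n \<Rightarrow> ereal) \<Rightarrow> (int^'n) set"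
  where "exponents f = {j. f j \<noteq> -\<infinity>}"

definition real_vec :: "int^'n \<Rightarrow> real^'n"
  where "real_vec j = (\<chi> i. of_int (j $ i))"

definition trop_term :: "(int^'n \<Rightarrow> ereal) \<Rightarrow> int^'n \<Rightarrow> real^'n \<Rightarrow> real"
  where "trop_term f j x = real_of_ereal (f j) + real_vec j \<bullet> x"

definition trop_eval :: "(int^'n \<Rightarrow> ereal) \<Rightarrow> real^'n \<Rightarrow> real"
  where "trop_eval f x = Max ((\<lambda>j. trop_term f j x) ` exponents f)"

definition maximizers :: "(int^'n \<Rightarrow> ereal) \<Rightarrow> real^'n \<Rightarrow> (int^'n) set"
  where "maximizers f x = {j\<in>exponents f. trop_term f j x = trop_eval f x}"

definition trop_hypersurface :: "(int^'n \<Rightarrow> ereal) \<Rightarrow> (real^'n) set"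
  where "trop_hypersurface f = {x. card (maximizers f x) \<ge> 2}"

definition Newton_polytope :: "(int^'n \<Rightarrow> ereal) \<Rightarrow> (real^'n) set"
  where "Newton_polytope f = convex hull (real_vec ` exponents f)"

definition regular_subdivision :: "(int^'n \<Rightarrow> ereal) \<Rightarrow> (real^'n) set set"
  where "regular_subdivision f = {convex hull (real_vec ` maximizers f x) |x. True}"

definition dual_cell :: "(int^'n \<Rightarrow> ereal) \<Rightarrow> (real^'n) set \<Rightarrow> (real^'n) set"
  where "dual_cell f E = {x. E \<subseteq> convex hull (real_vec ` maximizers f x)}"

definition lattice_length :: "(real^'n) set \<Rightarrow> nat"
  where "lattice_length E = card (E \<inter> int_lattice) - 1"

text \<open>
  The weight of a full-dimensional subset of a maximal cell of the hypersurface: the lattice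
  length of the edge of the regular subdivision dual to that cell. If \<open>trop_hypersurface f\<close>
  is a translate of the support of a pure fan, each translated maximal cone lies in exactly one
  maximal cell.
\<close>

definition trop_weight :: "(int^'n \<Rightarrow> ereal) \<Rightarrow> (real^'n) set \<Rightarrow> nat"
  where "trop_weight f A = lattice_length
    (THE E. E \<in> regular_subdivision f \<and> aff_dim E = 1 \<and> A \<subseteq> dual_cell f E)"

end

theory Submission
  imports Defs "Jordan_Normal_Form.Determinant"
begin

text \<open>
  Let \<open>V\<close> be the set of exponents that are the unique maximizer of \<open>f\<close> at some point. Their convex
  hull is the Newton polytope (\<open>Newton_polytope_eq\<close>), so the claim is that \<open>V\<close> is affinely independent.

  As the hypersurface is a cone with apex \<open>x\<^sub>0\<close>, the polynomial \<open>f\<close> is, up to a constant, the support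
  function of \<open>V\<close> centered at \<open>x\<^sub>0\<close>. The fan \<open>\<Sigma>\<close> subdivides the set where two elements of \<open>V\<close> attain
  the maximum, and the complement falls into open convex cones, the regions, one for each element
  of \<open>V\<close> (\<open>max_fan_vertices\<close>). A facet, that is, a cone of dimension \<open>d = n - 1\<close>, separates two regions.

  The duality isomorphism that counts the vertices is the one for \<open>p = d\<close> and \<open>q = 0\<close>. Its target
  consists of the cycles among the functions on the set of facets, because \<open>F_0\<close> is constant and
  there are no cones of dimension \<open>d + 1\<close>. The boundary of the region of a vertex \<open>v\<close> is such a cycle
  (\<open>region_boundary_is_cycle\<close>, a statement on the plane transverse to a cone of codimension 2). By
  duality there is an additive function \<open>U\<close> on \<open>F_d\<close> of the vertex of \<open>\<Sigma>\<close> with values in the ring, such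
  that \<open>w(\<sigma>) U(\<Lambda>\<^sub>\<sigma>)\<close> is the coefficient of the facet \<open>\<sigma>\<close> in this cycle (\<open>region_potential\<close>).

  On the other hand, exterior vectors of degree \<open>n - 1\<close> are linear forms, and under this
  identification \<open>w(\<sigma>) \<Lambda>\<^sub>\<sigma>\<close> is up to sign the difference \<open>j - k\<close> of the vertices on the two sides of
  \<open>\<sigma>\<close>, because \<open>\<Lambda>\<^sub>\<sigma>\<close> is primitive and the weight is the lattice length of the edge from \<open>j\<close> to \<open>k\<close>.
  So \<open>U\<close> maps \<open>j - k\<close> to \<open>[j = v] - [k = v]\<close>. Since any two regions can be joined by crossing facets
  (\<open>facet_between\<close>), this holds for all \<open>j\<close> and \<open>k\<close> in \<open>V\<close>: the indicator function of \<open>v\<close> is the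
  restriction to \<open>V\<close> of an affine map.

  If \<open>V\<close> were affinely dependent, there would be a relation with coprime integral coefficients \<open>c\<close>.
  Applying \<open>U\<close> to it gives \<open>c(v) = 0\<close> in the ring for every \<open>v\<close>
  (\<open>integer_affine_relation_vanishes\<close>), and by coprimality \<open>1 = 0\<close>.
\<close>

(* The subscript notation is kept for the components of vectors in real^'n. *)
no_notation vec_index (infixl "$" 100)
hide_const (open) Determinant.det Matrix.vec

section \<open>Exterior products in Pluecker coordinates\<close>

text \<open>
  Pluecker coordinates are minors, so the multilinear algebra of \<^const>\<open>wedge\<close> reduces to
  determinants.
\<close>

lemma wedge_eq_det:
  assumes "length js = length vs"
  shows "wedge vs js =
    Determinant.det (Matrix.mat (length vs) (length vs) (\<lambda>(i, k). vs ! i $ (js ! k)))"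
proof -
  have "(\<Prod>i = 0..<length vs. Matrix.mat (length vs) (length vs) (\<lambda>(i, k). vs ! i $ (js ! k)) $$ (i, \<pi> i))
      = (\<Prod>i<length vs. vs ! i $ (js ! \<pi> i))" if "\<pi> permutes {..<length vs}" for \<pi>
  proof (rule prod.cong)
    show "{0..<length vs} = {..<length vs}" by auto
    fix i assume "i \<in> {..<length vs}"
    moreover have "\<pi> i < length vs" using that calculation permutes_in_image by fastforce
    ultimately show "Matrix.mat (length vs) (length vs) (\<lambda>(i, k). vs ! i $ (js ! k)) $$ (i, \<pi> i) = vs ! i $ (js ! \<pi> i)"
      by simp
  qed
  moreover have "{0..<length vs} = {..<length vs}" by auto
  ultimately show ?thesis
    using assms by (simp add: wedge_def Determinant.det_def)
qed

lemma wedge_length_neq: "length js \<noteq> length vs \<Longrightarrow> wedge vs js = 0"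
  by (simp add: wedge_def)

lemma wedge_change_of_basis:
  assumes "length us = length vs"
    and "\<And>i. i < length vs \<Longrightarrow> us ! i = (\<Sum>k<length vs. C i k *\<^sub>R vs ! k)"
  shows "wedge us js =
    Determinant.det (Matrix.mat (length vs) (length vs) (\<lambda>(i, k). C i k)) * wedge vs js"
proof (cases "length js = length vs")
  case True
  let ?p = "length vs"
  let ?C = "Matrix.mat ?p ?p (\<lambda>(i, k). C i k)"
  let ?V = "Matrix.mat ?p ?p (\<lambda>(i, k). vs ! i $ (js ! k))"
  have "Matrix.mat ?p ?p (\<lambda>(i, k). us ! i $ (js ! k)) = ?C * ?V"
  proof (rule eq_matI)
    fix i k assume "i < dim_row (?C * ?V)" "k < dim_col (?C * ?V)"
    then have ik: "i < ?p" "k < ?p" by auto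
    have "us ! i $ (js ! k) = (\<Sum>l<?p. C i l * vs ! l $ (js ! k))"
      using ik assms(2)[of i] by simp
    also have "\<dots> = (?C * ?V) $$ (i, k)"
      using ik by (simp add: scalar_prod_def lessThan_atLeast0)
    finally show "Matrix.mat ?p ?p (\<lambda>(i, k). us ! i $ (js ! k)) $$ (i, k) = (?C * ?V) $$ (i, k)"
      using ik by simp
  qed auto
  then show ?thesis
    using True assms(1) by (simp add: wedge_eq_det det_mult[where n = ?p])
next
  case False
  then show ?thesis using assms(1) by (simp add: wedge_length_neq)
qed

text \<open>
  Exterior multiplication by \<open>x\<close> from the left. In coordinates it is the Laplace expansion along
  the row of \<open>x\<close>. Being linear on all of \<open>'n ext\<close>, it applies to sums of decomposable vectors.
\<close>

definition ext_prod :: "real^'n \<Rightarrow> 'n ext \<Rightarrow> 'n ext"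
  where "ext_prod x \<omega> = (\<lambda>js. \<Sum>k<length js. (-1) ^ k * x $ (js ! k) * \<omega> (take k js @ drop (Suc k) js))"

lemma wedge_Cons:
  fixes x :: "real^'n"
  shows "wedge (x # vs) = ext_prod x (wedge vs)"
proof
  fix js :: "'n list"
  show "wedge (x # vs) js = ext_prod x (wedge vs) js"
  proof (cases "length js = Suc (length vs)")
    case True
    let ?m = "Suc (length vs)"
    let ?A = "Matrix.mat ?m ?m (\<lambda>(i, k). (x # vs) ! i $ (js ! k))"
    have minor: "mat_delete ?A 0 k =
        Matrix.mat (length vs) (length vs) (\<lambda>(i, l). vs ! i $ ((take k js @ drop (Suc k) js) ! l))"
      if "k < ?m" for k
      by (rule eq_matI) (use that True in \<open>auto simp: mat_delete_def nth_append min_def\<close>)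
    have "wedge (x # vs) js = Determinant.det ?A"
      using True by (simp add: wedge_eq_det)
    also have "\<dots> = (\<Sum>k<?m. ?A $$ (0, k) * cofactor ?A 0 k)"
      by (rule laplace_expansion_row) auto
    also have "\<dots> = (\<Sum>k<?m. (-1) ^ k * x $ (js ! k) * wedge vs (take k js @ drop (Suc k) js))"
      by (rule sum.cong) (use True in \<open>auto simp: cofactor_def minor wedge_eq_det\<close>)
    finally show ?thesis by (simp add: ext_prod_def True)
  next
    case False
    then have "wedge vs (take k js @ drop (Suc k) js) = 0" if "k < length js" for k
      using that by (intro wedge_length_neq) auto
    then show ?thesis using False by (simp add: wedge_length_neq ext_prod_def)
  qed
qed

lemma ext_prod_add_left: "ext_prod (x + y) \<omega> = ext_prod x \<omega> + ext_prod y \<omega>"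
  by (auto simp: ext_prod_def algebra_simps sum.distrib)

lemma ext_prod_scale_left: "ext_prod (c *\<^sub>R x) \<omega> = (\<lambda>js. c * ext_prod x \<omega> js)"
  by (auto simp: ext_prod_def sum_distrib_left mult_ac)

lemma ext_prod_add_right: "ext_prod x (\<omega> + \<eta>) = ext_prod x \<omega> + ext_prod x \<eta>"
  by (auto simp: ext_prod_def algebra_simps sum.distrib)

lemma ext_prod_scale_right: "ext_prod x (\<lambda>js. c * \<omega> js) = (\<lambda>js. c * ext_prod x \<omega> js)"
  by (auto simp: ext_prod_def sum_distrib_left mult_ac)

lemma ext_prod_0_right [simp]: "ext_prod x 0 = 0"
  by (auto simp: ext_prod_def)

lemma linear_ext_prod: "linear (\<lambda>x. ext_prod x \<omega> js)"
  by (rule linearI) (simp_all add: ext_prod_add_left ext_prod_scale_left)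

lemma linear_wedge: "linear (\<lambda>x. wedge (x # vs) js)"
  by (simp add: wedge_Cons linear_ext_prod)

lemma wedge_repeated:
  fixes x :: "real^'n"
  assumes "x \<in> set vs" shows "wedge (x # vs) = 0"
proof
  fix js :: "'n list"
  show "wedge (x # vs) js = 0 js"
  proof (cases "length js = Suc (length vs)")
    case True
    obtain i where i: "i < length vs" "vs ! i = x" using assms by (metis in_set_conv_nth)
    let ?m = "Suc (length vs)"
    have "Determinant.det (Matrix.mat ?m ?m (\<lambda>(i, k). (x # vs) ! i $ (js ! k))) = 0"
      by (rule det_identical_rows[where n = ?m and i = 0 and j = "Suc i"])
        (use i in \<open>auto intro!: eq_vecI\<close>)
    then show ?thesis using True by (simp add: wedge_eq_det)
  qed (simp add: wedge_length_neq)
qed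

lemma wedge_dependent:
  assumes "x \<in> span (set vs)" shows "wedge (x # vs) = 0"
proof
  fix js
  show "wedge (x # vs) js = 0 js"
    using linear_eq_0_on_span[OF linear_wedge[of vs js] _ assms] by (simp add: wedge_repeated)
qed

lemma wedge_swap: "wedge (x # y # vs) js = - wedge (y # x # vs) js"
proof -
  have *: "ext_prod u (ext_prod u (wedge vs)) js = 0" for u
    using wedge_repeated[of u "u # vs"] by (simp add: wedge_Cons)
  show ?thesis
    using *[of "x + y"] by (simp add: wedge_Cons ext_prod_add_left ext_prod_add_right *)
qed

lemma set_span_coordinates:
  assumes "x \<in> span (set vs)"
  obtains c where "x = (\<Sum>k<length vs. c k *\<^sub>R (vs ! k :: 'a::real_vector))"
proof -
  have "\<exists>c. x = (\<Sum>k<length vs. c k *\<^sub>R vs ! k)"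
    using assms
  proof (induction rule: span_induct_alt)
    case base
    show ?case by (rule exI[of _ "\<lambda>_. 0"]) simp
  next
    case (step a v y)
    obtain c where c: "y = (\<Sum>k<length vs. c k *\<^sub>R vs ! k)" using step by blast
    obtain i where i: "i < length vs" "vs ! i = v" using step by (metis in_set_conv_nth)
    have "(\<Sum>k<length vs. (c k + (if k = i then a else 0)) *\<^sub>R vs ! k)
        = y + (\<Sum>k<length vs. if k = i then a *\<^sub>R v else 0)"
      unfolding c sum.distrib[symmetric]
      by (intro sum.cong) (auto simp: scaleR_add_left i)
    then have "(\<Sum>k<length vs. (c k + (if k = i then a else 0)) *\<^sub>R vs ! k) = a *\<^sub>R v + y"
      using i by simp
    then show ?case by (intro exI[of _ "\<lambda>k. c k + (if k = i then a else 0)"]) simp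
  qed
  then show ?thesis using that by blast
qed

lemma wedge_proportional:
  assumes "length us = length vs" and "set us \<subseteq> span (set vs)"
  obtains \<kappa> where "wedge us = (\<lambda>js. \<kappa> * wedge vs js)"
proof -
  have "\<forall>i<length vs. \<exists>c. us ! i = (\<Sum>k<length vs. c k *\<^sub>R vs ! k)"
    using assms by (metis nth_mem set_span_coordinates subsetD)
  then obtain C where "\<And>i. i < length vs \<Longrightarrow> us ! i = (\<Sum>k<length vs. C i k *\<^sub>R vs ! k)"
    by metis
  then show ?thesis using that wedge_change_of_basis[OF assms(1)] by blast
qed

lemma group_closure_coordinates:
  assumes "x \<in> group_closure (set vs)"
  obtains c :: "nat \<Rightarrow> int" where "x = (\<Sum>k<length vs. of_int (c k) *\<^sub>R (vs ! k :: 'a::real_vector))"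
proof -
  have "\<exists>c :: nat \<Rightarrow> int. x = (\<Sum>k<length vs. of_int (c k) *\<^sub>R vs ! k)"
    using assms
  proof (induction rule: group_closure.induct)
    case (base s)
    show ?case
    proof (cases "s = 0")
      case True
      then show ?thesis by (intro exI[of _ "\<lambda>_. 0"]) simp
    next
      case False
      then obtain i where i: "i < length vs" "vs ! i = s" using base by (metis in_set_conv_nth insertE)
      have "(\<Sum>k<length vs. of_int (if k = i then 1 else 0) *\<^sub>R vs ! k)
        = (\<Sum>k<length vs. if k = i then s else 0)" using i by (intro sum.cong) auto
      then show ?thesis using i by (intro exI[of _ "\<lambda>k. if k = i then 1 else 0"]) simp
    qed
  next
    case (diff s t)
    then obtain c d :: "nat \<Rightarrow> int" where "s = (\<Sum>k<length vs. of_int (c k) *\<^sub>R vs ! k)"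
      "t = (\<Sum>k<length vs. of_int (d k) *\<^sub>R vs ! k)" by blast
    then have "s - t = (\<Sum>k<length vs. of_int (c k - d k) *\<^sub>R vs ! k)"
      by (simp add: sum_subtractf scaleR_diff_left)
    then show ?case by (intro exI)
  qed
  then show ?thesis using that by blast
qed

lemma det_Ints:
  assumes "\<And>i k. i < p \<Longrightarrow> k < p \<Longrightarrow> C i k \<in> (\<int> :: real set)"
  shows "Determinant.det (Matrix.mat p p (\<lambda>(i, k). C i k)) \<in> \<int>"
proof -
  have "(\<Prod>i = 0..<p. C i (\<pi> i)) \<in> \<int>" if "\<pi> permutes {0..<p}" for \<pi>
    by (intro Ints_prod assms) (use permutes_in_image[OF that] in auto)
  moreover have "(\<Prod>i = 0..<p. Matrix.mat p p (\<lambda>(i, k). C i k) $$ (i, \<pi> i)) = (\<Prod>i = 0..<p. C i (\<pi> i))"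
    if "\<pi> permutes {0..<p}" for \<pi>
    by (intro prod.cong) (use permutes_in_image[OF that] in auto)
  ultimately show ?thesis
    unfolding Determinant.det_def by (auto intro!: Ints_sum Ints_mult simp: sign_def)
qed

lemma wedge_integer_multiple:
  assumes "length us = length vs" and "set us \<subseteq> group_closure (set vs)"
  obtains \<kappa> where "\<kappa> \<in> \<int>" "wedge us = (\<lambda>js. \<kappa> * wedge vs js)"
proof -
  have "\<forall>i<length vs. \<exists>c :: nat \<Rightarrow> int. us ! i = (\<Sum>k<length vs. of_int (c k) *\<^sub>R vs ! k)"
    using assms by (metis nth_mem group_closure_coordinates subsetD)
  then obtain C :: "nat \<Rightarrow> nat \<Rightarrow> int"
    where "\<And>i. i < length vs \<Longrightarrow> us ! i = (\<Sum>k<length vs. of_int (C i k) *\<^sub>R vs ! k)"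
    by metis
  then have "wedge us = (\<lambda>js.
      Determinant.det (Matrix.mat (length vs) (length vs) (\<lambda>(i, k). of_int (C i k))) * wedge vs js)"
    using wedge_change_of_basis[OF assms(1), of "\<lambda>i k. of_int (C i k)"] by blast
  then show ?thesis
    by (rule that[rotated]) (intro det_Ints, simp)
qed

lemma wedge_Ints:
  assumes "set vs \<subseteq> int_lattice" shows "wedge vs js \<in> \<int>"
proof (cases "length js = length vs")
  case True
  have "vs ! i $ l \<in> \<int>" if "i < length vs" for i l
    using assms that nth_mem unfolding int_lattice_def by blast
  then show ?thesis by (auto simp: wedge_eq_det[OF True] intro: det_Ints)
qed (simp add: wedge_length_neq)

text \<open>
  A fixed enumeration of the coordinate indices. The value of an exterior vector of top degree at
  \<open>coords\<close> is its coefficient with respect to the volume form \<open>wedge axes\<close>.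
\<close>

definition coords :: "'n::finite list"
  where "coords = (SOME js. distinct js \<and> set js = UNIV)"

lemma coords: "distinct (coords :: 'n::finite list)" "set (coords :: 'n list) = UNIV"
proof -
  have "\<exists>js :: 'n list. distinct js \<and> set js = UNIV"
    using finite_distinct_list[OF finite[of UNIV]] by blast
  from someI_ex[OF this] show "distinct (coords :: 'n list)" "set (coords :: 'n list) = UNIV"
    unfolding coords_def by blast+
qed

lemma length_coords: "length (coords :: 'n::finite list) = CARD('n)"
  using coords distinct_card by metis

definition axes :: "(real^'n) list"
  where "axes = map (\<lambda>i. axis i 1) coords"

lemma length_axes: "length (axes :: (real^'n) list) = CARD('n)"
  by (simp add: axes_def length_coords)

lemma set_axes: "set axes = Basis"
  by (auto simp: axes_def coords Basis_vec_def)

lemma wedge_axes_coords: "wedge axes (coords :: 'n::finite list) = 1"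
proof -
  have "Matrix.mat CARD('n) CARD('n) (\<lambda>(i, k). axes ! i $ (coords ! k :: 'n)) = (1\<^sub>m CARD('n) :: real mat)"
    by (rule eq_matI) (auto simp: axes_def axis_def length_coords nth_eq_iff_index_eq[OF coords(1)])
  then show ?thesis by (simp add: wedge_eq_det length_coords length_axes)
qed

lemma wedge_top:
  fixes vs :: "(real^'n) list"
  assumes "length vs = CARD('n)"
  shows "wedge vs = (\<lambda>js. wedge vs coords * wedge axes js)"
proof -
  obtain \<kappa> where "wedge vs = (\<lambda>js. \<kappa> * wedge axes js)"
    by (rule wedge_proportional[of vs axes]) (auto simp: assms length_axes set_axes)
  then show ?thesis by (simp add: wedge_axes_coords)
qed

text \<open>
  Prepend vectors that complete \<open>vs\<close> to a basis. A multiple of the wedge of that basis is the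
  volume form, which is nonzero, and exterior multiplication maps 0 to 0.
\<close>

lemma wedge_nonzero:
  fixes vs :: "(real^'n) list"
  assumes "distinct vs" "independent (set vs)"
  shows "wedge vs \<noteq> 0"
  using assms
proof (induction "CARD('n) - length vs" arbitrary: vs)
  case 0
  have "length vs = dim (set vs)"
    using 0 by (simp add: dim_eq_card_independent distinct_card)
  moreover have "dim (set vs) \<le> CARD('n)" using dim_subset_UNIV[of "set vs"] by simp
  ultimately have len: "length vs = CARD('n)" "dim (set vs) = DIM(real^'n)" using 0 by auto
  then have "span (set vs) = UNIV" using dim_eq_full by blast
  then obtain \<kappa> where "wedge axes = (\<lambda>js. \<kappa> * wedge vs js)"
    using wedge_proportional[of axes vs] len by (auto simp: length_axes)
  then have "1 = \<kappa> * wedge vs coords" using wedge_axes_coords by metis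
  then show ?case by (metis mult_zero_right zero_fun_apply zero_neq_one)
next
  case (Suc m)
  have "dim (set vs) = length vs"
    using Suc.prems by (simp add: dim_eq_card_independent distinct_card)
  then have "dim (set vs) \<noteq> DIM(real^'n)" using Suc.hyps(2) by simp
  then obtain x where x: "x \<notin> span (set vs)" using dim_eq_full by blast
  then have "wedge (x # vs) \<noteq> 0"
    using Suc by (intro Suc.hyps(1)) (auto simp: independent_insert intro: span_base)
  then show ?case by (metis wedge_Cons ext_prod_0_right)
qed

lemma wedge_Cons_coords_eq_0_iff:
  fixes vs :: "(real^'n) list"
  assumes "distinct vs" "independent (set vs)" "Suc (length vs) = CARD('n)"
  shows "wedge (x # vs) coords = 0 \<longleftrightarrow> x \<in> span (set vs)"
proof
  assume 0: "wedge (x # vs) coords = 0"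
  have "wedge (x # vs) = (\<lambda>js. wedge (x # vs) coords * wedge axes js)"
    using assms by (intro wedge_top) simp
  then have "wedge (x # vs) = 0" by (auto simp: 0)
  then show "x \<in> span (set vs)"
    using wedge_nonzero[of "x # vs"] assms by (auto simp: independent_insert intro: span_base)
qed (simp add: wedge_dependent)

text \<open>
  The linear form \<open>x \<mapsto> wedge (x # vs) coords\<close> has kernel \<open>span (set vs)\<close>. A lattice vector \<open>x\<close> with
  the least positive value completes \<open>vs\<close> to a basis of the lattice, by division with remainder.
  Passing to the standard basis has an integral determinant, so that value divides 1. In other
  words, the form is a primitive integral defining form of \<open>span (set vs)\<close>.
\<close>

lemma saturated_basis_extends:
  fixes vs :: "(real^'n) list"
  assumes "distinct vs" "independent (set vs)" "Suc (length vs) = CARD('n)"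
    and sat: "group_closure (set vs) = int_lattice \<inter> span (set vs)"
  obtains x where "x \<in> int_lattice" "\<bar>wedge (x # vs) coords\<bar> = 1"
proof -
  define D where "D x = wedge (x # vs) coords" for x
  have lin: "linear D" unfolding D_def by (rule linear_wedge)
  have vs: "set vs \<subseteq> int_lattice" using sat by (auto intro: group_closure.base)
  have D_Ints: "D x \<in> \<int>" if "x \<in> int_lattice" for x
    unfolding D_def using that vs by (intro wedge_Ints) auto
  have axes_int: "set axes \<subseteq> (int_lattice :: (real^'n) set)"
    by (auto simp: axes_def int_lattice_def axis_def)
  have "\<exists>x\<in>set axes. D x \<noteq> 0"
  proof (rule ccontr)
    assume "\<not> ?thesis"
    then have "D x = 0" for x
      using linear_eq_0_on_span[OF lin, of Basis x] by (auto simp: set_axes)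
    then have "span (set vs) = UNIV"
      using wedge_Cons_coords_eq_0_iff[OF assms(1-3)] by (auto simp: D_def)
    then have "dim (set vs) = DIM(real^'n)" using dim_eq_full by blast
    then show False using assms by (simp add: dim_eq_card_independent distinct_card)
  qed
  then obtain x\<^sub>0 where x\<^sub>0: "x\<^sub>0 \<in> int_lattice" "D x\<^sub>0 \<noteq> 0" using axes_int by blast
  define P where "P m \<longleftrightarrow> m > 0 \<and> (\<exists>x\<in>int_lattice. D x = of_nat m)" for m
  have minus: "- x \<in> int_lattice" if "x \<in> int_lattice" for x :: "real^'n"
    using that by (auto simp: int_lattice_def)
  have "\<exists>m. P m"
  proof -
    obtain z where z: "D x\<^sub>0 = of_int z" using D_Ints x\<^sub>0 by (metis Ints_cases)
    have "D (if z > 0 then x\<^sub>0 else - x\<^sub>0) = of_nat (nat \<bar>z\<bar>)"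
      using z by (auto simp: linear_neg[OF lin])
    moreover have "nat \<bar>z\<bar> > 0" using z x\<^sub>0 by auto
    ultimately show ?thesis unfolding P_def
      by (intro exI[of _ "nat \<bar>z\<bar>"] conjI bexI[of _ "if z > 0 then x\<^sub>0 else - x\<^sub>0"])
        (use x\<^sub>0 minus in auto)
  qed
  define m where "m = (LEAST m. P m)"
  have "P m" unfolding m_def using \<open>\<exists>m. P m\<close> by (rule LeastI_ex)
  then obtain x where m: "m > 0" and x: "x \<in> int_lattice" "D x = of_nat m" by (auto simp: P_def)
  have "y \<in> group_closure (insert x (set vs))" if y: "y \<in> int_lattice" for y
  proof -
    obtain z where z: "D y = of_int z" using D_Ints y by (metis Ints_cases)
    define y' where "y' = y - of_int (z div int m) *\<^sub>R x"
    have int: "y' \<in> int_lattice" using x y by (auto simp: y'_def int_lattice_def)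
    have "z - z div int m * int m = z mod int m" by (simp add: minus_div_mult_eq_mod)
    then have "D y' = of_int (z mod int m)"
      unfolding y'_def linear_diff[OF lin] linear_scale[OF lin] z x(2) real_scaleR_def
      by (metis of_int_diff of_int_mult of_int_of_nat_eq)
    then have "D y' = of_nat (nat (z mod int m))" using m by simp
    moreover have "\<not> P (nat (z mod int m))"
      using m not_less_Least[of "nat (z mod int m)" P] unfolding m_def[symmetric] by (simp add: nat_less_iff)
    ultimately have "nat (z mod int m) = 0" using int unfolding P_def by (metis gr0I)
    then have "D y' = 0" using \<open>D y' = of_nat (nat (z mod int m))\<close> by simp
    then have "y' \<in> span (set vs)"
      using wedge_Cons_coords_eq_0_iff[OF assms(1-3)] by (simp add: D_def)
    then have "y' \<in> group_closure (set vs)" using int sat by blast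
    then have 1: "y' \<in> group_closure (insert x (set vs))"
      by (induction rule: group_closure.induct) (auto intro: group_closure.intros)
    have nat: "of_nat k *\<^sub>R x \<in> group_closure (insert x (set vs))" for k
      by (induction k) (auto simp: scaleR_add_left intro: group_closure_add group_closure.base)
    have "of_int k *\<^sub>R x \<in> group_closure (insert x (set vs))" for k
      using nat[of "nat k"] nat[of "nat (- k)"] by (cases "k \<ge> 0") auto
    then have "y' + of_int (z div int m) *\<^sub>R x \<in> group_closure (insert x (set vs))"
      using 1 group_closure_add by blast
    then show ?thesis by (simp add: y'_def)
  qed
  then have "set axes \<subseteq> group_closure (set (x # vs))" using axes_int by auto
  then obtain \<kappa> where \<kappa>: "\<kappa> \<in> \<int>" "wedge axes = (\<lambda>js. \<kappa> * wedge (x # vs) js)"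
    using wedge_integer_multiple[of axes "x # vs"] assms(3) by (metis length_Cons length_axes)
  then have "1 = \<kappa> * of_nat m" using x by (metis D_def wedge_axes_coords)
  moreover obtain k where "\<kappa> = of_int k" using \<kappa>(1) by (metis Ints_cases)
  ultimately have "k * int m = 1" by (metis of_int_1 of_int_eq_iff of_int_mult of_int_of_nat_eq)
  then have "int m dvd 1" by (metis dvd_triv_right)
  then have "m = 1" by simp
  then show ?thesis using that[of x] x by (simp add: D_def)
qed

text \<open>
  A tuple that misses the index \<open>i\<close> can be recovered after multiplication by the \<open>i\<close>-th unit
  vector. In degree \<open>n - 1\<close> every tuple misses an index, so the lemma is the injectivity of the
  identification of exterior vectors of degree \<open>n - 1\<close> with linear forms.
\<close>

lemma ext_eq_0_if_ext_prods_eq_0: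
  assumes "\<And>x. ext_prod x \<omega> = 0" and "set js \<noteq> (UNIV :: 'n::finite set)"
  shows "\<omega> js = 0"
proof -
  obtain i where i: "i \<notin> set js" using assms(2) by blast
  have "0 = ext_prod (axis i 1) \<omega> (i # js)" by (simp add: assms(1))
  also have "\<dots> = (\<Sum>k<Suc (length js). if k = 0 then \<omega> js else 0)"
    unfolding ext_prod_def length_Cons
    by (intro sum.cong refl) (use i in \<open>auto simp: axis_def nth_Cons split: nat.splits\<close>)
  also have "\<dots> = \<omega> js" by simp
  finally show ?thesis by simp
qed

text \<open>
  The list \<open>ts\<close> spans a subspace of codimension 2. The form \<open>wedge (x # y # ts) coords\<close> in \<open>x\<close> and
  \<open>y\<close> is the orientation form of the quotient plane.
\<close>

context
  fixes ts :: "(real^'n) list"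
  assumes ts: "distinct ts" "independent (set ts)" "Suc (Suc (length ts)) = CARD('n)"
begin

lemma plane_dependent:
  assumes "wedge (x # y # ts) coords = 0" and "y \<notin> span (set ts)"
  obtains a where "x - a *\<^sub>R y \<in> span (set ts)"
proof -
  have "x \<in> span (set (y # ts))"
    using assms ts wedge_Cons_coords_eq_0_iff[of "y # ts" x]
    by (auto simp: independent_insert intro: span_base)
  then show ?thesis using that by (auto simp: span_breakdown_eq)
qed

text \<open>
  Cramer's rule in the quotient plane: pairing the left-hand side with \<open>c\<close> and with \<open>s\<close>
  gives 0, and these two vectors span the plane.
\<close>

lemma plane_cramer:
  assumes "wedge (c # s # ts) coords \<noteq> 0"
  shows "wedge (s # s' # ts) coords *\<^sub>R c - wedge (c # s' # ts) coords *\<^sub>R s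
    + wedge (c # s # ts) coords *\<^sub>R s' \<in> span (set ts)" (is "?v \<in> _")
proof -
  define B where "B x y = wedge (x # y # ts) coords" for x y
  have lin: "linear (\<lambda>x. B x y)" for y unfolding B_def by (rule linear_wedge)
  have swap: "B x y = - B y x" for x y unfolding B_def by (rule wedge_swap)
  have "B x x = 0" for x using swap[of x x] by simp
  have T: "B t y = 0" if "t \<in> span (set ts)" for t y
    unfolding B_def using that by (subst wedge_dependent) (auto intro: set_rev_mp[OF _ span_mono])
  have v: "?v = B s s' *\<^sub>R c - B c s' *\<^sub>R s + B c s *\<^sub>R s'" by (simp add: B_def)
  have c: "c \<notin> span (set ts)" using T[of c s] assms by (auto simp: B_def)
  have "B ?v c = 0" "B ?v s = 0"
    unfolding v linear_diff[OF lin] linear_add[OF lin] linear_scale[OF lin]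
    using swap[of s c] swap[of s' c] swap[of s' s] \<open>\<And>x. B x x = 0\<close> by simp_all
  obtain a where a: "?v - a *\<^sub>R c \<in> span (set ts)"
    using plane_dependent[of ?v c] \<open>B ?v c = 0\<close> c by (auto simp: B_def)
  have "0 = B (?v - a *\<^sub>R c) s" using T[OF a] by simp
  also have "\<dots> = - a * B c s"
    using \<open>B ?v s = 0\<close> by (simp add: linear_diff[OF lin] linear_scale[OF lin])
  finally have "a = 0" using assms by (simp add: B_def)
  then show ?thesis using a by simp
qed

end

section \<open>Tensor products as cosets of formal sums\<close>

lemma group_closure_mono: "S \<subseteq> T \<Longrightarrow> group_closure S \<subseteq> group_closure T"
proof
  fix x assume "S \<subseteq> T" "x \<in> group_closure S"
  from this(2,1) show "x \<in> group_closure T"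
    by (induction rule: group_closure.induct) (auto intro: group_closure.intros)
qed

lemma group_closure_idem: "group_closure (group_closure S) = group_closure S"
proof
  show "group_closure (group_closure S) \<subseteq> group_closure S"
  proof
    fix x assume "x \<in> group_closure (group_closure S)"
    then show "x \<in> group_closure S"
      by (induction rule: group_closure.induct) (auto intro: group_closure.diff)
  qed
qed (auto intro: group_closure.base)

lemma tensor_rels_0 [simp]: "0 \<in> tensor_rels M"
  by (simp add: tensor_rels_def)

lemma tensor_rels_add: "s \<in> tensor_rels M \<Longrightarrow> t \<in> tensor_rels M \<Longrightarrow> s + t \<in> tensor_rels M"
  by (simp add: tensor_rels_def group_closure_add)

lemma rels_plus_rels:
  assumes "(tensor_rels M' :: ('m::ab_group_add \<Rightarrow>\<^sub>0 'r::comm_ring_1) set) \<subseteq> tensor_rels M"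
  shows "(tensor_rels M' :: ('m \<Rightarrow>\<^sub>0 'r) set) + tensor_rels M = tensor_rels M"
    (is "?A + ?B = ?B")
proof
  show "?A + ?B \<subseteq> ?B"
  proof
    fix t assume "t \<in> ?A + ?B"
    then obtain a b where "t = a + b" "a \<in> ?A" "b \<in> ?B"
      by (rule set_plus_elim)
    then show "t \<in> ?B" using assms by (simp add: tensor_rels_add subsetD)
  qed
  show "?B \<subseteq> ?A + ?B"
    using set_zero_plus2[of ?A ?B] by simp
qed

lemma coset_plus: "(s +o tensor_rels M) + (t +o tensor_rels M) = (s + t) +o tensor_rels M"
  by (simp add: set_plus_rearrange rels_plus_rels)

lemma coset_plus_rels: "(t +o tensor_rels M) + tensor_rels M = t +o tensor_rels M"
  by (simp add: set_plus_rearrange3 rels_plus_rels)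

lemma coset_eq_iff: "s +o tensor_rels M = t +o tensor_rels M \<longleftrightarrow> s - t \<in> tensor_rels M"
proof
  assume eq: "s +o tensor_rels M = t +o tensor_rels M"
  have "s + 0 \<in> s +o tensor_rels M" unfolding tensor_rels_def by (intro set_plus_intro2) simp
  then have "s \<in> t +o tensor_rels M" using eq by simp
  then show "s - t \<in> tensor_rels M" by (auto simp: elt_set_plus_def)
next
  assume diff: "s - t \<in> tensor_rels M"
  have sub: "a +o tensor_rels M \<subseteq> b +o tensor_rels M" if "a - b \<in> tensor_rels M"
    for a b :: "'a \<Rightarrow>\<^sub>0 'b"
  proof
    fix x assume "x \<in> a +o tensor_rels M"
    then obtain h where h: "h \<in> tensor_rels M" "x = a + h" by (auto simp: elt_set_plus_def)
    then have "(a - b) + h \<in> tensor_rels M"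
      using that unfolding tensor_rels_def by (intro group_closure_add)
    moreover have "x = b + ((a - b) + h)" using h by simp
    ultimately show "x \<in> b +o tensor_rels M" by blast
  qed
  moreover have "t - s \<in> tensor_rels M"
    using diff group_closure_minus_iff[of "s - t"] unfolding tensor_rels_def minus_diff_eq by blast
  ultimately show "s +o tensor_rels M = t +o tensor_rels M" using diff by blast
qed

lemma sum_cosets:
  assumes "finite I"
  shows "(\<Sum>i\<in>I. t i +o tensor_rels M) + tensor_rels M = (\<Sum>i\<in>I. t i) +o tensor_rels M"
  using assms
proof (induction rule: finite_induct)
  case empty
  then show ?case by (auto simp: elt_set_plus_def)
next
  case (insert i I)
  then show ?case by (simp add: add.assoc coset_plus)
qed

lemma pure_tensor_in_tensor: "x \<in> M \<Longrightarrow> pure_tensor M x r \<in> tensor M"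
  unfolding tensor_def pure_tensor_def
  by (rule CollectI, rule exI[of _ "Poly_Mapping.single x r"]) simp

lemma pure_tensor_add:
  assumes "x \<in> M" "y \<in> M"
  shows "pure_tensor M (x + y) r = pure_tensor M x r + pure_tensor M y r"
proof -
  have "Poly_Mapping.single (x + y) r - Poly_Mapping.single x r - Poly_Mapping.single y r \<in> tensor_rels M"
    unfolding tensor_rels_def using assms by (intro group_closure.base) blast
  then show ?thesis
    by (simp add: pure_tensor_def coset_plus coset_eq_iff diff_diff_eq)
qed

lemma pure_tensor_zero: "pure_tensor M x 0 = tensor_rels M"
  by (auto simp: pure_tensor_def elt_set_plus_def)

lemma tensor_sum_pure:
  assumes "finite I"
  shows "tensor_sum M (\<lambda>i. pure_tensor M x (r i)) I = pure_tensor M x (\<Sum>i\<in>I. r i)"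
proof -
  have "(\<Sum>i\<in>I. Poly_Mapping.single x (r i)) = Poly_Mapping.single x (\<Sum>i\<in>I. r i)"
    using assms by (induction rule: finite_induct) (auto simp: single_add)
  then show ?thesis
    by (simp add: tensor_sum_def pure_tensor_def sum_cosets[OF assms])
qed

lemma tensor_incl_pure:
  assumes "M' \<subseteq> M"
  shows "tensor_incl M (pure_tensor M' x r) = pure_tensor M x r"
proof -
  have "tensor_rels M' \<subseteq> (tensor_rels M :: ('a \<Rightarrow>\<^sub>0 'b) set)"
    unfolding tensor_rels_def using assms by (intro group_closure_mono) blast
  then show ?thesis
    by (simp add: tensor_incl_def pure_tensor_def set_plus_rearrange3 rels_plus_rels)
qed

lemma map_times_single:
  "Poly_Mapping.map ((*) r) (Poly_Mapping.single x s) = Poly_Mapping.single x (r * s :: _ :: comm_ring_1)"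
  by (rule poly_mapping_eqI) (auto simp: Poly_Mapping.map.rep_eq lookup_single when_def)

lemma map_times_diff:
  "Poly_Mapping.map ((*) r) (s - t) =
    Poly_Mapping.map ((*) r) s - Poly_Mapping.map ((*) (r::'r::comm_ring_1)) t"
  by (rule poly_mapping_eqI) (auto simp: Poly_Mapping.map.rep_eq lookup_minus when_def algebra_simps)

lemma map_times_add:
  "Poly_Mapping.map ((*) r) (s + t) =
    Poly_Mapping.map ((*) r) s + Poly_Mapping.map ((*) (r::'r::comm_ring_1)) t"
  by (rule poly_mapping_eqI) (auto simp: Poly_Mapping.map.rep_eq lookup_add when_def distrib_left[symmetric])

lemma map_times_rels:
  assumes "t \<in> tensor_rels M" shows "Poly_Mapping.map ((*) r) t \<in> tensor_rels M"
  using assms unfolding tensor_rels_def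
proof (induction rule: group_closure.induct)
  case (base s)
  then show ?case
    by (auto simp: map_times_diff map_times_single intro!: group_closure.base)
      (auto intro!: poly_mapping_eqI simp: Poly_Mapping.map.rep_eq when_def)
next
  case (diff s t)
  then show ?case by (simp add: map_times_diff group_closure.diff)
qed

lemma tensor_scale_pure: "tensor_scale M r (pure_tensor M x s) = pure_tensor M x (r * s)"
proof -
  let ?H = "tensor_rels M :: ('a \<Rightarrow>\<^sub>0 'b) set"
  have map: "Poly_Mapping.map ((*) r) (Poly_Mapping.single x s + h)
      = Poly_Mapping.single x (r * s) + Poly_Mapping.map ((*) r) h" for h
    by (simp add: map_times_add map_times_single)
  have "Poly_Mapping.map ((*) r) ` (Poly_Mapping.single x s +o ?H) + ?H
      \<subseteq> Poly_Mapping.single x (r * s) +o (?H + ?H)"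
  proof
    fix t assume "t \<in> Poly_Mapping.map ((*) r) ` (Poly_Mapping.single x s +o ?H) + ?H"
    then obtain h k where "h \<in> ?H" "k \<in> ?H"
      "t = Poly_Mapping.map ((*) r) (Poly_Mapping.single x s + h) + k"
      by (auto simp: elt_set_plus_def set_plus_def)
    then have "t = Poly_Mapping.single x (r * s) + (Poly_Mapping.map ((*) r) h + k)"
      "Poly_Mapping.map ((*) r) h \<in> ?H"
      by (simp_all add: map add.assoc map_times_rels)
    then show "t \<in> Poly_Mapping.single x (r * s) +o (?H + ?H)"
      using \<open>k \<in> ?H\<close> by blast
  qed
  moreover have "Poly_Mapping.single x (r * s) +o ?H
      \<subseteq> Poly_Mapping.map ((*) r) ` (Poly_Mapping.single x s +o ?H) + ?H"
  proof
    fix t assume "t \<in> Poly_Mapping.single x (r * s) +o ?H"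
    then obtain h where h: "h \<in> ?H" "t = Poly_Mapping.single x (r * s) + h"
      by (auto simp: elt_set_plus_def)
    have "0 \<in> ?H" unfolding tensor_rels_def by simp
    then have "Poly_Mapping.single x s + 0 \<in> Poly_Mapping.single x s +o ?H" by (rule set_plus_intro2)
    then have "Poly_Mapping.single x (r * s) \<in> Poly_Mapping.map ((*) r) ` (Poly_Mapping.single x s +o ?H)"
      by (metis add_0_right imageI map_times_single)
    then show "t \<in> Poly_Mapping.map ((*) r) ` (Poly_Mapping.single x s +o ?H) + ?H"
      using h by blast
  qed
  ultimately show ?thesis
    by (simp add: tensor_scale_def pure_tensor_def rels_plus_rels)
qed

text \<open>
  An additive map \<open>\<phi>\<close> to the integers induces the evaluation \<open>\<Sum> r\<^sub>i [x\<^sub>i] \<mapsto> \<Sum> \<phi>(x\<^sub>i) r\<^sub>i\<close> of formal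
  sums. It kills the relations and maps \<open>r [e]\<close> to \<open>r\<close>.
\<close>

lemma pure_tensor_inject:
  fixes \<phi> :: "'m::ab_group_add \<Rightarrow> int" and r s :: "'r::comm_ring_1"
  assumes add: "\<And>x y. x \<in> M \<Longrightarrow> y \<in> M \<Longrightarrow> \<phi> (x + y) = \<phi> x + \<phi> y"
    and "\<phi> e = 1" and eq: "pure_tensor M e r = pure_tensor M e s"
  shows "r = s"
proof -
  define E :: "('m \<Rightarrow>\<^sub>0 'r) \<Rightarrow> 'r"
    where "E t = (\<Sum>x\<in>Poly_Mapping.keys t. of_int (\<phi> x) * poly_mapping.lookup t x)" for t
  have E: "E t = (\<Sum>x\<in>A. of_int (\<phi> x) * poly_mapping.lookup t x)" if "finite A" "Poly_Mapping.keys t \<subseteq> A" for t A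
    unfolding E_def using that by (intro sum.mono_neutral_left) (auto simp: in_keys_iff)
  have E_diff: "E (t - t') = E t - E t'" for t t'
  proof -
    let ?A = "Poly_Mapping.keys t \<union> Poly_Mapping.keys t'"
    have "E (t - t') = (\<Sum>x\<in>?A. of_int (\<phi> x) * poly_mapping.lookup (t - t') x)"
      by (rule E) (auto simp: in_keys_iff lookup_minus)
    also have "\<dots> = (\<Sum>x\<in>?A. of_int (\<phi> x) * poly_mapping.lookup t x) - (\<Sum>x\<in>?A. of_int (\<phi> x) * poly_mapping.lookup t' x)"
      by (simp add: lookup_minus algebra_simps sum_subtractf)
    also have "\<dots> = E t - E t'" by (simp add: E[of ?A])
    finally show ?thesis .
  qed
  have E_single: "E (Poly_Mapping.single x a) = of_int (\<phi> x) * a" for x a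
    using E[of "{x}" "Poly_Mapping.single x a"] by simp
  have E_rels: "E t = 0" if "t \<in> tensor_rels M" for t
    using that unfolding tensor_rels_def
  proof (induction rule: group_closure.induct)
    case (base t)
    then consider "t = 0" | x y r where "x \<in> M" "y \<in> M"
      "t = Poly_Mapping.single (x + y) r - Poly_Mapping.single x r - Poly_Mapping.single y r"
      by blast
    then show ?case
    proof cases
      case 1
      then show ?thesis by (simp add: E_def)
    next
      case 2
      show ?thesis unfolding 2(3) using 2(1,2)
        by (simp only: E_diff E_single add of_int_add) (simp add: algebra_simps)
    qed
  next
    case (diff t t')
    then show ?case by (simp add: E_diff)
  qed
  have "Poly_Mapping.single e r - Poly_Mapping.single e s \<in> tensor_rels M"
    using eq by (simp add: pure_tensor_def coset_eq_iff)
  from E_rels[OF this] show ?thesis by (simp add: E_diff E_single assms(2))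
qed

lemma tensor_dual_additive:
  assumes "u \<in> tensor_dual M" "x \<in> M" "y \<in> M"
  shows "u (pure_tensor M (x + y) 1) = u (pure_tensor M x 1) + u (pure_tensor M y 1)"
  using assms by (simp add: pure_tensor_add tensor_dual_def pure_tensor_in_tensor)

section \<open>Rational cones and fans\<close>

lemma rational_coneD:
  assumes "rational_cone \<sigma>"
  shows "convex \<sigma>" "closed \<sigma>" "conic \<sigma>" "0 \<in> \<sigma>" "\<And>x. x \<in> \<sigma> \<Longrightarrow> - x \<in> \<sigma> \<Longrightarrow> x = 0"
  using assms convex_convex_cone_hull closed_convex_cone_hull conic_convex_cone_hull
    convex_cone_hull_contains_0
  unfolding rational_cone_def by blast+

text \<open>
  The cone is generated by lattice vectors, so its lattice spans the same space as the cone.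
\<close>

lemma span_lattice_basis:
  assumes "rational_cone \<sigma>" "lattice_basis (cone_lattice \<sigma>) vs"
  shows "span (set vs) = span \<sigma>"
proof
  have vs: "group_closure (set vs) = int_lattice \<inter> span \<sigma>"
    using assms by (simp add: lattice_basis_def cone_lattice_def)
  then have "set vs \<subseteq> span \<sigma>" by (auto intro: group_closure.base)
  then show "span (set vs) \<subseteq> span \<sigma>" by (simp add: span_minimal)
  have gc: "group_closure (set vs) \<subseteq> span (set vs)"
  proof
    fix x assume "x \<in> group_closure (set vs)"
    then show "x \<in> span (set vs)"
      by (induction rule: group_closure.induct) (auto intro: span_base span_diff span_zero)
  qed
  obtain G where G: "G \<subseteq> int_lattice" "\<sigma> = convex_cone hull G"
    using assms unfolding rational_cone_def by blast
  have "G \<subseteq> \<sigma>" unfolding G(2) by (rule hull_subset)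
  then have "G \<subseteq> int_lattice \<inter> span \<sigma>" using G(1) span_superset by blast
  then have "G \<subseteq> span (set vs)" using vs gc by blast
  moreover have "convex_cone (span (set vs))"

    by (rule convex_cone_span)
  ultimately have "\<sigma> \<subseteq> span (set vs)" unfolding G(2) by (rule hull_minimal)
  then show "span \<sigma> \<subseteq> span (set vs)" by (simp add: span_minimal)
qed

lemma length_lattice_basis:
  assumes "rational_cone \<sigma>" "lattice_basis (cone_lattice \<sigma>) vs"
  shows "length vs = dim \<sigma>"
  using span_lattice_basis[OF assms] assms(2) dim_span
  by (metis lattice_basis_def dim_eq_card_independent distinct_card)

lemma affine_hull_cone: "0 \<in> \<sigma> \<Longrightarrow> affine hull \<sigma> = span \<sigma>"
  by (simp add: affine_hull_span_0 hull_inc)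

lemma aff_dim_cone: "0 \<in> \<sigma> \<Longrightarrow> aff_dim \<sigma> = int (dim \<sigma>)"
  by (simp add: aff_dim_zero hull_inc)

lemma dim_face_less:
  assumes "rational_cone \<sigma>" "0 \<in> \<tau>" "\<tau> face_of \<sigma>" "\<tau> \<noteq> \<sigma>"
  shows "dim \<tau> < dim \<sigma>"
  using face_of_aff_dim_lt[OF _ assms(3,4)] assms(1,2) rational_coneD[OF assms(1)]
  by (simp add: aff_dim_cone)

lemma rel_interior_notin_span_face:
  assumes "rational_cone \<sigma>" "0 \<in> \<tau>" "\<tau> face_of \<sigma>" "\<tau> \<noteq> \<sigma>" "s \<in> rel_interior \<sigma>"
  shows "s \<notin> span \<tau>"
proof
  assume "s \<in> span \<tau>"
  then have "s \<in> \<tau>"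
    using face_of_imp_eq_affine_Int[OF _ assms(3)] assms rational_coneD[OF assms(1)] rel_interior_subset
    by (metis IntI affine_hull_cone subsetD)
  then have "\<sigma> \<subseteq> \<tau>" using subset_of_face_of[OF assms(3), of \<sigma>] assms(5) by (auto simp: disjnt_iff)
  then show False using assms face_of_imp_subset by blast
qed

locale rational_fan =
  fixes \<Sigma> :: "(real^'n) set set"
  assumes fan: "fan \<Sigma>"
begin

lemma finite_fan: "finite \<Sigma>"
  and fan_nonempty: "\<Sigma> \<noteq> {}"
  and rational_cone_fan: "\<sigma> \<in> \<Sigma> \<Longrightarrow> rational_cone \<sigma>"
  and fan_face: "\<sigma> \<in> \<Sigma> \<Longrightarrow> \<tau> face_of \<sigma> \<Longrightarrow> \<tau> \<noteq> {} \<Longrightarrow> \<tau> \<in> \<Sigma>"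
  and fan_Int: "\<sigma> \<in> \<Sigma> \<Longrightarrow> \<tau> \<in> \<Sigma> \<Longrightarrow> \<sigma> \<inter> \<tau> face_of \<sigma>" "\<sigma> \<in> \<Sigma> \<Longrightarrow> \<tau> \<in> \<Sigma> \<Longrightarrow> \<sigma> \<inter> \<tau> face_of \<tau>"
  using fan unfolding fan_def by blast+

lemmas cone_convex = rational_coneD(1)[OF rational_cone_fan]
  and cone_closed = rational_coneD(2)[OF rational_cone_fan]
  and cone_conic = rational_coneD(3)[OF rational_cone_fan]
  and cone_0 = rational_coneD(4)[OF rational_cone_fan]
  and cone_pointed = rational_coneD(5)[OF rational_cone_fan]

lemma vertex_face: "\<sigma> \<in> \<Sigma> \<Longrightarrow> {0} face_of \<sigma>"
  unfolding face_of_singleton extreme_point_of_def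
proof safe
  assume \<sigma>: "\<sigma> \<in> \<Sigma>"
  show "0 \<in> \<sigma>" using \<sigma> by (rule cone_0)
  fix x y assume xy: "x \<in> \<sigma>" "y \<in> \<sigma>" "0 \<in> open_segment x y"
  then obtain u where u: "0 < u" "u < 1" "0 = (1 - u) *\<^sub>R x + u *\<^sub>R y" "x \<noteq> y"
    by (auto simp: in_segment)
  have "u *\<^sub>R y = - ((1 - u) *\<^sub>R x)" using u(3) by (simp add: eq_neg_iff_add_eq_0 add.commute)
  moreover have "(1 - u) *\<^sub>R x \<in> \<sigma>" "u *\<^sub>R y \<in> \<sigma>"
    using conicD[OF cone_conic[OF \<sigma>]] xy u by simp_all
  ultimately have "(1 - u) *\<^sub>R x \<in> \<sigma>" "- ((1 - u) *\<^sub>R x) \<in> \<sigma>" by simp_all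
  then have "(1 - u) *\<^sub>R x = 0" by (rule cone_pointed[OF \<sigma>])
  then show False using u by auto
qed

lemma vertex_in_fan: "{0} \<in> \<Sigma>"
  using fan_nonempty vertex_face fan_face by blast

lemma compact_cones_0: "compact_cones \<Sigma> 0 = {{0}}"
proof
  show "compact_cones \<Sigma> 0 \<subseteq> {{0}}" using cone_0 by (auto simp: compact_cones_def)
  show "{{0}} \<subseteq> compact_cones \<Sigma> 0" using vertex_in_fan by (auto simp: compact_cones_def)
qed

lemma rel_interior_point:
  assumes "\<sigma> \<in> \<Sigma>" obtains s where "s \<in> rel_interior \<sigma>" "s \<in> \<sigma>"
  using rel_interior_eq_empty[OF cone_convex[OF assms]] cone_0[OF assms] rel_interior_subset by blast

lemma face_eq_if_dim_eq:
  assumes "\<sigma> \<in> \<Sigma>" "\<rho> \<in> \<Sigma>" "\<sigma> face_of \<rho>" "dim \<rho> \<le> dim \<sigma>"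
  shows "\<sigma> = \<rho>"
  using assms dim_face_less[OF rational_cone_fan cone_0] by (meson not_le)

text \<open>
  The intersection of the two cones is a face of \<open>\<sigma>\<close> that meets the relative interior of \<open>\<sigma>\<close>, so it
  is \<open>\<sigma>\<close> itself.
\<close>

lemma rel_interior_in_cone_face:
  assumes "\<sigma> \<in> \<Sigma>" "\<rho> \<in> \<Sigma>" "x \<in> rel_interior \<sigma>" "x \<in> \<rho>"
  shows "\<sigma> face_of \<rho>"
proof -
  have "x \<in> \<sigma> \<inter> \<rho>" using assms rel_interior_subset by blast
  then have "\<sigma> \<subseteq> \<sigma> \<inter> \<rho>"
    using subset_of_face_of[OF fan_Int(1), of \<sigma> \<rho> \<sigma>] assms by (auto simp: disjnt_iff)
  then show ?thesis using fan_Int(2)[OF assms(1,2)] by (metis Int_lower1 antisym)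
qed

text \<open>
  A cone of least dimension through \<open>x\<close> works. Otherwise a supporting hyperplane at \<open>x\<close> would cut
  out a face through \<open>x\<close> of smaller dimension.
\<close>

lemma in_rel_interior_of_cone:
  assumes "x \<in> \<Union>\<Sigma>"
  obtains \<sigma> where "\<sigma> \<in> \<Sigma>" "x \<in> rel_interior \<sigma>"
proof -
  obtain \<sigma> where \<sigma>: "\<sigma> \<in> \<Sigma>" "x \<in> \<sigma>" and min: "\<And>\<rho>. \<rho> \<in> \<Sigma> \<Longrightarrow> x \<in> \<rho> \<Longrightarrow> dim \<sigma> \<le> dim \<rho>"
    using assms arg_min_nat_lemma[of "\<lambda>\<sigma>. \<sigma> \<in> \<Sigma> \<and> x \<in> \<sigma>" _ dim] by blast
  have "x \<in> rel_interior \<sigma>"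
  proof (rule ccontr)
    assume nri: "x \<notin> rel_interior \<sigma>"
    then obtain a where a: "\<And>y. y \<in> \<sigma> \<Longrightarrow> a \<bullet> x \<le> a \<bullet> y" "\<And>y. y \<in> rel_interior \<sigma> \<Longrightarrow> a \<bullet> x < a \<bullet> y"
      using supporting_hyperplane_relative_frontier[of \<sigma> x] cone_convex[OF \<sigma>(1)] cone_closed[OF \<sigma>(1)] \<sigma>(2)
      by (metis closure_closed)
    let ?F = "\<sigma> \<inter> {y. a \<bullet> y = a \<bullet> x}"
    have F: "?F face_of \<sigma>"
      using face_of_Int_supporting_hyperplane_ge[OF cone_convex[OF \<sigma>(1)]] a(1) by blast
    have "?F \<in> \<Sigma>" using fan_face[OF \<sigma>(1) F] \<sigma>(2) by blast
    moreover have "?F \<noteq> \<sigma>"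
    proof -
      obtain y where "y \<in> rel_interior \<sigma>"
        using rel_interior_eq_empty[OF cone_convex[OF \<sigma>(1)]] \<sigma>(2) by blast
      then show ?thesis using a(2)[of y] rel_interior_subset by force
    qed
    ultimately have "dim ?F < dim \<sigma>"
      using F dim_face_less[OF rational_cone_fan[OF \<sigma>(1)] cone_0] by blast
    then show False using min[of ?F] \<open>?F \<in> \<Sigma>\<close> \<sigma>(2) by auto
  qed
  then show ?thesis using that \<sigma> by blast
qed

lemma locally_through_point:
  obtains \<epsilon> where "\<epsilon> > 0" "\<And>\<rho> y. \<rho> \<in> \<Sigma> \<Longrightarrow> y \<in> \<rho> \<Longrightarrow> dist t y < \<epsilon> \<Longrightarrow> t \<in> \<rho>"
proof -
  have "closed (\<Union>{\<rho>\<in>\<Sigma>. t \<notin> \<rho>})" using finite_fan cone_closed by (intro closed_Union) auto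
  then have "open (- \<Union>{\<rho>\<in>\<Sigma>. t \<notin> \<rho>})" by (simp add: open_Compl)
  then obtain \<epsilon> where "\<epsilon> > 0" "ball t \<epsilon> \<subseteq> - \<Union>{\<rho>\<in>\<Sigma>. t \<notin> \<rho>}"
    by (metis (no_types, lifting) ComplI Union_iff mem_Collect_eq open_contains_ball)
  then show ?thesis using that by (force simp: subset_iff)
qed

lemma rel_interior_ball:
  assumes "\<sigma> \<in> \<Sigma>" "s \<in> rel_interior \<sigma>"
  obtains \<epsilon> where "\<epsilon> > 0" "\<And>y. y \<in> span \<sigma> \<Longrightarrow> dist s y < \<epsilon> \<Longrightarrow> y \<in> \<sigma>"
  using assms affine_hull_cone[OF cone_0[OF assms(1)]]
  by (auto simp: mem_rel_interior_ball subset_iff)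

end

lemma fan_dim_ge: "finite \<Sigma> \<Longrightarrow> \<sigma> \<in> \<Sigma> \<Longrightarrow> dim \<sigma> \<le> fan_dim \<Sigma>"
  by (simp add: fan_dim_def)

section \<open>Support functions of finite sets\<close>

text \<open>
  The points of \<open>V\<close> on the face of its convex hull with outer normal \<open>y\<close>.
\<close>

definition top_face :: "'a::real_inner set \<Rightarrow> 'a \<Rightarrow> 'a set"
  where "top_face V y = {j\<in>V. \<forall>k\<in>V. k \<bullet> y \<le> j \<bullet> y}"

text \<open>
  The open normal cone of the vertex \<open>j\<close>, where \<open>j\<close> alone determines the support function of \<open>V\<close>.
\<close>

definition region :: "'a::real_inner set \<Rightarrow> 'a \<Rightarrow> 'a set"
  where "region V j = {y. \<forall>k\<in>V - {j}. k \<bullet> y < j \<bullet> y}"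

lemma open_region:
  assumes "finite V" shows "open (region V j)"
proof -
  have "region V j = (\<Inter>k\<in>V - {j}. {y. k \<bullet> y < j \<bullet> y})" by (auto simp: region_def)
  then show ?thesis using assms by (auto intro!: open_INT open_Collect_less continuous_intros)
qed

lemma convex_region: "convex (region V j)"
proof -
  have "region V j = (\<Inter>k\<in>V - {j}. {y. (k - j) \<bullet> y < 0})" by (auto simp: region_def inner_diff_left)
  then show ?thesis by (auto intro!: convex_INT convex_halfspace_lt)
qed

lemma top_face_region:
  assumes "j \<in> V" "y \<in> region V j" shows "top_face V y = {j}"
proof -
  have "i = j" if "i \<in> top_face V y" for i
  proof (rule ccontr)
    assume "i \<noteq> j"
    then have "i \<bullet> y < j \<bullet> y" using assms(2) that by (auto simp: top_face_def region_def)
    moreover have "j \<bullet> y \<le> i \<bullet> y" using assms(1) that by (auto simp: top_face_def)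
    ultimately show False by simp
  qed
  moreover have "k \<bullet> y \<le> j \<bullet> y" if "k \<in> V" for k
    using assms that by (cases "k = j") (auto simp: region_def less_imp_le)
  ultimately show ?thesis using assms(1) by (auto simp: top_face_def)
qed

lemma region_disjoint: "j \<in> V \<Longrightarrow> i \<in> V \<Longrightarrow> y \<in> region V j \<Longrightarrow> y \<in> region V i \<Longrightarrow> i = j"
  using top_face_region by blast

lemma top_face_nonempty:
  assumes "finite V" "V \<noteq> {}" obtains j where "j \<in> top_face V y"
proof -
  have "Max ((\<lambda>k. k \<bullet> y) ` V) \<in> (\<lambda>k. k \<bullet> y) ` V" using assms by (intro Max_in) auto
  then obtain j where j: "j \<in> V" "j \<bullet> y = Max ((\<lambda>k. k \<bullet> y) ` V)" by auto
  then have max: "k \<bullet> y \<le> j \<bullet> y" if "k \<in> V" for k using that assms by simp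
  show ?thesis by (rule that[of j]) (use j(1) max in \<open>simp add: top_face_def\<close>)
qed

text \<open>
  A strict inequality between two of finitely many continuous functions persists nearby, so near
  \<open>y\<close> no new maximizers appear.
\<close>

lemma maximizers_near:
  fixes g :: "'i \<Rightarrow> 'a::topological_space \<Rightarrow> real"
  assumes "finite I" "\<And>i. continuous_on UNIV (g i)"
  obtains N where "open N" "y \<in> N"
    "\<And>x. x \<in> N \<Longrightarrow> {i\<in>I. \<forall>k\<in>I. g k x \<le> g i x} \<subseteq> {i\<in>I. \<forall>k\<in>I. g k y \<le> g i y}"
proof (rule that)
  let ?P = "{p\<in>I \<times> I. g (fst p) y < g (snd p) y}"
  let ?N = "\<Inter>p\<in>?P. {x. g (fst p) x < g (snd p) x}"
  show "open ?N" using assms by (intro open_INT ballI open_Collect_less) simp_all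
  show "y \<in> ?N" by simp
  show "{i\<in>I. \<forall>k\<in>I. g k x \<le> g i x} \<subseteq> {i\<in>I. \<forall>k\<in>I. g k y \<le> g i y}" if x: "x \<in> ?N" for x
  proof (rule subsetI, rule CollectI, rule conjI)
    fix i assume i: "i \<in> {i\<in>I. \<forall>k\<in>I. g k x \<le> g i x}"
    then show "i \<in> I" by simp
    show "\<forall>k\<in>I. g k y \<le> g i y"
    proof (rule ballI, rule ccontr)
      fix k assume k: "k \<in> I" "\<not> g k y \<le> g i y"
      then have "(i, k) \<in> ?P" using i by simp
      then have "g i x < g k x" using x by fastforce
      then show False using i k(1) by fastforce
    qed
  qed
qed

text \<open>
  If \<open>d\<close> had a component orthogonal to \<open>a\<close>, moving far along it inside the half-space would make
  \<open>d\<close> positive.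
\<close>

lemma halfspace_dual:
  fixes a d :: "'a::real_inner"
  assumes "a \<noteq> 0" and "\<And>v. a \<bullet> v > 0 \<Longrightarrow> d \<bullet> v \<le> 0"
  obtains c where "c \<ge> 0" "d = - c *\<^sub>R a"
proof -
  define c where "c = (d \<bullet> a) / (a \<bullet> a)"
  define r where "r = d - c *\<^sub>R a"
  have aa: "a \<bullet> a > 0" using assms(1) by simp
  have ra: "r \<bullet> a = 0" using aa by (simp add: r_def c_def inner_diff_left)
  have "r = 0"
  proof (rule ccontr)
    assume "r \<noteq> 0"
    then have rr: "r \<bullet> r > 0" by simp
    define t where "t = (1 - d \<bullet> a) / (r \<bullet> r)"
    have "d \<bullet> r = r \<bullet> r" using ra by (simp add: r_def inner_diff_left inner_commute algebra_simps)
    then have "d \<bullet> (a + t *\<^sub>R r) = 1" using rr by (simp add: inner_add_right t_def)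
    moreover have "a \<bullet> (a + t *\<^sub>R r) > 0" using ra aa by (simp add: inner_add_right inner_commute)
    ultimately show False using assms(2) by fastforce
  qed
  moreover have "d \<bullet> a \<le> 0" using assms(2) aa by blast
  ultimately show ?thesis
    by (intro that[of "- c"]) (use aa in \<open>auto simp: r_def c_def divide_nonpos_pos\<close>)
qed

lemma eventually_nonpos_at_0:
  fixes A B :: real
  assumes "\<eta> > 0" and "\<And>t. 0 < t \<Longrightarrow> t < \<eta> \<Longrightarrow> A + t * B \<le> 0"
  shows "A \<le> 0"
proof (rule tendsto_upperbound)
  show "((\<lambda>t. A + t * B) \<longlongrightarrow> A) (at_right 0)"
    by (rule tendsto_eq_intros refl | simp)+
  show "\<forall>\<^sub>F t in at_right 0. A + t * B \<le> 0"
    unfolding eventually_at_right_field using assms by blast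
qed simp

lemma region_le: "y \<in> region V j \<Longrightarrow> i \<in> V \<Longrightarrow> i \<bullet> y \<le> j \<bullet> y"
  by (cases "i = j") (auto simp: region_def less_imp_le)

section \<open>Facets separate regions of linearity\<close>

text \<open>
  A fan structure on the tropical hypersurface of the support function \<open>y \<mapsto> max {v \<bullet> y |v. v \<in> V}\<close>,
  which is the set of points where two elements of \<open>V\<close> attain the maximum. That all regions are
  nonempty means that every element of \<open>V\<close> is a vertex of the convex hull.
\<close>

locale max_fan = rational_fan +
  fixes V :: "(real^'n) set"
  assumes finite_V: "finite V"
    and regions_nonempty: "j \<in> V \<Longrightarrow> region V j \<noteq> {}"
    and support: "\<Union>\<Sigma> = {y. \<exists>j\<in>top_face V y. \<exists>k\<in>top_face V y. j \<noteq> k}"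
begin

lemma two_tops_at_0: obtains j k where "j \<in> V" "k \<in> V" "j \<noteq> k"
proof -
  have "0 \<in> \<Union>\<Sigma>" using vertex_in_fan by blast
  then show ?thesis using that by (auto simp: support top_face_def)
qed

lemma V_nonempty: "V \<noteq> {}"
  using two_tops_at_0 by blast

lemma support_iff_regions: "y \<in> \<Union>\<Sigma> \<longleftrightarrow> (\<forall>j\<in>V. y \<notin> region V j)"
proof
  assume "y \<in> \<Union>\<Sigma>"
  then obtain j k where "j \<in> top_face V y" "k \<in> top_face V y" "j \<noteq> k" by (auto simp: support)
  then show "\<forall>j\<in>V. y \<notin> region V j" using top_face_region by fastforce
next
  assume no: "\<forall>j\<in>V. y \<notin> region V j"
  obtain j where j: "j \<in> top_face V y" using top_face_nonempty[OF finite_V V_nonempty] .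
  then have "j \<in> V" "y \<notin> region V j" using no by (auto simp: top_face_def)
  then obtain k where k: "k \<in> V" "k \<noteq> j" "j \<bullet> y \<le> k \<bullet> y" by (auto simp: region_def not_less)
  then have "k \<in> top_face V y" using j by (auto simp: top_face_def intro: order_trans)
  then show "y \<in> \<Union>\<Sigma>" using j k(2) by (auto simp: support)
qed

text \<open>
  The regions are open and disjoint, and they cover the complement of the support.
\<close>

lemma connected_in_region:
  assumes "connected S" "S \<inter> \<Union>\<Sigma> = {}" "a \<in> S" "b \<in> S" "j \<in> V" "a \<in> region V j"
  shows "b \<in> region V j"
proof (rule connected_induction_simple[OF assms(1,3,4), where P = "\<lambda>y. y \<in> region V j"])
  fix y assume "y \<in> S"
  then obtain i where i: "i \<in> V" "y \<in> region V i" using assms(2) support_iff_regions by blast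
  have "openin (top_of_set S) (S \<inter> region V i)"
    using open_region[OF finite_V] by (simp add: openin_open_Int)
  moreover have "\<forall>x\<in>S \<inter> region V i. \<forall>y\<in>S \<inter> region V i. x \<in> region V j \<longrightarrow> y \<in> region V j"
    using region_disjoint[OF i(1) assms(5)] by blast
  ultimately show "\<exists>T. openin (top_of_set S) T \<and> y \<in> T \<and>
      (\<forall>x\<in>T. \<forall>y\<in>T. x \<in> region V j \<longrightarrow> y \<in> region V j)"
    using i \<open>y \<in> S\<close> by blast
qed (use assms in auto)

text \<open>
  The support lies in the finitely many hyperplanes on which two elements of \<open>V\<close> agree, so it is a
  null set.
\<close>

lemma dim_cone_less:
  assumes "\<sigma> \<in> \<Sigma>" shows "dim \<sigma> < CARD('n)"
proof (rule ccontr)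
  assume "\<not> ?thesis"
  then have "dim \<sigma> = DIM(real^'n)" using dim_subset_UNIV[of \<sigma>] by simp
  then have "aff_dim \<sigma> = DIM(real^'n)" using aff_dim_cone[OF cone_0[OF assms]] by simp
  then have "affine hull \<sigma> = UNIV" using aff_dim_eq_full by blast
  then have "interior \<sigma> \<noteq> {}"
    using rel_interior_interior rel_interior_eq_empty cone_convex[OF assms] cone_0[OF assms]
    by (metis empty_iff)
  then have "\<not> negligible \<sigma>" using negligible_convex_interior cone_convex[OF assms] by blast
  moreover have "negligible (\<Union>j\<in>V. \<Union>k\<in>V - {j}. {y. (j - k) \<bullet> y = 0})"
    using finite_V by (intro negligible_Union finite_imageI finite_Diff) (auto intro!: negligible_hyperplane negligible_Union)
  moreover have "\<sigma> \<subseteq> (\<Union>j\<in>V. \<Union>k\<in>V - {j}. {y. (j - k) \<bullet> y = 0})"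
  proof
    fix y assume "y \<in> \<sigma>"
    then obtain j k where "j \<in> top_face V y" "k \<in> top_face V y" "j \<noteq> k" using assms support by blast
    then show "y \<in> (\<Union>j\<in>V. \<Union>k\<in>V - {j}. {y. (j - k) \<bullet> y = 0})"
      by (intro UN_I[of j] UN_I[of k]) (auto simp: top_face_def inner_diff_left intro!: antisym)
  qed
  ultimately show False using negligible_subset by blast
qed

text \<open>
  On the region of \<open>i\<close> the form \<open>i\<close> exceeds both \<open>j\<close> and \<open>k\<close>, hence every convex combination of them.
\<close>

lemma vertex_in_segment:
  assumes "i \<in> V" "j \<in> V" "k \<in> V" "i \<in> closed_segment j k" shows "i = j \<or> i = k"
proof (rule ccontr)
  assume neq: "\<not> ?thesis"
  obtain u where u: "0 \<le> u" "u \<le> 1" "i = (1 - u) *\<^sub>R j + u *\<^sub>R k"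
    using assms(4) by (auto simp: in_segment)
  obtain y where "y \<in> region V i" using regions_nonempty assms(1) by blast
  then have less: "j \<bullet> y < i \<bullet> y" "k \<bullet> y < i \<bullet> y" using assms(2,3) neq by (auto simp: region_def)
  have "i \<bullet> y = (1 - u) * (j \<bullet> y) + u * (k \<bullet> y)" unfolding u(3) by (simp add: inner_add_left)
  also have "\<dots> \<le> max (j \<bullet> y) (k \<bullet> y)" by (rule convex_bound_le) (use u in auto)
  finally show False using less by simp
qed

definition facet :: "(real^'n) set \<Rightarrow> bool"
  where "facet \<sigma> \<longleftrightarrow> \<sigma> \<in> \<Sigma> \<and> Suc (dim \<sigma>) = CARD('n)"

lemma facet_unique:
  assumes "facet \<sigma>" "s \<in> rel_interior \<sigma>" "\<rho> \<in> \<Sigma>" "s \<in> \<rho>" shows "\<rho> = \<sigma>"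
  using assms rel_interior_in_cone_face[of \<sigma> \<rho> s] face_eq_if_dim_eq[of \<sigma> \<rho>] dim_cone_less[of \<rho>]
  by (simp add: facet_def)

text \<open>
  Near a relative interior point \<open>s\<close> of a facet \<open>\<sigma>\<close> the support coincides with \<open>\<sigma>\<close>. So each of
  the two half-balls around \<open>s\<close> that are cut out by \<open>span \<sigma>\<close> lies in one region; these are the
  regions of \<open>j\<close> and \<open>k\<close>. An affine function \<open>\<beta> + i \<bullet> y\<close> below the support function that touches it
  at \<open>s\<close> is bounded by \<open>j\<close> on one half-ball and by \<open>k\<close> on the other. Then \<open>i - j\<close> and \<open>i - k\<close>
  are multiples of a normal vector \<open>a\<close> of \<open>\<sigma>\<close> with opposite signs, and \<open>i\<close> lies between \<open>j\<close> and
  \<open>k\<close>. This is stated for arbitrary \<open>i\<close> because it will also be applied to exponents of a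
  polynomial that are not vertices.
\<close>

lemma facet_sides_at:
  assumes "facet \<sigma>" "s \<in> rel_interior \<sigma>"
  obtains j k where "j \<in> V" "k \<in> V" "j \<noteq> k" "top_face V s = {j, k}" "span \<sigma> = {v. (j - k) \<bullet> v = 0}"
    "\<forall>i \<beta>. (\<forall>y. \<exists>l\<in>V. \<beta> + i \<bullet> y \<le> l \<bullet> y) \<longrightarrow> \<beta> + i \<bullet> s = j \<bullet> s \<longrightarrow> i \<in> closed_segment j k"
proof -
  have \<sigma>: "\<sigma> \<in> \<Sigma>" and dim: "Suc (dim \<sigma>) = CARD('n)" using assms by (auto simp: facet_def)
  obtain a where a: "a \<noteq> 0" "span \<sigma> \<subseteq> {x. a \<bullet> x = 0}"
    using lowdim_subset_hyperplane[of \<sigma>] dim by auto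
  have span: "span \<sigma> = {x. a \<bullet> x = 0}"
    using a dim by (intro subspace_dim_equal subspace_hyperplane) (simp_all add: dim_hyperplane)
  have s: "s \<in> \<sigma>" "a \<bullet> s = 0" using assms(2) rel_interior_subset span_superset a(2) by blast+
  obtain \<epsilon> where \<epsilon>: "\<epsilon> > 0" "\<And>\<rho> y. \<rho> \<in> \<Sigma> \<Longrightarrow> y \<in> \<rho> \<Longrightarrow> dist s y < \<epsilon> \<Longrightarrow> s \<in> \<rho>"
    using locally_through_point[of s] by blast
  have off: "y \<notin> \<Union>\<Sigma>" if "dist s y < \<epsilon>" "a \<bullet> y \<noteq> 0" for y
  proof
    assume "y \<in> \<Union>\<Sigma>"
    then obtain \<rho> where "\<rho> \<in> \<Sigma>" "y \<in> \<rho>" by blast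
    then have "y \<in> \<sigma>" using facet_unique[OF assms] \<epsilon>(2) that by blast
    then show False using that(2) a(2) span_superset by blast
  qed
  have side: "\<exists>j\<in>V. \<forall>y. dist s y < \<epsilon> \<longrightarrow> a' \<bullet> y > 0 \<longrightarrow> y \<in> region V j"
    if a': "a' = a \<or> a' = - a" for a'
  proof -
    let ?H = "ball s \<epsilon> \<inter> {y. a' \<bullet> y > 0}"
    have "\<exists>j\<in>V. \<forall>y\<in>?H. y \<in> region V j"
    proof (cases "?H = {}")
      case True
      then show ?thesis using V_nonempty by blast
    next
      case False
      then obtain y where y: "y \<in> ?H" by blast
      have disj: "?H \<inter> \<Union>\<Sigma> = {}" using off a' by (auto simp: dist_commute)
      have "connected ?H"
        by (intro convex_connected convex_Int convex_ball convex_halfspace_gt)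
      moreover obtain j where "j \<in> V" "y \<in> region V j" using y disj support_iff_regions by blast
      ultimately show ?thesis using connected_in_region disj y by blast
    qed
    then show ?thesis unfolding Ball_def Int_iff mem_ball mem_Collect_eq by blast
  qed
  obtain j where j: "j \<in> V" "\<And>y. dist s y < \<epsilon> \<Longrightarrow> a \<bullet> y > 0 \<Longrightarrow> y \<in> region V j"
    using side[of a] by blast
  obtain k where k: "k \<in> V" "\<And>y. dist s y < \<epsilon> \<Longrightarrow> - a \<bullet> y > 0 \<Longrightarrow> y \<in> region V k"
    using side[of "- a"] by blast
  have dom: "\<exists>c\<ge>0. i - l = - c *\<^sub>R a'"
    if H: "\<And>y. dist s y < \<epsilon> \<Longrightarrow> a' \<bullet> y > 0 \<Longrightarrow> \<beta> + i \<bullet> y \<le> l \<bullet> y" and eq: "\<beta> + i \<bullet> s = l \<bullet> s"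
      and a': "a' = a \<or> a' = - a" for a' i l \<beta>
  proof -
    have "(i - l) \<bullet> v \<le> 0" if v: "a' \<bullet> v > 0" for v
    proof -
      have "v \<noteq> 0" using v by auto
      define t where "t = \<epsilon> / (2 * norm v)"
      have t: "t > 0" using \<epsilon> \<open>v \<noteq> 0\<close> by (simp add: t_def)
      have "dist s (s + t *\<^sub>R v) < \<epsilon>" using \<epsilon> \<open>v \<noteq> 0\<close> by (simp add: dist_norm t_def)
      moreover have "a' \<bullet> (s + t *\<^sub>R v) > 0" using s(2) v t a' by (auto simp: inner_add_right mult_pos_neg)
      ultimately have "\<beta> + i \<bullet> (s + t *\<^sub>R v) \<le> l \<bullet> (s + t *\<^sub>R v)" by (rule H)
      then have "t * ((i - l) \<bullet> v) \<le> 0" using eq by (simp add: inner_add_right inner_diff_left algebra_simps)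
      then show ?thesis using t by (simp add: mult_le_0_iff)
    qed
    moreover have "a' \<noteq> 0" using a a' by auto
    ultimately obtain c where "c \<ge> 0" "i - l = - c *\<^sub>R a'" using halfspace_dual by blast
    then show ?thesis by blast
  qed
  have top: "l \<in> top_face V s"
    if l: "l \<in> V" "\<And>y. dist s y < \<epsilon> \<Longrightarrow> a' \<bullet> y > 0 \<Longrightarrow> y \<in> region V l" and a': "a' = a \<or> a' = - a" for a' l
  proof -
    have "i \<bullet> s - l \<bullet> s \<le> 0" if i: "i \<in> V" for i
    proof (rule eventually_nonpos_at_0)
      have "norm a > 0" using a by simp
      then show "0 < \<epsilon> / norm a" using \<epsilon> by simp
      fix t assume t: "0 < t" "t < \<epsilon> / norm a"
      have "norm a' = norm a" "a' \<bullet> s = 0" "a' \<noteq> 0" using a' a s(2) by auto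
      then have "dist s (s + t *\<^sub>R a') < \<epsilon>" "a' \<bullet> (s + t *\<^sub>R a') > 0"
        using t \<open>norm a > 0\<close> by (simp_all add: dist_norm inner_add_right field_simps)
      then have "s + t *\<^sub>R a' \<in> region V l" by (rule l(2))
      then have "i \<bullet> (s + t *\<^sub>R a') \<le> l \<bullet> (s + t *\<^sub>R a')"
        using i by (rule region_le)
      then show "i \<bullet> s - l \<bullet> s + t * ((i - l) \<bullet> a') \<le> 0"
        by (simp add: inner_add_right inner_diff_left algebra_simps)
    qed
    then show ?thesis using l(1) by (simp add: top_face_def)
  qed
  have tops: "j \<in> top_face V s" "k \<in> top_face V s" using top[of j a] top[of k "- a"] j k by auto
  then have jks: "j \<bullet> s = k \<bullet> s" by (auto simp: top_face_def intro: antisym)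
  have "j \<noteq> k"
  proof
    assume "j = k"
    define t where "t = \<epsilon> / (2 * norm a)"
    have t: "t > 0" "dist s (s + t *\<^sub>R a) < \<epsilon>" "dist s (s - t *\<^sub>R a) < \<epsilon>"
      using \<epsilon> a by (simp_all add: dist_norm t_def)
    have "s + t *\<^sub>R a \<in> region V j" using t s a by (intro j(2)) (simp_all add: inner_add_right)
    moreover have "s - t *\<^sub>R a \<in> region V j"
      unfolding \<open>j = k\<close> using t s a by (intro k(2)) (simp_all add: inner_diff_right)
    ultimately have "(1/2) *\<^sub>R (s + t *\<^sub>R a) + (1/2) *\<^sub>R (s - t *\<^sub>R a) \<in> region V j"
      by (intro convexD[OF convex_region]) auto
    moreover have "(1/2) *\<^sub>R (s + t *\<^sub>R a) + (1/2) *\<^sub>R (s - t *\<^sub>R a) = s"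
      by (simp add: algebra_simps flip: scaleR_add_left)
    ultimately have "s \<in> region V j" by simp
    then show False using s(1) \<sigma> j(1) support_iff_regions by blast
  qed
  have seg: "i \<in> closed_segment j k"
    if dominated: "\<And>y. \<exists>l\<in>V. \<beta> + i \<bullet> y \<le> l \<bullet> y" and eq: "\<beta> + i \<bullet> s = j \<bullet> s" for i \<beta>
  proof -
    have le: "\<beta> + i \<bullet> y \<le> m \<bullet> y" if "m \<in> V" "y \<in> region V m" for m y
    proof -
      obtain l where "l \<in> V" "\<beta> + i \<bullet> y \<le> l \<bullet> y" using dominated by blast
      moreover have "l \<bullet> y \<le> m \<bullet> y"
        using that(2) \<open>l \<in> V\<close> by (rule region_le)
      ultimately show ?thesis by simp
    qed
    obtain c where c: "c \<ge> 0" "i - j = - c *\<^sub>R a" using dom[of a \<beta> i j] le[OF j] eq by auto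
    obtain c' where c': "c' \<ge> 0" "i - k = - c' *\<^sub>R (- a)"
      using dom[of "- a" \<beta> i k] le[OF k] eq jks by auto
    have jk: "j - k = (c + c') *\<^sub>R a" using c(2) c'(2) by (simp add: algebra_simps)
    then have "c + c' \<noteq> 0" using \<open>j \<noteq> k\<close> by auto
    then have pos: "c + c' > 0" using c(1) c'(1) by simp
    have "k - j = - ((c + c') *\<^sub>R a)" using jk by (simp add: algebra_simps)
    then have "(c / (c + c')) *\<^sub>R (k - j) = - c *\<^sub>R a" using pos by simp
    then have "i = j + (c / (c + c')) *\<^sub>R (k - j)" unfolding c(2)[symmetric] by simp
    then have "i = (1 - c / (c + c')) *\<^sub>R j + (c / (c + c')) *\<^sub>R k"
      by (simp add: scaleR_diff_left scaleR_diff_right)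
    moreover have "0 \<le> c / (c + c')" "c / (c + c') \<le> 1" using pos c c' by (simp_all add: field_simps)
    ultimately show ?thesis unfolding in_segment by blast
  qed
  have "i = j \<or> i = k" if i: "i \<in> top_face V s" for i
  proof (rule ccontr)
    assume neq: "\<not> ?thesis"
    have "i \<in> V" using i by (simp add: top_face_def)
    then have "i \<in> closed_segment j k"
      using i tops by (intro seg[of 0 i]) (auto simp: top_face_def intro: antisym)
    then show False using vertex_in_segment[OF \<open>i \<in> V\<close> j(1) k(1)] neq by blast
  qed
  then have topeq: "top_face V s = {j, k}" using tops by blast
  obtain c where c: "k - j = - c *\<^sub>R a"
    using dom[of a 0 k j] region_le[OF j(2) k(1)] jks by auto
  then have "c \<noteq> 0" using \<open>j \<noteq> k\<close> by auto
  moreover have "j - k = c *\<^sub>R a" using c by (simp add: algebra_simps)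
  ultimately have span': "span \<sigma> = {v. (j - k) \<bullet> v = 0}" using span by simp
  have "\<forall>i \<beta>. (\<forall>y. \<exists>l\<in>V. \<beta> + i \<bullet> y \<le> l \<bullet> y) \<longrightarrow> \<beta> + i \<bullet> s = j \<bullet> s \<longrightarrow> i \<in> closed_segment j k"
    using seg by blast
  then show ?thesis using that[OF j(1) k(1) \<open>j \<noteq> k\<close> topeq span'] by blast
qed

text \<open>
  The two sides are the same at all relative interior points of the facet, because they are
  locally constant and the relative interior is connected. On the closure they still attain the
  maximum.
\<close>

lemma facet_sides:
  assumes "facet \<sigma>"
  obtains j k where "j \<in> V" "k \<in> V" "j \<noteq> k"
    "\<And>s. s \<in> rel_interior \<sigma> \<Longrightarrow> top_face V s = {j, k}"
    "\<And>s. s \<in> \<sigma> \<Longrightarrow> j \<in> top_face V s \<and> k \<in> top_face V s"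
    "span \<sigma> = {v. (j - k) \<bullet> v = 0}"
    "\<forall>i \<beta>. (\<forall>y. \<exists>l\<in>V. \<beta> + i \<bullet> y \<le> l \<bullet> y) \<longrightarrow>
      (\<forall>s\<in>rel_interior \<sigma>. \<beta> + i \<bullet> s = j \<bullet> s \<longrightarrow> i \<in> closed_segment j k)"
proof -
  have \<sigma>: "\<sigma> \<in> \<Sigma>" using assms by (auto simp: facet_def)
  obtain s where s: "s \<in> rel_interior \<sigma>" by (rule rel_interior_point[OF \<sigma>])
  obtain j k where jk: "j \<in> V" "k \<in> V" "j \<noteq> k" "top_face V s = {j, k}" "span \<sigma> = {v. (j - k) \<bullet> v = 0}"
    by (rule facet_sides_at[OF assms s]) (rule that)
  have const: "top_face V x = {j, k}" if x: "x \<in> rel_interior \<sigma>" for x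
  proof (rule connected_induction_simple[where P = "\<lambda>x. top_face V x = {j, k}" and S = "rel_interior \<sigma>" and a = s])
    show "connected (rel_interior \<sigma>)"
      by (intro convex_connected convex_rel_interior cone_convex[OF \<sigma>])
    fix y assume y: "y \<in> rel_interior \<sigma>"
    obtain j' k' where jk': "j' \<in> V" "k' \<in> V" "j' \<noteq> k'" "top_face V y = {j', k'}" "span \<sigma> = {v. (j' - k') \<bullet> v = 0}"
      by (rule facet_sides_at[OF assms y]) (rule that)
    have cont: "continuous_on UNIV (\<lambda>x. i \<bullet> x)" for i :: "real^'n" by (intro continuous_intros)
    obtain N where N: "open N" "y \<in> N" "\<And>x. x \<in> N \<Longrightarrow> top_face V x \<subseteq> top_face V y"
      by (rule maximizers_near[where g = inner, OF finite_V cont, of y, folded top_face_def]) (rule that)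
    have "openin (top_of_set (rel_interior \<sigma>)) (rel_interior \<sigma> \<inter> N)"
      using N(1) by (simp add: openin_open_Int)
    moreover have "top_face V x = {j', k'}" if x: "x \<in> rel_interior \<sigma> \<inter> N" for x
    proof -
      have "x \<in> span \<sigma>" using x rel_interior_subset span_superset by blast
      then have eq: "j' \<bullet> x = k' \<bullet> x" using jk'(5) by (simp add: inner_diff_left)
      have sub: "top_face V x \<subseteq> {j', k'}" using N(3)[of x] x jk'(4) by simp
      obtain i where "i \<in> top_face V x" using top_face_nonempty[OF finite_V V_nonempty] .
      moreover from this have "i \<bullet> x = j' \<bullet> x" using sub eq by auto
      ultimately have "j' \<in> top_face V x" "k' \<in> top_face V x"
        using jk'(1,2) eq by (auto simp: top_face_def)
      then show ?thesis using sub by blast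
    qed
    ultimately show "\<exists>T. openin (top_of_set (rel_interior \<sigma>)) T \<and> y \<in> T \<and>
        (\<forall>x\<in>T. \<forall>y\<in>T. top_face V x = {j, k} \<longrightarrow> top_face V y = {j, k})"
      using y N(2) by (intro exI[of _ "rel_interior \<sigma> \<inter> N"]) simp
  qed (use s x jk in auto)
  have all: "j \<in> top_face V x \<and> k \<in> top_face V x" if x: "x \<in> \<sigma>" for x
  proof -
    let ?C = "\<Inter>i\<in>V. {x. i \<bullet> x \<le> j \<bullet> x} \<inter> {x. i \<bullet> x \<le> k \<bullet> x}"
    have "closed ?C" by (intro closed_INT ballI closed_Int closed_Collect_le continuous_intros)
    moreover have "rel_interior \<sigma> \<subseteq> ?C" using const by (auto simp: top_face_def)
    ultimately have "closure (rel_interior \<sigma>) \<subseteq> ?C" by (simp add: closure_minimal)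
    then have "x \<in> ?C"
      using x closure_subset[of \<sigma>] convex_closure_rel_interior[OF cone_convex[OF \<sigma>]] by blast
    then show ?thesis using jk by (auto simp: top_face_def)
  qed
  have "i \<in> closed_segment j k"
    if i: "\<And>y. \<exists>l\<in>V. \<beta> + i \<bullet> y \<le> l \<bullet> y" "t \<in> rel_interior \<sigma>" "\<beta> + i \<bullet> t = j \<bullet> t" for i \<beta> t
  proof -
    obtain j' k' where jk': "top_face V t = {j', k'}"
      "\<forall>i \<beta>. (\<forall>y. \<exists>l\<in>V. \<beta> + i \<bullet> y \<le> l \<bullet> y) \<longrightarrow> \<beta> + i \<bullet> t = j' \<bullet> t \<longrightarrow> i \<in> closed_segment j' k'"
      by (rule facet_sides_at[OF assms i(2)]) (rule that)
    have "{j', k'} = {j, k}" using jk'(1) const[OF i(2)] by simp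
    moreover have "j' \<bullet> t = j \<bullet> t"
    proof (rule antisym)
      have "j \<in> top_face V t" "j' \<in> top_face V t" using jk'(1) const[OF i(2)] by auto
      then show "j' \<bullet> t \<le> j \<bullet> t" "j \<bullet> t \<le> j' \<bullet> t" by (auto simp: top_face_def)
    qed
    ultimately have "i \<in> closed_segment j' k'" using jk'(2)[rule_format, OF i(1)] i(3) by simp
    then show ?thesis using \<open>{j', k'} = {j, k}\<close> by (metis closed_segment_commute doubleton_eq_iff)
  qed
  then have "\<forall>i \<beta>. (\<forall>y. \<exists>l\<in>V. \<beta> + i \<bullet> y \<le> l \<bullet> y) \<longrightarrow>
      (\<forall>s\<in>rel_interior \<sigma>. \<beta> + i \<bullet> s = j \<bullet> s \<longrightarrow> i \<in> closed_segment j k)"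
    by blast
  then show ?thesis using that[OF jk(1-3) const all jk(5)] by blast
qed

text \<open>
  Any two regions can be joined by crossing facets. A cone of codimension at least 2 casts from a
  point \<open>y\<close> a shadow inside the proper subspace \<open>span (insert y \<tau>)\<close>. Hence a segment from \<open>y\<close> to a
  generic point \<open>z\<close> of another region meets the support only in relative interiors of facets. One
  of these is crossed where the segment leaves the closed regions of the elements of \<open>A\<close>.
\<close>

lemma facet_between:
  assumes A: "A \<subseteq> V" "A \<noteq> {}" "A \<noteq> V"
  obtains \<sigma> s j k where "facet \<sigma>" "s \<in> rel_interior \<sigma>" "j \<in> A" "k \<in> V - A"
    "j \<in> top_face V s" "k \<in> top_face V s"
proof -
  obtain j k where jk: "j \<in> A" "k \<in> V - A" using A by blast
  then obtain y where y: "y \<in> region V j" using regions_nonempty A(1) by blast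
  define T where "T = {\<tau>\<in>\<Sigma>. Suc (dim \<tau>) < CARD('n)}"
  let ?bad = "\<Union>\<tau>\<in>T. span (insert y \<tau>)"
  have "negligible (span (insert y \<tau>))" if "\<tau> \<in> T" for \<tau>
    using that dim_insert[of y \<tau>] by (intro negligible_lowdim) (auto simp: T_def)
  then have "negligible ?bad"
    using finite_fan by (intro negligible_Union finite_imageI) (auto simp: T_def)
  moreover have "\<not> negligible (region V k)"
    using open_not_negligible[OF open_region[OF finite_V]] regions_nonempty jk by blast
  ultimately obtain z where z: "z \<in> region V k" "z \<notin> ?bad" using negligible_subset by blast
  let ?S = "closed_segment y z"
  let ?top = "\<lambda>i. {x. \<forall>l\<in>V. l \<bullet> x \<le> i \<bullet> x}"
  have closed: "closed (\<Union>i\<in>B. ?top i)" if "B \<subseteq> V" for B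
  proof (intro closed_UN ballI)
    show "finite B" using that finite_V finite_subset by blast
    fix i
    have "?top i = (\<Inter>l\<in>V. {x. l \<bullet> x \<le> i \<bullet> x})" by auto
    then show "closed (?top i)" by (auto intro!: closed_INT closed_Collect_le continuous_intros)
  qed
  have cover: "?S \<subseteq> (\<Union>i\<in>A. ?top i) \<union> (\<Union>i\<in>V - A. ?top i)"
  proof
    fix x
    obtain i where "i \<in> top_face V x" using top_face_nonempty[OF finite_V V_nonempty] .
    then show "x \<in> (\<Union>i\<in>A. ?top i) \<union> (\<Union>i\<in>V - A. ?top i)" by (auto simp: top_face_def)
  qed
  have "y \<in> ?top j" "z \<in> ?top k" using region_le y z by blast+
  then have "(\<Union>i\<in>A. ?top i) \<inter> (\<Union>i\<in>V - A. ?top i) \<inter> ?S \<noteq> {}"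
    using connected_closedD[OF connected_segment _ cover closed[OF A(1)] closed[of "V - A"]] jk
      ends_in_segment[of y z] by blast
  then obtain x i l where x: "x \<in> ?S" "i \<in> A" "l \<in> V - A" "x \<in> ?top i" "x \<in> ?top l" by blast
  then have tops: "i \<in> top_face V x" "l \<in> top_face V x" using A(1) by (auto simp: top_face_def)
  moreover have "i \<noteq> l" using x(2,3) by blast
  ultimately have "x \<in> \<Union>\<Sigma>" unfolding support by blast
  then obtain \<sigma> where \<sigma>: "\<sigma> \<in> \<Sigma>" "x \<in> rel_interior \<sigma>" by (rule in_rel_interior_of_cone)
  have "\<sigma> \<notin> T"
  proof
    assume T: "\<sigma> \<in> T"
    have x\<sigma>: "x \<in> \<sigma>" using \<sigma>(2) rel_interior_subset by blast
    obtain u where u: "x = (1 - u) *\<^sub>R y + u *\<^sub>R z" using x(1) by (auto simp: in_segment)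
    have "u \<noteq> 0"
    proof
      assume "u = 0"
      then have "y \<in> \<Union>\<Sigma>" using u x\<sigma> \<sigma>(1) by auto
      then show False using y jk A(1) support_iff_regions by blast
    qed
    have "x \<in> span (insert y \<sigma>)" "y \<in> span (insert y \<sigma>)" using x\<sigma> by (auto intro: span_base)
    then have "(1 / u) *\<^sub>R (x - (1 - u) *\<^sub>R y) \<in> span (insert y \<sigma>)"
      by (intro span_scale span_diff)
    then have "z \<in> span (insert y \<sigma>)" using u \<open>u \<noteq> 0\<close> by simp
    then show False using z(2) T by blast
  qed
  then have "facet \<sigma>" using dim_cone_less[OF \<sigma>(1)] \<sigma>(1) by (auto simp: T_def facet_def)
  then show ?thesis using that \<sigma>(2) x(2,3) tops by blast
qed

lemma Suc_fan_dim: "Suc (fan_dim \<Sigma>) = CARD('n)"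
proof -
  obtain j k where jk: "j \<in> V" "k \<in> V" "j \<noteq> k" by (rule two_tops_at_0)
  obtain \<sigma> where "facet \<sigma>" using facet_between[of "{j}"] jk by blast
  then have "\<sigma> \<in> \<Sigma>" "Suc (dim \<sigma>) = CARD('n)" by (auto simp: facet_def)
  then have "CARD('n) \<le> Suc (fan_dim \<Sigma>)" using fan_dim_ge[OF finite_fan] by fastforce
  moreover have "fan_dim \<Sigma> \<in> dim ` \<Sigma>"
    unfolding fan_dim_def using finite_fan fan_nonempty by (intro Max_in) auto
  then have "fan_dim \<Sigma> < CARD('n)" using dim_cone_less by auto
  ultimately show ?thesis by simp
qed

lemma facet_iff_cones: "facet \<sigma> \<longleftrightarrow> \<sigma> \<in> cones \<Sigma> (fan_dim \<Sigma>)"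
  using Suc_fan_dim by (auto simp: facet_def cones_def)

end

section \<open>The boundary of a region is a cycle\<close>

locale oriented_max_fan = max_fan \<Sigma> V
  for \<Sigma> :: "(real^'n) set set" and V :: "(real^'n) set" +
  fixes b :: "(real^'n) set \<Rightarrow> (real^'n) list"
  assumes orientation: "fan_orientation \<Sigma> b"
begin

lemma basis:
  assumes "\<sigma> \<in> \<Sigma>"
  shows "lattice_basis (cone_lattice \<sigma>) (b \<sigma>)" "distinct (b \<sigma>)" "independent (set (b \<sigma>))"
    "span (set (b \<sigma>)) = span \<sigma>" "length (b \<sigma>) = dim \<sigma>"
proof -
  show lb: "lattice_basis (cone_lattice \<sigma>) (b \<sigma>)"
    using orientation assms by (simp add: fan_orientation_def)
  then show "distinct (b \<sigma>)" "independent (set (b \<sigma>))" by (simp_all add: lattice_basis_def)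
  show "span (set (b \<sigma>)) = span \<sigma>" "length (b \<sigma>) = dim \<sigma>"
    using span_lattice_basis length_lattice_basis rational_cone_fan[OF assms] lb by blast+
qed

text \<open>
  A linear form with kernel \<open>span \<sigma>\<close>. Its sign tells the two sides of the facet \<open>\<sigma>\<close> apart
  according to the orientation of \<open>\<sigma>\<close>.
\<close>

definition side_form :: "(real^'n) set \<Rightarrow> real^'n \<Rightarrow> real"
  where "side_form \<sigma> x = wedge (x # b \<sigma>) coords"

lemma linear_side_form: "linear (side_form \<sigma>)"
  unfolding side_form_def by (rule linear_wedge)

lemma side_form_eq_0_iff: "facet \<sigma> \<Longrightarrow> side_form \<sigma> x = 0 \<longleftrightarrow> x \<in> span \<sigma>"
  using wedge_Cons_coords_eq_0_iff[of "b \<sigma>" x] basis[of \<sigma>] by (simp add: side_form_def facet_def)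

definition region_point :: "real^'n \<Rightarrow> real^'n"
  where "region_point j = (SOME y. y \<in> region V j)"

lemma region_point: "j \<in> V \<Longrightarrow> region_point j \<in> region V j"
  unfolding region_point_def using regions_nonempty by (simp add: some_in_eq)

text \<open>
  For a facet \<open>\<sigma>\<close>: the region of \<open>j\<close> is one of the two regions on either side of \<open>\<sigma>\<close>.
\<close>

definition bounds :: "real^'n \<Rightarrow> (real^'n) set \<Rightarrow> bool"
  where "bounds j \<sigma> \<longleftrightarrow> (\<forall>s\<in>\<sigma>. j \<in> top_face V s)"

lemma bounds_if_top:
  assumes "facet \<sigma>" "s \<in> rel_interior \<sigma>" "i \<in> top_face V s" shows "bounds i \<sigma>"
proof -
  obtain j k where jk: "j \<in> V" "k \<in> V" "j \<noteq> k"
    "\<And>s. s \<in> rel_interior \<sigma> \<Longrightarrow> top_face V s = {j, k}"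
    "\<And>s. s \<in> \<sigma> \<Longrightarrow> j \<in> top_face V s \<and> k \<in> top_face V s"
    by (rule facet_sides[OF assms(1)]) (rule that)
  then have "i \<in> {j, k}" using assms(2,3) by blast
  then show ?thesis using jk(5) by (auto simp: bounds_def)
qed

text \<open>
  The coefficient of \<open>\<sigma>\<close> in the oriented boundary of the region of \<open>j\<close>.
\<close>

definition region_sign :: "real^'n \<Rightarrow> (real^'n) set \<Rightarrow> int"
  where "region_sign j \<sigma> =
    (if bounds j \<sigma> then if side_form \<sigma> (region_point j) > 0 then 1 else -1 else 0)"

lemma bounds_other_side:
  assumes "facet \<sigma>" "j \<in> V" "bounds j \<sigma>"
  obtains k where "k \<in> V" "k \<noteq> j" "bounds k \<sigma>" "span \<sigma> = {v. (j - k) \<bullet> v = 0}"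
proof -
  obtain i l where il: "i \<in> V" "l \<in> V" "i \<noteq> l"
    "\<And>s. s \<in> rel_interior \<sigma> \<Longrightarrow> top_face V s = {i, l}"
    "\<And>s. s \<in> \<sigma> \<Longrightarrow> i \<in> top_face V s \<and> l \<in> top_face V s"
    "span \<sigma> = {v. (i - l) \<bullet> v = 0}"
    by (rule facet_sides[OF assms(1)]) (rule that)
  have "\<sigma> \<in> \<Sigma>" using assms(1) by (simp add: facet_def)
  then obtain s where s: "s \<in> rel_interior \<sigma>" "s \<in> \<sigma>" by (rule rel_interior_point)
  then have "j \<in> {i, l}" using assms(3) il(4)[OF s(1)] unfolding bounds_def by blast
  moreover have "span \<sigma> = {v. (l - i) \<bullet> v = 0}" unfolding il(6) by (auto simp: inner_diff_left)
  moreover have "bounds i \<sigma>" "bounds l \<sigma>" using il(5) by (auto simp: bounds_def)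
  ultimately show ?thesis using that[of i] that[of l] il by blast
qed

lemma region_point_notin_span:
  assumes "facet \<sigma>" "j \<in> V" "bounds j \<sigma>" shows "region_point j \<notin> span \<sigma>"
proof -
  obtain k where "k \<in> V" "k \<noteq> j" "span \<sigma> = {v. (j - k) \<bullet> v = 0}"
    using bounds_other_side[OF assms] by blast
  then show ?thesis using region_point[OF assms(2)] by (auto simp: region_def inner_diff_left)
qed

text \<open>
  As \<open>\<tau>\<close> is a face of \<open>\<sigma>\<close>, all points of \<open>\<sigma>\<close> outside \<open>\<tau>\<close> lie on one side of \<open>span \<tau>\<close> in \<open>span \<sigma>\<close>. So
  any inward pointing \<open>s\<close> decides the relative sign, which is defined with outward pointing
  vectors and is therefore opposite to the sign of \<open>\<kappa>\<close>.
\<close>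

lemma rel_sign_eq:
  assumes \<sigma>: "\<sigma> \<in> \<Sigma>" and \<tau>: "\<tau> \<in> \<Sigma>" "\<tau> face_of \<sigma>" "Suc (dim \<tau>) = dim \<sigma>" and s: "s \<in> rel_interior \<sigma>"
  obtains \<kappa> where "\<kappa> \<noteq> 0" "wedge (s # b \<tau>) = (\<lambda>js. \<kappa> * wedge (b \<sigma>) js)"
    "rel_sign b \<tau> \<sigma> = (if \<kappa> < 0 then 1 else -1)"
proof -
  have \<tau>\<sigma>: "\<tau> \<subseteq> \<sigma>" using \<tau>(2) by (rule face_of_imp_subset)
  have ex: "\<exists>\<kappa>. wedge (y # b \<tau>) = (\<lambda>js. \<kappa> * wedge (b \<sigma>) js)" if y: "y \<in> span \<sigma>" for y
  proof -
    have "set (b \<tau>) \<subseteq> span \<tau>" using basis(4)[OF \<tau>(1)] span_superset by blast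
    also have "span \<tau> \<subseteq> span \<sigma>" using \<tau>\<sigma> by (rule span_mono)
    finally have "set (y # b \<tau>) \<subseteq> span (set (b \<sigma>))" using y basis(4)[OF \<sigma>] by simp
    then show ?thesis
      using wedge_proportional[of "y # b \<tau>" "b \<sigma>"] basis(5)[OF \<sigma>] basis(5)[OF \<tau>(1)] \<tau>(3) by (metis length_Cons)
  qed
  have nz: "wedge (b \<sigma>) \<noteq> 0" using wedge_nonzero basis(2,3)[OF \<sigma>] by blast
  have zero: "y \<in> span \<tau>" if "wedge (y # b \<tau>) = 0" for y
  proof (rule ccontr)
    assume "y \<notin> span \<tau>"
    then have "wedge (y # b \<tau>) \<noteq> 0"
      using basis[OF \<tau>(1)] by (intro wedge_nonzero) (auto simp: independent_insert intro: span_base)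
    then show False using that by blast
  qed
  have s\<sigma>: "s \<in> \<sigma>" using s rel_interior_subset by blast
  obtain \<kappa> where \<kappa>: "wedge (s # b \<tau>) = (\<lambda>js. \<kappa> * wedge (b \<sigma>) js)"
    using ex[of s] s\<sigma> span_base by blast
  have "\<tau> \<noteq> \<sigma>" using \<tau>(3) by auto
  then have "s \<notin> span \<tau>"
    using rel_interior_notin_span_face[OF rational_cone_fan[OF \<sigma>] cone_0[OF \<tau>(1)] \<tau>(2)] s by blast
  then have "\<kappa> \<noteq> 0" using zero[of s] \<kappa> basis(4)[OF \<tau>(1)]
    by (metis (no_types, lifting) ext mult_zero_left wedge_nonzero zero_fun_apply)
  have same: False if y: "y \<in> \<sigma>" and \<mu>: "wedge (y # b \<tau>) = (\<lambda>js. \<mu> * wedge (b \<sigma>) js)" and opp: "\<kappa> > 0" "\<mu> < 0" for y \<mu>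
  proof -
    define u where "u = \<kappa> / (\<kappa> - \<mu>)"
    have u: "0 < u" "u < 1" using opp by (auto simp: u_def field_simps)
    define m where "m = (1 - u) *\<^sub>R s + u *\<^sub>R y"
    have "(1 - u) * \<kappa> + u * \<mu> = 0" using opp by (simp add: u_def field_simps)
    then have "wedge (m # b \<tau>) js = 0" for js
      unfolding m_def linear_add[OF linear_wedge] linear_scale[OF linear_wedge] \<kappa> \<mu>
      by (simp flip: distrib_right mult.assoc)
    then have "m \<in> span \<tau>" using zero by (metis ext zero_fun_apply)
    moreover have m\<sigma>: "m \<in> \<sigma>"
      unfolding m_def using u s\<sigma> y by (intro convexD[OF cone_convex[OF \<sigma>]]) auto
    ultimately have "m \<in> \<tau>"
      using face_of_imp_eq_affine_Int[OF cone_convex[OF \<sigma>] \<tau>(2)] affine_hull_cone[OF cone_0[OF \<tau>(1)]] by blast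
    moreover have "s \<noteq> y"
    proof
      assume "s = y"
      then have "\<kappa> * wedge (b \<sigma>) js = \<mu> * wedge (b \<sigma>) js" for js using \<kappa> \<mu> by metis
      then have "\<kappa> = \<mu>" using nz by (metis mult_right_cancel ext zero_fun_apply)
      then show False using opp by simp
    qed
    then have "m \<in> open_segment s y" using u by (auto simp: in_segment m_def)
    ultimately have "s \<in> \<tau>" using face_ofD[OF \<tau>(2) _ s\<sigma> y] by blast
    then show False using \<open>s \<notin> span \<tau>\<close> span_base by blast
  qed
  have neg: "wedge ((- y) # b \<tau>) = (\<lambda>js. - (wedge (y # b \<tau>) js))" for y
    using linear_neg[OF linear_wedge] by blast
  have "(\<exists>x k. - x \<in> \<sigma> \<and> k > 0 \<and> wedge (x # b \<tau>) = (\<lambda>js. k * wedge (b \<sigma>) js)) \<longleftrightarrow> \<kappa> < 0"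
  proof
    assume "\<exists>x k. - x \<in> \<sigma> \<and> k > 0 \<and> wedge (x # b \<tau>) = (\<lambda>js. k * wedge (b \<sigma>) js)"
    then obtain x k where x: "- x \<in> \<sigma>" "k > 0" "wedge (x # b \<tau>) = (\<lambda>js. k * wedge (b \<sigma>) js)" by blast
    have "wedge ((- x) # b \<tau>) = (\<lambda>js. (- k) * wedge (b \<sigma>) js)" unfolding neg x(3) by simp
    then show "\<kappa> < 0" using same[OF x(1)] x(2) \<open>\<kappa> \<noteq> 0\<close> by (meson neg_less_0_iff_less not_less_iff_gr_or_eq)
  next
    assume "\<kappa> < 0"
    moreover have "wedge ((- s) # b \<tau>) = (\<lambda>js. (- \<kappa>) * wedge (b \<sigma>) js)" unfolding neg \<kappa> by simp
    ultimately show "\<exists>x k. - x \<in> \<sigma> \<and> k > 0 \<and> wedge (x # b \<tau>) = (\<lambda>js. k * wedge (b \<sigma>) js)"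
      using s\<sigma> by (intro exI[of _ "- s"] exI[of _ "- \<kappa>"]) simp
  qed
  then have "rel_sign b \<tau> \<sigma> = (if \<kappa> < 0 then 1 else -1)" by (simp add: rel_sign_def)
  then show ?thesis using that \<open>\<kappa> \<noteq> 0\<close> \<kappa> by blast
qed

text \<open>
  The orientation of \<open>\<sigma>\<close> enters both factors and cancels. What remains is the orientation form of
  the plane \<open>\<real>\<^sup>n / span \<tau>\<close> at the direction of the region and the direction of \<open>\<sigma>\<close>.
\<close>

lemma rel_sign_region_sign:
  assumes "facet \<sigma>" "\<tau> \<in> \<Sigma>" "\<tau> face_of \<sigma>" "Suc (dim \<tau>) = dim \<sigma>" "j \<in> V" "bounds j \<sigma>"
    and s: "s \<in> rel_interior \<sigma>"
  shows "wedge (region_point j # s # b \<tau>) coords \<noteq> 0"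
    and "rel_sign b \<tau> \<sigma> * region_sign j \<sigma> =
      (if wedge (region_point j # s # b \<tau>) coords > 0 then -1 else 1)"
proof -
  have \<sigma>: "\<sigma> \<in> \<Sigma>" using assms by (simp add: facet_def)
  obtain \<kappa> where \<kappa>: "\<kappa> \<noteq> 0" "wedge (s # b \<tau>) = (\<lambda>js. \<kappa> * wedge (b \<sigma>) js)"
    "rel_sign b \<tau> \<sigma> = (if \<kappa> < 0 then 1 else -1)"
    by (rule rel_sign_eq[OF \<sigma> assms(2-4) s]) (rule that)
  have eq: "wedge (region_point j # s # b \<tau>) coords = \<kappa> * side_form \<sigma> (region_point j)"
    unfolding side_form_def wedge_Cons[of "region_point j"] \<kappa>(2) ext_prod_scale_right ..
  have nz: "side_form \<sigma> (region_point j) \<noteq> 0"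
    using region_point_notin_span side_form_eq_0_iff assms by blast
  show "wedge (region_point j # s # b \<tau>) coords \<noteq> 0" using eq nz \<kappa>(1) by simp
  show "rel_sign b \<tau> \<sigma> * region_sign j \<sigma> =
      (if wedge (region_point j # s # b \<tau>) coords > 0 then -1 else 1)"
    using nz \<kappa>(1) assms(6) unfolding eq \<kappa>(3) region_sign_def
    by (auto simp: zero_less_mult_iff)
qed

text \<open>
  Adding a large multiple of a relative interior point of \<open>\<tau>\<close> moves any vector of \<open>span \<tau>\<close> into \<open>\<tau>\<close>.
  This allows computations modulo \<open>span \<tau>\<close> near \<open>\<tau>\<close>.
\<close>

lemma add_multiple_in_cone:
  assumes "\<tau> \<in> \<Sigma>" "t \<in> rel_interior \<tau>" "v \<in> span \<tau>"
  obtains N where "N > 0" "N *\<^sub>R t + v \<in> \<tau>"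
proof -
  obtain \<epsilon> where \<epsilon>: "\<epsilon> > 0" "\<And>y. y \<in> span \<tau> \<Longrightarrow> dist t y < \<epsilon> \<Longrightarrow> y \<in> \<tau>"
    using rel_interior_ball[OF assms(1,2)] by blast
  define N where "N = (norm v + 1) / \<epsilon>"
  have N: "N > 0" using \<epsilon> by (simp add: N_def add_nonneg_pos)
  have "norm v / N < \<epsilon>" using \<epsilon> N by (simp add: N_def field_simps)
  then have "dist t (t + (1 / N) *\<^sub>R v) < \<epsilon>" using N by (simp add: dist_norm)
  moreover have "t + (1 / N) *\<^sub>R v \<in> span \<tau>"
    using assms rel_interior_subset by (intro span_add span_scale) (auto intro: span_base)
  ultimately have "N *\<^sub>R (t + (1 / N) *\<^sub>R v) \<in> \<tau>"
    using \<epsilon>(2) N by (intro conicD[OF cone_conic[OF assms(1)]]) auto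
  then show ?thesis using that N by (simp add: scaleR_add_right)
qed

text \<open>
  Around a cone \<open>\<tau>\<close> of codimension 2 everything takes place in the plane \<open>\<real>\<^sup>n / span \<tau>\<close>. There the
  region of \<open>j\<close> becomes a convex cone and the facets through \<open>\<tau>\<close> that bound it become its boundary
  rays. The cycle condition says that these rays cancel: if there is one, there is exactly one on
  each side of a direction \<open>c\<close> inside the region. With respect to \<open>c\<close>, the sides are told apart by
  the sign of the orientation form \<open>turn c\<close>.
\<close>

context
  fixes \<tau> :: "(real^'n) set" and j :: "real^'n"
  assumes \<tau>: "\<tau> \<in> \<Sigma>" "Suc (Suc (dim \<tau>)) = CARD('n)" and j: "j \<in> V"
begin

definition star_facets :: "(real^'n) set set"
  where "star_facets = {\<sigma>. facet \<sigma> \<and> \<tau> face_of \<sigma> \<and> bounds j \<sigma>}"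

definition turn :: "real^'n \<Rightarrow> real^'n \<Rightarrow> real"
  where "turn x y = wedge (x # y # b \<tau>) coords"

lemma star_facetsD:
  assumes "\<sigma> \<in> star_facets"
  shows "facet \<sigma>" "\<sigma> \<in> \<Sigma>" "\<tau> face_of \<sigma>" "\<tau> \<subseteq> \<sigma>" "Suc (dim \<tau>) = dim \<sigma>" "bounds j \<sigma>" "\<tau> \<noteq> \<sigma>"
  using assms \<tau>(2) face_of_imp_subset by (auto simp: star_facets_def facet_def)

lemma linear_turn: "linear (\<lambda>x. turn x y)"
  unfolding turn_def by (rule linear_wedge)

lemma turn_swap: "turn x y = - turn y x"
  unfolding turn_def by (rule wedge_swap)

lemma turn_span: "t \<in> span \<tau> \<Longrightarrow> turn t y = 0"
  unfolding turn_def using basis(4)[OF \<tau>(1)]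
  by (subst wedge_dependent) (auto intro: set_rev_mp[OF _ span_mono])

lemma turn_cramer:
  assumes "turn c s \<noteq> 0"
  shows "turn s s' *\<^sub>R c - turn c s' *\<^sub>R s + turn c s *\<^sub>R s' \<in> span \<tau>"
  using plane_cramer[of "b \<tau>" c s s'] assms basis[OF \<tau>(1)] \<tau>(2) by (simp add: turn_def)

text \<open>
  If \<open>s\<close> were strictly between \<open>c\<close> and \<open>s'\<close> in the plane, then Cramer's rule would write a positive
  multiple of \<open>s\<close>, up to an element of \<open>\<tau>\<close>, as a sum of a positive multiple of \<open>c\<close> and points of the
  closed region. That sum is inside the open region, but it also lies in the support.
\<close>

lemma not_between_interior_and_facet:
  assumes \<sigma>: "\<sigma> \<in> star_facets" "s \<in> \<sigma>" and \<sigma>': "\<sigma>' \<in> star_facets" "s' \<in> \<sigma>'"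
    and c: "c \<in> region V j"
    and "turn c s * turn c s' > 0"
  shows "turn s s' * turn c s \<le> 0"
proof (rule ccontr)
  assume "\<not> ?thesis"
  then have pos: "turn s s' * turn c s > 0" by simp
  define \<beta> where "\<beta> = turn c s"
  have \<beta>: "\<beta> \<noteq> 0" "turn c s' / \<beta> > 0" "turn s s' / \<beta> > 0"
    using assms(6) pos by (auto simp: \<beta>_def zero_less_mult_iff zero_less_divide_iff)
  define v where "v = turn s s' *\<^sub>R c - turn c s' *\<^sub>R s + \<beta> *\<^sub>R s'"
  have v: "v \<in> span \<tau>" using turn_cramer \<beta>(1) by (simp add: v_def \<beta>_def)
  obtain t where t: "t \<in> rel_interior \<tau>" "t \<in> \<tau>" by (rule rel_interior_point[OF \<tau>(1)])
  obtain N where N: "N > 0" "N *\<^sub>R t + (- (1 / \<beta>)) *\<^sub>R v \<in> \<tau>"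
    using add_multiple_in_cone[OF \<tau>(1) t(1), of "(- (1 / \<beta>)) *\<^sub>R v"] v span_scale by blast
  let ?p = "(turn c s' / \<beta>) *\<^sub>R s + N *\<^sub>R t"
  have p: "?p = (turn s s' / \<beta>) *\<^sub>R c + s' + (N *\<^sub>R t + (- (1 / \<beta>)) *\<^sub>R v)"
    using \<beta>(1) by (simp add: v_def scaleR_add_right scaleR_diff_right)
  have "t \<in> \<sigma>" using t(2) star_facetsD(4)[OF \<sigma>(1)] by blast
  then have "?p \<in> \<sigma>"
    using \<beta> N \<sigma>(2) cone_conic[OF star_facetsD(2)[OF \<sigma>(1)]] cone_convex[OF star_facetsD(2)[OF \<sigma>(1)]]
    by (intro convex_cone_add) (auto simp: convex_cone_def intro: conicD less_imp_le)
  then have "?p \<notin> region V j"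
    using support_iff_regions[of ?p] star_facetsD(2)[OF \<sigma>(1)] j by blast
  moreover have "?p \<in> region V j"
    unfolding region_def
  proof (rule CollectI, rule ballI)
    fix k assume k: "k \<in> V - {j}"
    have "k \<bullet> c < j \<bullet> c" using c k by (simp add: region_def)
    then have "k \<bullet> ((turn s s' / \<beta>) *\<^sub>R c) < j \<bullet> ((turn s s' / \<beta>) *\<^sub>R c)"
      unfolding inner_scaleR_right using \<beta>(3) by (rule mult_strict_left_mono)
    moreover have "k \<bullet> x \<le> j \<bullet> x" if "x \<in> \<rho>" "bounds j \<rho>" for x \<rho>
      using that k by (auto simp: bounds_def top_face_def)
    then have "k \<bullet> s' \<le> j \<bullet> s'"
      "k \<bullet> (N *\<^sub>R t + (- (1 / \<beta>)) *\<^sub>R v) \<le> j \<bullet> (N *\<^sub>R t + (- (1 / \<beta>)) *\<^sub>R v)"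
      using \<sigma>'(2) star_facetsD(4,6)[OF \<sigma>'(1)] N(2) by blast+
    ultimately show "k \<bullet> ?p < j \<bullet> ?p" unfolding p inner_add_right by linarith
  qed
  ultimately show False by blast
qed

text \<open>
  Neither of \<open>s\<close> and \<open>s'\<close> is strictly between \<open>c\<close> and the other one, so they are on the same ray of the
  plane. Then \<open>\<sigma>\<close> and \<open>\<sigma>'\<close> share a point that is a positive combination of \<open>s\<close> and a point of \<open>\<tau>\<close>,
  and \<open>s\<close> lies in the common face.
\<close>

lemma star_facet_unique:
  assumes \<sigma>: "\<sigma> \<in> star_facets" "s \<in> rel_interior \<sigma>" and \<sigma>': "\<sigma>' \<in> star_facets" "s' \<in> rel_interior \<sigma>'"
    and c: "c \<in> region V j" and same: "turn c s * turn c s' > 0"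
  shows "\<sigma> = \<sigma>'"
proof -
  have s: "s \<in> \<sigma>" "s' \<in> \<sigma>'" using \<sigma> \<sigma>' rel_interior_subset by blast+
  have "turn s s' * turn c s \<le> 0"
    using not_between_interior_and_facet[OF \<sigma>(1) s(1) \<sigma>'(1) s(2) c same] .
  moreover have "turn s' s * turn c s' \<le> 0"
    using not_between_interior_and_facet[OF \<sigma>'(1) s(2) \<sigma>(1) s(1) c] same by (simp add: mult.commute)
  then have "turn s s' * turn c s' \<ge> 0" using turn_swap[of s' s] by simp
  ultimately have prod: "(turn s s' * turn c s) * (turn s s' * turn c s') \<le> 0"
    by (rule mult_nonpos_nonneg)
  have "turn s s' = 0"
  proof (rule ccontr)
    assume "turn s s' \<noteq> 0"
    then have "turn s s' * turn s s' > 0" by (auto simp: zero_less_mult_iff neq_iff)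
    then have "(turn s s' * turn s s') * (turn c s * turn c s') > 0" using same by (rule mult_pos_pos)
    then show False using prod by (simp add: mult_ac)
  qed
  define \<beta> where "\<beta> = turn c s"
  have \<beta>: "\<beta> \<noteq> 0" "turn c s' / \<beta> > 0" using same by (auto simp: \<beta>_def zero_less_mult_iff zero_less_divide_iff)
  define v where "v = \<beta> *\<^sub>R s' - turn c s' *\<^sub>R s"
  have v: "v \<in> span \<tau>"
    using turn_cramer[of c s s'] \<beta>(1) \<open>turn s s' = 0\<close> by (simp add: v_def \<beta>_def)
  obtain t where t: "t \<in> rel_interior \<tau>" "t \<in> \<tau>" by (rule rel_interior_point[OF \<tau>(1)])
  obtain N where N: "N > 0" "N *\<^sub>R t + (- (1 / \<beta>)) *\<^sub>R v \<in> \<tau>"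
    using add_multiple_in_cone[OF \<tau>(1) t(1), of "(- (1 / \<beta>)) *\<^sub>R v"] v span_scale by blast
  define \<mu> where "\<mu> = turn c s' / \<beta>"
  have \<mu>: "\<mu> > 0" using \<beta>(2) by (simp add: \<mu>_def)
  let ?p = "\<mu> *\<^sub>R s + N *\<^sub>R t"
  have "?p = s' + (N *\<^sub>R t + (- (1 / \<beta>)) *\<^sub>R v)"
    using \<beta>(1) by (simp add: v_def \<mu>_def scaleR_diff_right)
  moreover have "N *\<^sub>R t + (- (1 / \<beta>)) *\<^sub>R v \<in> \<sigma>'" using N(2) star_facetsD(4)[OF \<sigma>'(1)] by blast
  ultimately have p\<sigma>': "?p \<in> \<sigma>'"
    using s(2) cone_conic[OF star_facetsD(2)[OF \<sigma>'(1)]] cone_convex[OF star_facetsD(2)[OF \<sigma>'(1)]]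
    by (metis convex_cone_add convex_cone_def empty_iff)
  have t\<sigma>: "t \<in> \<sigma>" using t(2) star_facetsD(4)[OF \<sigma>(1)] by blast
  have conic: "conic \<sigma>" "convex \<sigma>" using cone_conic cone_convex star_facetsD(2)[OF \<sigma>(1)] by auto
  have ends: "(2 * \<mu>) *\<^sub>R s \<in> \<sigma>" "(2 * N) *\<^sub>R t \<in> \<sigma>"
    using \<mu> N(1) by (auto intro!: conicD[OF conic(1)] s t\<sigma>)
  have mid: "?p = (1 - 1 / 2) *\<^sub>R ((2 * \<mu>) *\<^sub>R s) + (1 / 2) *\<^sub>R ((2 * N) *\<^sub>R t)" by simp
  have "(2 * \<mu>) *\<^sub>R s \<noteq> (2 * N) *\<^sub>R t"
  proof
    assume "(2 * \<mu>) *\<^sub>R s = (2 * N) *\<^sub>R t"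
    moreover have "s = (1 / (2 * \<mu>)) *\<^sub>R ((2 * \<mu>) *\<^sub>R s)" using \<mu> by simp
    ultimately have "s = (1 / (2 * \<mu>)) *\<^sub>R ((2 * N) *\<^sub>R t)" by simp
    moreover have "t \<in> span \<tau>" using t(2) by (rule span_base)
    ultimately have "s \<in> span \<tau>" by (metis span_scale)
    then show False
      using rel_interior_notin_span_face[OF rational_cone_fan[OF star_facetsD(2)[OF \<sigma>(1)]] cone_0[OF \<tau>(1)]]
        star_facetsD(3,7)[OF \<sigma>(1)] \<sigma>(2) by blast
  qed
  then have "?p \<in> open_segment ((2 * \<mu>) *\<^sub>R s) ((2 * N) *\<^sub>R t)"
    unfolding in_segment using mid by (intro conjI exI[of _ "1/2"]) auto
  moreover have "?p \<in> \<sigma> \<inter> \<sigma>'"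
  proof
    show "?p \<in> \<sigma>" unfolding mid by (intro convexD[OF conic(2)] ends) auto
  qed (rule p\<sigma>')
  ultimately have "(2 * \<mu>) *\<^sub>R s \<in> \<sigma> \<inter> \<sigma>'"
    using face_ofD[OF fan_Int(1)[OF star_facetsD(2)[OF \<sigma>(1)] star_facetsD(2)[OF \<sigma>'(1)]] _ ends] by blast
  then have "(2 * \<mu>) *\<^sub>R s \<in> \<sigma>'" by blast
  from conicD[OF cone_conic[OF star_facetsD(2)[OF \<sigma>'(1)]] this, of "1 / (2 * \<mu>)"]
  have "s \<in> \<sigma>'" using \<mu> by simp
  then show ?thesis
    using facet_unique[OF star_facetsD(1)[OF \<sigma>(1)] \<sigma>(2) star_facetsD(2)[OF \<sigma>'(1)]] by simp
qed

text \<open>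
  The directions \<open>a *\<^sub>R c - s\<close> are opposite to \<open>s\<close> with respect to \<open>c\<close>. They point into the region
  of \<open>j\<close> for large \<open>a\<close> and leave it at the largest \<open>a\<close> for which some \<open>k\<close> ties with \<open>j\<close>. Starting
  at \<open>t\<close> in the direction \<open>q\<close> belonging to this \<open>a\<close>, one stays in the support and in the closed
  region, so one enters the facet on the other side.
\<close>

lemma opposite_star_facet:
  assumes \<sigma>: "\<sigma> \<in> star_facets" "s \<in> rel_interior \<sigma>" and c: "c \<in> region V j" and cs: "turn c s \<noteq> 0"
  obtains \<rho> y where "\<rho> \<in> star_facets" "y \<in> rel_interior \<rho>" "turn c s * turn c y < 0"
proof -
  obtain t where t: "t \<in> rel_interior \<tau>" "t \<in> \<tau>" by (rule rel_interior_point[OF \<tau>(1)])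
  have tj: "j \<in> top_face V t" using t(2) star_facetsD(4,6)[OF \<sigma>(1)] by (auto simp: bounds_def)
  (* Only the vertices that tie with j at t matter near t. *)
  define J where "J = {k\<in>V - {j}. k \<bullet> t = j \<bullet> t}"
  have "finite J" using finite_V by (simp add: J_def)
  obtain k\<^sub>0 where "k\<^sub>0 \<in> V" "k\<^sub>0 \<noteq> j" "bounds k\<^sub>0 \<sigma>"
    using bounds_other_side[OF star_facetsD(1)[OF \<sigma>(1)] j star_facetsD(6)[OF \<sigma>(1)]] by blast
  moreover from this have "k\<^sub>0 \<in> top_face V t"
    using t(2) star_facetsD(4)[OF \<sigma>(1)] by (auto simp: bounds_def)
  ultimately have "k\<^sub>0 \<in> J" using tj by (auto simp: J_def top_face_def intro: antisym)
  have jc: "(k - j) \<bullet> c < 0" if "k \<in> V" "k \<noteq> j" for k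
    using c that by (simp add: region_def inner_diff_left)
  define a where "a = Max ((\<lambda>k. ((k - j) \<bullet> s) / ((k - j) \<bullet> c)) ` J)"
  have "a \<in> (\<lambda>k. ((k - j) \<bullet> s) / ((k - j) \<bullet> c)) ` J"
    unfolding a_def using \<open>finite J\<close> \<open>k\<^sub>0 \<in> J\<close> by (intro Max_in) auto
  then obtain k\<^sub>1 where k\<^sub>1: "k\<^sub>1 \<in> J" "a = ((k\<^sub>1 - j) \<bullet> s) / ((k\<^sub>1 - j) \<bullet> c)" by blast
  define q where "q = a *\<^sub>R c - s"
  have q: "(k - j) \<bullet> q \<le> 0" if "k \<in> J" for k
  proof -
    have neg: "(k - j) \<bullet> c < 0" using that jc by (simp add: J_def)
    have "((k - j) \<bullet> s) / ((k - j) \<bullet> c) \<le> a" unfolding a_def using \<open>finite J\<close> that by simp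
    then have "a * ((k - j) \<bullet> c) \<le> (k - j) \<bullet> s" using neg by (simp add: neg_divide_le_eq)
    then show ?thesis by (simp add: q_def inner_diff_right)
  qed
  have q\<^sub>1: "(k\<^sub>1 - j) \<bullet> q = 0"
    using jc[of k\<^sub>1] k\<^sub>1 by (simp add: q_def inner_diff_right J_def)
  obtain \<epsilon> where \<epsilon>: "\<epsilon> > 0" "\<And>\<rho> y. \<rho> \<in> \<Sigma> \<Longrightarrow> y \<in> \<rho> \<Longrightarrow> dist t y < \<epsilon> \<Longrightarrow> t \<in> \<rho>"
    using locally_through_point[of t] by blast
  have lim: "((\<lambda>\<eta>. t + \<eta> *\<^sub>R q) \<longlongrightarrow> t) (at_right 0)"
    by (rule tendsto_eq_intros refl | simp)+
  have "\<forall>\<^sub>F \<eta> in at_right 0. k \<bullet> (t + \<eta> *\<^sub>R q) \<le> j \<bullet> (t + \<eta> *\<^sub>R q)" if k: "k \<in> V" for k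
  proof (cases "k \<in> J \<or> k = j")
    case True
    have "k \<bullet> (t + \<eta> *\<^sub>R q) \<le> j \<bullet> (t + \<eta> *\<^sub>R q)" if "\<eta> > 0" for \<eta>
    proof -
      have "\<eta> * ((k - j) \<bullet> q) \<le> 0" using q[of k] True that by (auto simp: mult_le_0_iff)
      moreover have "k \<bullet> t = j \<bullet> t" using True by (auto simp: J_def)
      ultimately show ?thesis by (simp add: inner_add_right inner_diff_left algebra_simps)
    qed
    then show ?thesis by (intro eventually_at_rightI[of 0 1]) auto
  next
    case False
    have "k \<bullet> t \<le> j \<bullet> t" using tj k by (simp add: top_face_def)
    then have "(k - j) \<bullet> t < 0" using False k by (auto simp: J_def inner_diff_left)
    moreover have "((\<lambda>\<eta>. (k - j) \<bullet> (t + \<eta> *\<^sub>R q)) \<longlongrightarrow> (k - j) \<bullet> t) (at_right 0)"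
      by (intro tendsto_inner tendsto_const lim)
    ultimately have "\<forall>\<^sub>F \<eta> in at_right 0. (k - j) \<bullet> (t + \<eta> *\<^sub>R q) < 0"
      by (rule order_tendstoD(2)[rotated])
    then show ?thesis by eventually_elim (simp add: inner_diff_left)
  qed
  then have "\<forall>\<^sub>F \<eta> in at_right 0. \<forall>k\<in>V. k \<bullet> (t + \<eta> *\<^sub>R q) \<le> j \<bullet> (t + \<eta> *\<^sub>R q)"
    using finite_V by (simp add: eventually_ball_finite_distrib)
  moreover have "\<forall>\<^sub>F \<eta> in at_right 0. dist (t + \<eta> *\<^sub>R q) t < \<epsilon>" using lim \<epsilon>(1) by (rule tendstoD)
  moreover have "\<forall>\<^sub>F \<eta> in at_right (0::real). \<eta> > 0" by (simp add: eventually_at_right_less)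
  ultimately have "\<forall>\<^sub>F \<eta> in at_right 0. (\<forall>k\<in>V. k \<bullet> (t + \<eta> *\<^sub>R q) \<le> j \<bullet> (t + \<eta> *\<^sub>R q))
      \<and> dist (t + \<eta> *\<^sub>R q) t < \<epsilon> \<and> \<eta> > 0"
    by eventually_elim simp
  then obtain \<eta> where \<eta>: "\<And>k. k \<in> V \<Longrightarrow> k \<bullet> (t + \<eta> *\<^sub>R q) \<le> j \<bullet> (t + \<eta> *\<^sub>R q)"
    "dist (t + \<eta> *\<^sub>R q) t < \<epsilon>" "\<eta> > 0"
    using eventually_happens[of _ "at_right (0::real)"] trivial_limit_at_right_real by blast
  define y where "y = t + \<eta> *\<^sub>R q"
  have yj: "j \<in> top_face V y" using \<eta>(1) j by (simp add: top_face_def y_def)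
  have "k\<^sub>1 \<bullet> y = j \<bullet> y"
    using q\<^sub>1 k\<^sub>1(1) by (simp add: y_def J_def inner_add_right inner_diff_left)
  then have "k\<^sub>1 \<in> top_face V y" using yj k\<^sub>1(1) by (simp add: top_face_def J_def)
  then have "y \<in> \<Union>\<Sigma>" using yj k\<^sub>1(1) unfolding support J_def by blast
  then obtain \<rho> where \<rho>: "\<rho> \<in> \<Sigma>" "y \<in> rel_interior \<rho>" by (rule in_rel_interior_of_cone)
  have "turn c c = 0" using turn_swap[of c c] by simp
  have "turn y c = - \<eta> * turn s c"
    unfolding y_def q_def linear_add[OF linear_turn] linear_diff[OF linear_turn] linear_scale[OF linear_turn]
    using turn_span[OF span_base[OF t(2)]] \<open>turn c c = 0\<close> by simp
  then have cy: "turn c y = - \<eta> * turn c s" using turn_swap[of c y] turn_swap[of c s] by simp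
  then have "turn c y \<noteq> 0" using cs \<eta>(3) by simp
  then have "y \<notin> span \<tau>" using turn_span turn_swap[of c y] by fastforce
  have "t \<in> \<rho>" using \<epsilon>(2)[OF \<rho>(1), of y] \<rho>(2) rel_interior_subset \<eta>(2) by (auto simp: y_def dist_commute)
  then have face: "\<tau> face_of \<rho>" using rel_interior_in_cone_face[OF \<tau>(1) \<rho>(1) t(1)] by blast
  moreover have "\<tau> \<noteq> \<rho>" using \<open>y \<notin> span \<tau>\<close> \<rho>(2) rel_interior_subset span_base by blast
  ultimately have "dim \<tau> < dim \<rho>"
    using dim_face_less[OF rational_cone_fan[OF \<rho>(1)] cone_0[OF \<tau>(1)]] by blast
  then have facet: "facet \<rho>" using dim_cone_less[OF \<rho>(1)] \<tau>(2) \<rho>(1) by (simp add: facet_def)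
  then have "bounds j \<rho>" using bounds_if_top[OF _ \<rho>(2) yj] by blast
  then have "\<rho> \<in> star_facets" using facet face by (simp add: star_facets_def)
  moreover have "turn c s * turn c y < 0"
  proof -
    have "turn c s * turn c s > 0" using cs by (auto simp: zero_less_mult_iff neq_iff)
    then show ?thesis unfolding cy using \<eta>(3) by (simp add: mult.left_commute)
  qed
  ultimately show ?thesis using that \<rho>(2) by blast
qed

lemma region_boundary_is_cycle:
  "(\<Sum>\<sigma> | facet \<sigma> \<and> \<tau> face_of \<sigma>. rel_sign b \<tau> \<sigma> * region_sign j \<sigma>) = 0"
proof -
  define g where "g \<sigma> = rel_sign b \<tau> \<sigma> * region_sign j \<sigma>" for \<sigma>
  let ?c = "region_point j"
  have c: "?c \<in> region V j" using j by (rule region_point)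
  have fin: "finite {\<sigma>. facet \<sigma> \<and> \<tau> face_of \<sigma>}"
    using finite_fan by (rule rev_finite_subset) (auto simp: facet_def)
  have g: "turn ?c s \<noteq> 0" "g \<sigma> = (if turn ?c s > 0 then -1 else 1)"
    if "\<sigma> \<in> star_facets" "s \<in> rel_interior \<sigma>" for \<sigma> s
    using rel_sign_region_sign[OF star_facetsD(1)[OF that(1)] \<tau>(1) star_facetsD(3,5)[OF that(1)] j
        star_facetsD(6)[OF that(1)] that(2)]
    by (simp_all add: g_def turn_def)
  have point: "\<exists>s. s \<in> rel_interior \<sigma>" if "\<sigma> \<in> star_facets" for \<sigma>
    using rel_interior_eq_empty cone_convex cone_0 star_facetsD(2)[OF that] by blast
  have "(\<Sum>\<sigma> | facet \<sigma> \<and> \<tau> face_of \<sigma>. g \<sigma>) = (\<Sum>\<sigma>\<in>star_facets. g \<sigma>)"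
    using fin by (intro sum.mono_neutral_right) (auto simp: star_facets_def g_def region_sign_def)
  also have "\<dots> = 0"
  proof (cases "star_facets = {}")
    case False
    then obtain \<sigma> s where \<sigma>: "\<sigma> \<in> star_facets" "s \<in> rel_interior \<sigma>" using point by blast
    obtain \<rho> y where \<rho>: "\<rho> \<in> star_facets" "y \<in> rel_interior \<rho>" "turn ?c s * turn ?c y < 0"
      using opposite_star_facet[OF \<sigma> c g(1)[OF \<sigma>]] by blast
    have opp: "g \<rho> = - g \<sigma>"
      using g(2)[OF \<sigma>] g(2)[OF \<rho>(1,2)] \<rho>(3) by (auto simp: mult_less_0_iff)
    have "\<pi> = \<sigma> \<or> \<pi> = \<rho>" if \<pi>: "\<pi> \<in> star_facets" for \<pi>
    proof -
      obtain x where x: "x \<in> rel_interior \<pi>" using point \<pi> by blast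
      have "turn ?c s * turn ?c x > 0 \<or> turn ?c y * turn ?c x > 0"
        using \<rho>(3) g(1)[OF \<pi> x] by (auto simp: mult_less_0_iff zero_less_mult_iff linorder_neq_iff)
      then show ?thesis
        using star_facet_unique[OF \<sigma> \<pi> x c] star_facet_unique[OF \<rho>(1,2) \<pi> x c] by blast
    qed
    then have eq: "star_facets = {\<sigma>, \<rho>}" using \<sigma>(1) \<rho>(1) by blast
    have "\<sigma> \<noteq> \<rho>" using opp g(2)[OF \<sigma>] by (auto split: if_splits)
    then show ?thesis using opp by (simp add: eq)
  qed simp
  finally show ?thesis by (simp add: g_def)
qed

end

end

section \<open>Vertex differences and their potentials\<close>

lemma inner_int_lattice: "x \<in> int_lattice \<Longrightarrow> y \<in> int_lattice \<Longrightarrow> x \<bullet> y \<in> \<int>"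
  unfolding int_lattice_def inner_vec_def by (auto intro!: Ints_sum Ints_mult)

lemma ext_prod_sum: "finite I \<Longrightarrow> ext_prod x (\<Sum>i\<in>I. f i) = (\<Sum>i\<in>I. ext_prod x (f i))"
proof (induction rule: finite_induct)
  case (insert i I)
  then show ?case unfolding sum.insert[OF insert.hyps] ext_prod_add_right by metis
qed (simp only: sum.empty ext_prod_0_right)

lemma sum_fun_apply: "finite I \<Longrightarrow> (\<Sum>i\<in>I. f i) x = (\<Sum>i\<in>I. f i x)"
  by (induction rule: finite_induct) simp_all

text \<open>
  The vector \<open>(j - k) / m\<close> is integral, and it is primitive because \<open>x\<close> takes the value 1 or -1 on
  it. So the lattice points of the segment divide it into \<open>\<bar>m\<bar>\<close> equal parts.
\<close>

lemma lattice_length_segment: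
  fixes j k x :: "real^'n" and m :: int
  assumes jk: "j \<in> int_lattice" "k \<in> int_lattice" and prim: "\<And>l. (j - k) $ l / of_int m \<in> \<int>"
    and x: "x \<in> int_lattice" "\<bar>(j - k) \<bullet> x\<bar> = \<bar>of_int m\<bar>" and m: "m \<noteq> 0"
  shows "lattice_length (closed_segment j k) = nat \<bar>m\<bar>"
proof -
  let ?p = "\<lambda>i. k + (of_int i / of_int \<bar>m\<bar>) *\<^sub>R (j - k)"
  have "j \<noteq> k" using x m by auto
  have "closed_segment j k \<inter> int_lattice = ?p ` {0..\<bar>m\<bar>}"
  proof
    show "closed_segment j k \<inter> int_lattice \<subseteq> ?p ` {0..\<bar>m\<bar>}"
    proof
      fix y assume y: "y \<in> closed_segment j k \<inter> int_lattice"
      then obtain u where u: "0 \<le> u" "u \<le> 1" "y = (1 - u) *\<^sub>R k + u *\<^sub>R j"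
        using closed_segment_commute[of j k] by (auto simp: in_segment)
      have yk: "y - k = u *\<^sub>R (j - k)" unfolding u(3) by (simp add: algebra_simps)
      have "y - k \<in> int_lattice" using y jk by (auto simp: int_lattice_def)
      then have "u * ((j - k) \<bullet> x) \<in> \<int>" using inner_int_lattice[OF _ x(1), of "y - k"] by (simp add: yk)
      then have "\<bar>u * ((j - k) \<bullet> x)\<bar> \<in> \<int>" by simp
      then have "u * of_int \<bar>m\<bar> \<in> \<int>" using u(1) x(2) by (simp add: abs_mult)
      then obtain i where i: "u * of_int \<bar>m\<bar> = of_int i" by (metis Ints_cases)
      then have "u = of_int i / of_int \<bar>m\<bar>" using m by (simp add: field_simps)
      then have "y = ?p i" using yk by (simp add: algebra_simps)
      moreover have "0 \<le> (of_int i :: real)" "(of_int i :: real) \<le> of_int \<bar>m\<bar>"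
        unfolding i[symmetric] using u by (simp_all add: mult_left_le_one_le)
      then have "i \<in> {0..\<bar>m\<bar>}" by (simp only: atLeastAtMost_iff of_int_0_le_iff of_int_le_iff)
      ultimately show "y \<in> ?p ` {0..\<bar>m\<bar>}" by blast
    qed
    show "?p ` {0..\<bar>m\<bar>} \<subseteq> closed_segment j k \<inter> int_lattice"
    proof
      fix y assume "y \<in> ?p ` {0..\<bar>m\<bar>}"
      then obtain i where i: "0 \<le> i" "i \<le> \<bar>m\<bar>" "y = ?p i" by auto
      have "y = (1 - of_int i / of_int \<bar>m\<bar>) *\<^sub>R k + (of_int i / of_int \<bar>m\<bar>) *\<^sub>R j"
        unfolding i(3) by (simp add: algebra_simps)
      moreover have "0 \<le> (of_int i / of_int \<bar>m\<bar> :: real)" "(of_int i / of_int \<bar>m\<bar> :: real) \<le> 1"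
        using i m by simp_all
      ultimately have "y \<in> closed_segment k j" unfolding in_segment by blast
      moreover have "y $ l \<in> \<int>" for l
      proof -
        have "of_int i / of_int \<bar>m\<bar> * (j - k) $ l = of_int (i * sgn m) * ((j - k) $ l / of_int m)"
          using m by (cases "m > 0") (simp_all add: sgn_if abs_if)
        then have "y $ l = k $ l + of_int (i * sgn m) * ((j - k) $ l / of_int m)"
          unfolding i(3) by simp
        moreover have "k $ l \<in> \<int>" using jk by (simp add: int_lattice_def)
        ultimately show ?thesis using prim[of l] by (metis Ints_add Ints_mult Ints_of_int)
      qed
      ultimately show "y \<in> closed_segment j k \<inter> int_lattice"
        unfolding closed_segment_commute[of j k] by (simp add: int_lattice_def)
    qed
  qed
  moreover have "inj_on ?p {0..\<bar>m\<bar>}" using m \<open>j \<noteq> k\<close> by (auto simp: inj_on_def)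
  ultimately have "card (closed_segment j k \<inter> int_lattice) = card {0..\<bar>m\<bar>}"
    by (simp add: card_image)
  then show ?thesis by (simp add: lattice_length_def)
qed

context oriented_max_fan
begin

lemma bounds_at_most_two:
  assumes "facet \<sigma>" "j \<noteq> k" "bounds j \<sigma>" "bounds k \<sigma>" "bounds i \<sigma>" shows "i = j \<or> i = k"
proof -
  obtain j' k' where jk: "j' \<in> V" "k' \<in> V" "j' \<noteq> k'"
    "\<And>s. s \<in> rel_interior \<sigma> \<Longrightarrow> top_face V s = {j', k'}"
    by (rule facet_sides[OF assms(1)]) (rule that)
  have "\<sigma> \<in> \<Sigma>" using assms(1) by (simp add: facet_def)
  then obtain s where s: "s \<in> rel_interior \<sigma>" "s \<in> \<sigma>" by (rule rel_interior_point)
  then have "{j, k, i} \<subseteq> {j', k'}" using assms(3-5) jk(4)[OF s(1)] unfolding bounds_def by blast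
  then show ?thesis using assms(2) by auto
qed

text \<open>
  Both \<open>j - k\<close> and the side form vanish on \<open>span \<sigma>\<close>, and the side form is primitive. So the edge
  dual to \<open>\<sigma>\<close> is an integral multiple of the side form, the factor being its lattice length up to
  sign.
\<close>

lemma edge_multiple_of_side_form:
  assumes V_int: "V \<subseteq> int_lattice" and \<sigma>: "facet \<sigma>" and jk: "j \<in> V" "k \<in> V" "j \<noteq> k" "bounds j \<sigma>" "bounds k \<sigma>"
  obtains m :: int where "m \<noteq> 0" "\<And>x. (j - k) \<bullet> x = of_int m * side_form \<sigma> x"
    "lattice_length (closed_segment j k) = nat \<bar>m\<bar>"
proof -
  have \<Sigma>: "\<sigma> \<in> \<Sigma>" using \<sigma> by (simp add: facet_def)
  have jk_int: "j \<in> int_lattice" "k \<in> int_lattice" using V_int jk by auto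
  obtain l where l: "l \<noteq> j" "bounds l \<sigma>" "span \<sigma> = {v. (j - l) \<bullet> v = 0}"
    using bounds_other_side[OF \<sigma> jk(1,4)] by metis
  have "l = k" using bounds_at_most_two[OF \<sigma> jk(3-5) l(2)] l(1) by blast
  then have span: "span \<sigma> = {v. (j - k) \<bullet> v = 0}" using l(3) by simp
  have "group_closure (set (b \<sigma>)) = int_lattice \<inter> span (set (b \<sigma>))"
    using basis(1)[OF \<Sigma>] basis(4)[OF \<Sigma>] by (simp add: lattice_basis_def cone_lattice_def)
  then obtain x where x: "x \<in> int_lattice" "\<bar>side_form \<sigma> x\<bar> = 1"
    using saturated_basis_extends[of "b \<sigma>"] basis[OF \<Sigma>] \<sigma> unfolding side_form_def facet_def by metis
  have "(j - k) \<bullet> x \<in> \<int>" by (simp add: inner_diff_left inner_int_lattice jk_int x(1))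
  then have "(j - k) \<bullet> x / side_form \<sigma> x \<in> \<int>"
    using x(2) by (cases "side_form \<sigma> x = 1") (auto simp: abs_if split: if_splits)
  then obtain m where m: "(j - k) \<bullet> x / side_form \<sigma> x = of_int m" by (metis Ints_cases)
  have eq: "(j - k) \<bullet> y = of_int m * side_form \<sigma> y" for y
  proof -
    let ?r = "side_form \<sigma> y / side_form \<sigma> x"
    have "side_form \<sigma> (y - ?r *\<^sub>R x) = 0"
      using x(2) by (auto simp: linear_diff[OF linear_side_form] linear_scale[OF linear_side_form])
    then have "(j - k) \<bullet> (y - ?r *\<^sub>R x) = 0" using side_form_eq_0_iff[OF \<sigma>] span by blast
    then show ?thesis using m by (simp add: inner_diff_right mult.commute flip: m)
  qed
  have "m \<noteq> 0"
  proof
    assume "m = 0"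
    then have "(j - k) \<bullet> (j - k) = 0" by (simp add: eq)
    then show False using jk(3) by simp
  qed
  moreover have "lattice_length (closed_segment j k) = nat \<bar>m\<bar>"
  proof (rule lattice_length_segment[OF jk_int _ x(1) _ \<open>m \<noteq> 0\<close>])
    fix l
    have "(j - k) $ l = (j - k) \<bullet> axis l 1" by (simp add: inner_axis)
    then have "(j - k) $ l / of_int m = side_form \<sigma> (axis l 1)"
      using \<open>m \<noteq> 0\<close> by (simp add: eq)
    moreover have "side_form \<sigma> (axis l 1) \<in> \<int>"
      unfolding side_form_def using basis(1)[OF \<Sigma>]
      by (intro wedge_Ints) (auto simp: lattice_basis_def cone_lattice_def int_lattice_def axis_def
          intro: group_closure.base)
    ultimately show "(j - k) $ l / of_int m \<in> \<int>" by simp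
  next
    show "\<bar>(j - k) \<bullet> x\<bar> = \<bar>of_int m\<bar>" using x(2) by (simp add: eq abs_mult)
  qed
  ultimately show ?thesis using that eq by blast
qed

text \<open>
  Abstractly, \<open>U\<close> is a functional whose cap product with the fundamental chain is the boundary of
  the region of \<open>i\<^sub>0\<close>. Exterior vectors of degree \<open>n - 1\<close> are identified with linear forms, and
  \<open>w \<sigma>\<close> times the orientation of the facet \<open>\<sigma>\<close> becomes, up to sign, the difference \<open>j - k\<close> of the vertices on its
  two sides. On such a difference \<open>U\<close> takes the value 1 if \<open>j = i\<^sub>0\<close>, -1 if \<open>k = i\<^sub>0\<close>, and 0 otherwise.
\<close>

context
  fixes M :: "'n ext set" and U :: "'n ext \<Rightarrow> 'r::comm_ring_1" and w :: "(real^'n) set \<Rightarrow> 'r"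
    and i\<^sub>0 :: "real^'n"
  assumes M_0: "0 \<in> M" and M_diff: "\<And>x y. x \<in> M \<Longrightarrow> y \<in> M \<Longrightarrow> x - y \<in> M"
    and M_facet: "\<And>\<sigma>. facet \<sigma> \<Longrightarrow> wedge (b \<sigma>) \<in> M"
    and M_degree: "\<And>\<omega> js. \<omega> \<in> M \<Longrightarrow> Suc (length js) \<noteq> CARD('n) \<Longrightarrow> \<omega> js = 0"
    and U_add: "\<And>x y. x \<in> M \<Longrightarrow> y \<in> M \<Longrightarrow> U (x + y) = U x + U y"
    and U_facet: "\<And>\<sigma>. facet \<sigma> \<Longrightarrow> w \<sigma> * U (wedge (b \<sigma>)) = of_int (region_sign i\<^sub>0 \<sigma>)"
    and w_length: "\<And>\<sigma> j k. facet \<sigma> \<Longrightarrow> j \<in> V \<Longrightarrow> k \<in> V \<Longrightarrow> j \<noteq> k \<Longrightarrow> bounds j \<sigma> \<Longrightarrow> bounds k \<sigma> \<Longrightarrow>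
      w \<sigma> = of_nat (lattice_length (closed_segment j k))"
    and V_int: "V \<subseteq> int_lattice" and i\<^sub>0: "i\<^sub>0 \<in> V"
begin

lemma M_uminus: "x \<in> M \<Longrightarrow> - x \<in> M"
  using M_diff[OF M_0, of x] by simp

lemma M_add: "x \<in> M \<Longrightarrow> y \<in> M \<Longrightarrow> x + y \<in> M"
  using M_diff[OF _ M_uminus, of x y] by simp

lemma U_0: "U 0 = 0"
  using U_add[OF M_0 M_0] by simp

lemma U_uminus: "x \<in> M \<Longrightarrow> U (- x) = - U x"
  using U_add[OF _ M_uminus, of x x] U_0 by (simp add: eq_neg_iff_add_eq_0 add.commute)

lemma int_multiple:
  assumes "x \<in> M"
  shows "(\<lambda>js. of_int z * x js) \<in> M \<and> U (\<lambda>js. of_int z * x js) = of_int z * U x"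
proof -
  have nat: "(\<lambda>js. of_nat m * x js) \<in> M \<and> U (\<lambda>js. of_nat m * x js) = of_nat m * U x" for m
  proof (induction m)
    case 0
    have "(\<lambda>js. of_nat 0 * x js) = 0" by auto
    then show ?case by (simp add: M_0 U_0)
  next
    case (Suc m)
    have "(\<lambda>js. of_nat (Suc m) * x js) = x + (\<lambda>js. of_nat m * x js)" by (auto simp: algebra_simps)
    then show ?case using Suc assms by (simp add: M_add U_add algebra_simps)
  qed
  show ?thesis
  proof (cases "z \<ge> 0")
    case True
    then show ?thesis using nat[of "nat z"] by simp
  next
    case False
    then have "(\<lambda>js. of_int z * x js) = - (\<lambda>js. of_nat (nat (- z)) * x js)" by auto
    then show ?thesis using nat[of "nat (- z)"] False by (simp add: M_uminus U_uminus)
  qed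
qed

text \<open>
  Exterior multiplication by \<open>x\<close> is the pairing of \<open>\<omega>\<close> with \<open>x\<close>, with values in the multiples of the
  volume form. So \<open>\<omega>\<close> represents the linear form \<open>j - k\<close>.
\<close>

definition potential_difference :: "real^'n \<Rightarrow> real^'n \<Rightarrow> 'n ext \<Rightarrow> bool"
  where "potential_difference j k \<omega> \<longleftrightarrow> \<omega> \<in> M \<and>
    (\<forall>x. ext_prod x \<omega> = (\<lambda>js. ((j - k) \<bullet> x) * wedge axes js)) \<and>
    U \<omega> = of_bool (j = i\<^sub>0) - of_bool (k = i\<^sub>0)"

lemma potential_difference_edge:
  assumes \<sigma>: "facet \<sigma>" and jk: "j \<in> V" "k \<in> V" "j \<noteq> k" "bounds j \<sigma>" "bounds k \<sigma>"
  shows "\<exists>\<omega>. potential_difference j k \<omega>"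
proof -
  obtain m :: int where m: "m \<noteq> 0" "\<And>x. (j - k) \<bullet> x = of_int m * side_form \<sigma> x"
    "lattice_length (closed_segment j k) = nat \<bar>m\<bar>"
    by (rule edge_multiple_of_side_form[OF V_int \<sigma> jk]) (rule that)
  let ?\<omega> = "\<lambda>js. of_int m * wedge (b \<sigma>) js"
  have "ext_prod x ?\<omega> = (\<lambda>js. ((j - k) \<bullet> x) * wedge axes js)" for x
  proof -
    have "length (x # b \<sigma>) = CARD('n)" using \<sigma> basis(5)[of \<sigma>] by (simp add: facet_def)
    then have "wedge (x # b \<sigma>) = (\<lambda>js. side_form \<sigma> x * wedge axes js)"
      unfolding side_form_def by (rule wedge_top)
    then show ?thesis by (simp add: ext_prod_scale_right m(2) mult.assoc flip: wedge_Cons)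
  qed
  moreover have "U ?\<omega> = (of_bool (j = i\<^sub>0) - of_bool (k = i\<^sub>0))"
  proof -
    have "w \<sigma> = of_int \<bar>m\<bar>" using w_length[OF \<sigma> jk] m(3) by simp
    then have "of_int m = of_int (sgn m) * w \<sigma>" by (metis of_int_mult sgn_mult_abs)
    then have "U ?\<omega> = of_int (sgn m) * (w \<sigma> * U (wedge (b \<sigma>)))"
      using int_multiple[OF M_facet[OF \<sigma>], of m] by (simp add: mult.assoc)
    also have "\<dots> = of_int (sgn m * region_sign i\<^sub>0 \<sigma>)" by (simp add: U_facet[OF \<sigma>] mult_ac)
    also have "sgn m * region_sign i\<^sub>0 \<sigma> = of_bool (j = i\<^sub>0) - of_bool (k = i\<^sub>0)"
    proof -
      have j: "of_int m * side_form \<sigma> (region_point j) > 0"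
        using region_point[OF jk(1)] jk by (simp add: region_def inner_diff_left flip: m(2))
      have k: "of_int m * side_form \<sigma> (region_point k) < 0"
        using region_point[OF jk(2)] jk by (simp add: region_def inner_diff_left flip: m(2))
      consider "i\<^sub>0 = j" | "i\<^sub>0 = k" | "i\<^sub>0 \<noteq> j" "i\<^sub>0 \<noteq> k" by blast
      then show ?thesis
      proof cases
        case 1
        then show ?thesis using jk j
          by (auto simp: region_sign_def sgn_if zero_less_mult_iff)
      next
        case 2
        then show ?thesis using jk k
          by (auto simp: region_sign_def sgn_if mult_less_0_iff)
      next
        case 3
        then have "\<not> bounds i\<^sub>0 \<sigma>" using bounds_at_most_two[OF \<sigma> jk(3-5)] by blast
        then show ?thesis using 3 by (auto simp: region_sign_def)
      qed
    qed
    finally show ?thesis by simp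
  qed
  ultimately show ?thesis
    unfolding potential_difference_def using int_multiple[OF M_facet[OF \<sigma>], of m] by blast
qed

lemma potential_difference_trans:
  assumes "potential_difference i j \<omega>" "potential_difference j k \<eta>"
  shows "potential_difference i k (\<omega> + \<eta>)"
proof -
  have M: "\<omega> \<in> M" "\<eta> \<in> M" using assms by (simp_all add: potential_difference_def)
  have "ext_prod x (\<omega> + \<eta>) = (\<lambda>js. ((i - k) \<bullet> x) * wedge axes js)" for x
    using assms
    by (auto simp: potential_difference_def ext_prod_add_right inner_diff_left algebra_simps)
  moreover have "U (\<omega> + \<eta>) = (of_bool (i = i\<^sub>0) - of_bool (k = i\<^sub>0))"
  proof -
    have "U (\<omega> + \<eta>) = U \<omega> + U \<eta>" using M by (rule U_add)
    also have "\<dots> = (of_bool (i = i\<^sub>0) - of_bool (j = i\<^sub>0)) + (of_bool (j = i\<^sub>0) - of_bool (k = i\<^sub>0))"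
      using assms unfolding potential_difference_def by metis
    also have "\<dots> = (of_bool (i = i\<^sub>0) - of_bool (k = i\<^sub>0))" by simp
    finally show ?thesis .
  qed
  ultimately show ?thesis unfolding potential_difference_def using M_add[OF M] by blast
qed

lemma potential_difference_refl: "potential_difference j j 0"
  by (auto simp: potential_difference_def M_0 U_0)

text \<open>
  Differences across facets generate all differences, because any two regions can be joined by
  crossing facets.
\<close>

lemma potential_difference_exists:
  assumes "j \<in> V" "k \<in> V" shows "\<exists>\<omega>. potential_difference j k \<omega>"
proof -
  define A where "A = {i\<in>V. \<exists>\<omega>. potential_difference j i \<omega>}"
  have "A = V"
  proof (rule ccontr)
    assume "A \<noteq> V"
    moreover have "A \<subseteq> V" by (auto simp: A_def)
    moreover have "A \<noteq> {}" using assms(1) potential_difference_refl unfolding A_def by blast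
    ultimately obtain \<sigma> s i l where "facet \<sigma>" "s \<in> rel_interior \<sigma>" "i \<in> A" "l \<in> V - A"
      "i \<in> top_face V s" "l \<in> top_face V s"
      using facet_between by metis
    moreover from this have "\<exists>\<omega>. potential_difference i l \<omega>"
      using bounds_if_top by (intro potential_difference_edge) (auto simp: A_def)
    ultimately have "l \<in> A" using potential_difference_trans unfolding A_def by blast
    then show False using \<open>l \<in> V - A\<close> by blast
  qed
  then show ?thesis using assms(2) by (auto simp: A_def)
qed

text \<open>
  The combination of the vectors representing \<open>j - i\<^sub>0\<close> with coefficients \<open>c j\<close> represents the zero
  form, so it is 0. Hence \<open>U\<close> maps it to 0, and the value of \<open>U\<close> is the same combination of values
  of the indicator function of \<open>i\<^sub>0\<close>.
\<close>

lemma integer_affine_relation_vanishes: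
  fixes c :: "real^'n \<Rightarrow> int"
  assumes "(\<Sum>j\<in>V. c j) = 0" "(\<Sum>j\<in>V. of_int (c j) *\<^sub>R j) = 0"
  shows "of_int (c i\<^sub>0) = (0 :: 'r)"
proof -
  obtain \<omega> where \<omega>: "\<And>j. j \<in> V \<Longrightarrow> potential_difference j i\<^sub>0 (\<omega> j)"
    using potential_difference_exists[OF _ i\<^sub>0] by metis
  let ?f = "\<lambda>j js. of_int (c j) * \<omega> j js"
  have sum: "(\<Sum>j\<in>I. ?f j) \<in> M \<and> U (\<Sum>j\<in>I. ?f j) = (\<Sum>j\<in>I. of_int (c j) * U (\<omega> j))"
    if "finite I" "I \<subseteq> V" for I
    using that
  proof (induction rule: finite_induct)
    case empty
    show ?case unfolding sum.empty using M_0 U_0 by blast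
  next
    case (insert j I)
    have "\<omega> j \<in> M" using \<omega> insert by (simp add: potential_difference_def)
    then have "?f j \<in> M" "U (?f j) = of_int (c j) * U (\<omega> j)" using int_multiple by blast+
    moreover have "(\<Sum>j\<in>I. ?f j) \<in> M" "U (\<Sum>j\<in>I. ?f j) = (\<Sum>j\<in>I. of_int (c j) * U (\<omega> j))"
      using insert by blast+
    ultimately show ?case
      unfolding sum.insert[OF insert.hyps] using U_add M_add by presburger
  qed
  define \<Omega> where "\<Omega> = (\<Sum>j\<in>V. ?f j)"
  have \<Omega>: "\<Omega> \<in> M" "U \<Omega> = (\<Sum>j\<in>V. of_int (c j) * U (\<omega> j))"
    unfolding \<Omega>_def using sum[OF finite_V] by blast+
  have "ext_prod x \<Omega> = 0" for x
  proof -
    have "ext_prod x \<Omega> = (\<Sum>j\<in>V. ext_prod x (?f j))" unfolding \<Omega>_def by (rule ext_prod_sum[OF finite_V])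
    also have "\<dots> = (\<Sum>j\<in>V. (\<lambda>js. of_int (c j) * (((j - i\<^sub>0) \<bullet> x) * wedge axes js)))"
      using \<omega> by (intro sum.cong refl) (simp add: ext_prod_scale_right potential_difference_def)
    also have "\<dots> = (\<lambda>js. (\<Sum>j\<in>V. of_int (c j) * ((j - i\<^sub>0) \<bullet> x)) * wedge axes js)"
      by (rule ext) (simp add: sum_fun_apply[OF finite_V] sum_distrib_right mult.assoc)
    also have "(\<Sum>j\<in>V. of_int (c j) * ((j - i\<^sub>0) \<bullet> x))
        = (\<Sum>j\<in>V. of_int (c j) *\<^sub>R j) \<bullet> x - of_int (\<Sum>j\<in>V. c j) * (i\<^sub>0 \<bullet> x)"
      by (simp add: inner_sum_left inner_diff_left algebra_simps sum_subtractf sum_distrib_left)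
    also have "\<dots> = 0" using assms by simp
    finally show ?thesis by auto
  qed
  then have "\<Omega> js = 0" for js
  proof (cases "set js = UNIV")
    case True
    then have "CARD('n) \<le> length js" by (metis card_length)
    then show ?thesis using M_degree[OF \<Omega>(1)] by simp
  qed (use ext_eq_0_if_ext_prods_eq_0 in blast)
  then have "\<Omega> = 0" by auto
  then have "0 = (\<Sum>j\<in>V. of_int (c j) * U (\<omega> j))" using \<Omega>(2) U_0 by simp
  also have "\<dots> = (\<Sum>j\<in>V. (of_int (c j) * of_bool (j = i\<^sub>0)) - of_int (c j))"
  proof (intro sum.cong refl)
    fix j assume "j \<in> V"
    then have "U (\<omega> j) = (of_bool (j = i\<^sub>0) - of_bool (i\<^sub>0 = i\<^sub>0))"
      using \<omega> unfolding potential_difference_def by blast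
    then show "of_int (c j) * U (\<omega> j) = (of_int (c j) * of_bool (j = i\<^sub>0)) - of_int (c j)"
      by (simp only:) (simp add: algebra_simps)
  qed
  also have "\<dots> = (\<Sum>j\<in>V. of_int (c j) * of_bool (j = i\<^sub>0)) - of_int (\<Sum>j\<in>V. c j)"
    by (simp add: sum_subtractf sum_distrib_left)
  also have "(\<Sum>j\<in>V. of_int (c j) * of_bool (j = i\<^sub>0)) = (\<Sum>j\<in>V. if j = i\<^sub>0 then of_int (c j) else (0::'r))"
    by (intro sum.cong) auto
  also have "\<dots> = of_int (c i\<^sub>0)" using i\<^sub>0 finite_V by simp
  finally show ?thesis using assms(1) by simp
qed

end

end

section \<open>The cap product onto top-dimensional chains of scalars\<close>

lemma wedge_Nil_Nil: "wedge [] [] = 1"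
  by (simp add: wedge_def sign_id)

lemma tensor_sum_cong: "(\<And>i. i \<in> I \<Longrightarrow> c i = c' i) \<Longrightarrow> tensor_sum M c I = tensor_sum M c' I"
  unfolding tensor_sum_def by (simp cong: sum.cong)

lemma tensor_sum_singleton_pure: "tensor_sum M (\<lambda>i. pure_tensor M x (r i)) {i} = pure_tensor M x (r i)"
  by (simp add: tensor_sum_pure)

lemma ext_power_degree:
  assumes "\<omega> \<in> ext_power p L" "length js \<noteq> p" shows "\<omega> js = 0"
  using assms unfolding ext_power_def
  by (induction rule: group_closure.induct) (auto simp: wedge_length_neq)

lemma F_Z_degree:
  assumes "\<omega> \<in> F_Z \<Sigma> p \<sigma>" "length js \<noteq> p" shows "\<omega> js = 0"
  using assms unfolding F_Z_def
  by (induction rule: group_closure.induct) (auto simp: ext_power_degree)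

text \<open>
  An increasing permutation satisfies \<open>i \<le> a i\<close>, and both sides have the same sum.
\<close>

lemma shuffle_perms_all: "shuffle_perms d d = {id}"
proof
  show "shuffle_perms d d \<subseteq> {id}"
  proof
    fix a assume "a \<in> shuffle_perms d d"
    then have a: "a permutes {..<d}" and mono: "strict_mono_on {..<d} a" by (auto simp: shuffle_perms_def)
    have ge: "i \<le> a i" if "i < d" for i
      using that
    proof (induction i)
      case (Suc i)
      then have "a i < a (Suc i)" using strict_mono_onD[OF mono] by simp
      then show ?case using Suc by simp
    qed simp
    have "(\<Sum>i<d. a i) = (\<Sum>i<d. i)" using sum.permute[OF a, of "\<lambda>i. i"] by (simp add: comp_def)
    then have "i = a i" if "i < d" for i
      using sum_mono_inv[of "\<lambda>i. i" "{..<d}" a i] ge that by simp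
    then show "a \<in> {id}" using permutes_not_in[OF a] by (auto simp: fun_eq_iff) (metis lessThan_iff)
  qed
  show "{id} \<subseteq> shuffle_perms d d"
    by (auto simp: shuffle_perms_def permutes_id strict_mono_on_def)
qed

lemma degree_0_coordinate_Ints:
  fixes x :: "'n::finite ext"
  assumes "x \<in> group_closure {wedge []}" shows "x [] \<in> \<int>"
  using assms by (induction rule: group_closure.induct) (auto simp: wedge_Nil_Nil)

context rational_fan
begin

lemma F_Z_0:
  assumes "\<sigma> \<in> \<Sigma>" shows "F_Z \<Sigma> 0 \<sigma> = group_closure {wedge []}"
proof -
  have "{wedge vs |vs. length vs = 0 \<and> set vs \<subseteq> L} = {wedge []}" for L :: "(real^'n) set" by auto
  then have ext: "ext_power 0 L = group_closure {wedge []}" for L :: "(real^'n) set"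
    unfolding ext_power_def by simp
  have "\<sigma> \<in> {\<gamma>\<in>\<Sigma>. \<sigma> face_of \<gamma>}" using assms cone_convex face_of_refl by blast
  then have "(\<Union>\<gamma>\<in>{\<gamma>\<in>\<Sigma>. \<sigma> face_of \<gamma>}. ext_power 0 (cone_lattice \<gamma>)) = group_closure {wedge []}"
    unfolding ext by blast
  then show ?thesis unfolding F_Z_def by (simp add: group_closure_idem)
qed

lemma wedge_Nil_in_F_Z: "\<sigma> \<in> \<Sigma> \<Longrightarrow> wedge [] \<in> F_Z \<Sigma> 0 \<sigma>"
  by (simp add: F_Z_0 group_closure.base)

lemma F_Z_0_inject:
  assumes "\<sigma> \<in> \<Sigma>" "pure_tensor (F_Z \<Sigma> 0 \<sigma>) (wedge []) (r::'r::comm_ring_1) = pure_tensor (F_Z \<Sigma> 0 \<sigma>) (wedge []) s"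
  shows "r = s"
proof (rule pure_tensor_inject[OF _ _ assms(2)])
  show "\<lfloor>(x + y) []\<rfloor> = \<lfloor>x []\<rfloor> + \<lfloor>y []\<rfloor>" if "x \<in> F_Z \<Sigma> 0 \<sigma>" "y \<in> F_Z \<Sigma> 0 \<sigma>" for x y
    using degree_0_coordinate_Ints[of x] degree_0_coordinate_Ints[of y] that assms(1)
    by (auto simp: F_Z_0 elim!: Ints_cases)
qed (simp add: wedge_Nil_Nil)

lemma F_Z_subset_vertex:
  assumes "\<sigma> \<in> \<Sigma>" shows "F_Z \<Sigma> p \<sigma> \<subseteq> F_Z \<Sigma> p {0}"
  unfolding F_Z_def
proof (rule group_closure_mono, rule UN_mono)
  show "{\<gamma>\<in>\<Sigma>. \<sigma> face_of \<gamma>} \<subseteq> {\<gamma>\<in>\<Sigma>. {0} face_of \<gamma>}" using vertex_face by blast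
qed simp

end

context oriented_max_fan
begin

abbreviation "d \<equiv> fan_dim \<Sigma>"

lemma wedge_basis_in_F_Z:
  assumes "\<alpha> \<in> cones \<Sigma> p" shows "wedge (b \<alpha>) \<in> F_Z \<Sigma> p \<alpha>"
proof -
  have \<alpha>: "\<alpha> \<in> \<Sigma>" "dim \<alpha> = p" using assms by (auto simp: cones_def)
  have "set (b \<alpha>) \<subseteq> cone_lattice \<alpha>"
    using basis(1)[OF \<alpha>(1)] by (auto simp: lattice_basis_def intro: group_closure.base)
  then have "wedge (b \<alpha>) \<in> ext_power p (cone_lattice \<alpha>)"
    unfolding ext_power_def using basis(5)[OF \<alpha>(1)] \<alpha>(2) by (intro group_closure.base) auto
  moreover have "\<alpha> \<in> {\<gamma>\<in>\<Sigma>. \<alpha> face_of \<gamma>}" using \<alpha> cone_convex face_of_refl by blast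
  ultimately show ?thesis unfolding F_Z_def by (intro group_closure.base) blast
qed

text \<open>
  The oriented boundary of the region of \<open>j\<close>, with coefficients in \<open>F_0 = \<int>\<close> tensored with the ring.
\<close>

definition region_chain :: "real^'n \<Rightarrow> ('n, 'r::comm_ring_1) chain"
  where "region_chain j = (\<lambda>\<sigma>. if \<sigma> \<in> cones \<Sigma> d
    then pure_tensor (F_Z \<Sigma> 0 \<sigma>) (wedge []) (of_int (region_sign j \<sigma>)) else {})"

text \<open>
  The coefficient groups \<open>F_Z \<Sigma> 0 \<sigma>\<close> are the same for all cones, so the boundary at \<open>\<tau>\<close> is the signed
  sum of the coefficients, which vanishes by \<open>region_boundary_is_cycle\<close>.
\<close>

lemma region_chain_cycle:
  assumes "j \<in> V" shows "region_chain j \<in> BM_cycles \<Sigma> b 0 d"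
  unfolding BM_cycles_def
proof (rule CollectI, intro conjI ballI impI)
  show "region_chain j \<in> BM_chains \<Sigma> 0 d"
    by (auto simp: BM_chains_def region_chain_def F_R_def cones_def
        intro!: pure_tensor_in_tensor wedge_Nil_in_F_Z)
  fix \<tau> assume \<tau>: "\<tau> \<in> \<Sigma>" "Suc (dim \<tau>) = d"
  let ?I = "{\<sigma>\<in>cones \<Sigma> d. \<tau> face_of \<sigma>}"
  have I: "?I = {\<sigma>. facet \<sigma> \<and> \<tau> face_of \<sigma>}" by (simp add: facet_iff_cones)
  have fin: "finite ?I" using finite_fan by (simp add: cones_def)
  have "BM_boundary \<Sigma> b 0 d (region_chain j) \<tau> = tensor_sum (F_Z \<Sigma> 0 \<tau>)
      (\<lambda>\<sigma>. tensor_scale (F_Z \<Sigma> 0 \<tau>) (of_int (rel_sign b \<tau> \<sigma>)) (iota \<Sigma> 0 \<sigma> \<tau> (region_chain j \<sigma>))) ?I"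
    using \<tau> by (simp add: BM_boundary_def)
  also have "\<dots> = tensor_sum (F_Z \<Sigma> 0 \<tau>)
      (\<lambda>\<sigma>. pure_tensor (F_Z \<Sigma> 0 \<tau>) (wedge []) (of_int (rel_sign b \<tau> \<sigma> * region_sign j \<sigma>))) ?I"
  proof (rule tensor_sum_cong)
    fix \<sigma> assume "\<sigma> \<in> ?I"
    then have \<sigma>: "\<sigma> \<in> cones \<Sigma> d" "\<sigma> \<in> \<Sigma>" by (auto simp: cones_def)
    have "F_Z \<Sigma> 0 \<sigma> \<subseteq> F_Z \<Sigma> 0 \<tau>" using F_Z_0 \<sigma> \<tau> by simp
    then show "tensor_scale (F_Z \<Sigma> 0 \<tau>) (of_int (rel_sign b \<tau> \<sigma>)) (iota \<Sigma> 0 \<sigma> \<tau> (region_chain j \<sigma>))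
        = pure_tensor (F_Z \<Sigma> 0 \<tau>) (wedge []) (of_int (rel_sign b \<tau> \<sigma> * region_sign j \<sigma>))"
      using \<sigma> by (simp add: iota_def region_chain_def tensor_incl_pure tensor_scale_pure)
  qed
  also have "\<dots> = pure_tensor (F_Z \<Sigma> 0 \<tau>) (wedge []) (\<Sum>\<sigma>\<in>?I. of_int (rel_sign b \<tau> \<sigma> * region_sign j \<sigma>))"
    by (rule tensor_sum_pure[OF fin])
  also have "(\<Sum>\<sigma>\<in>?I. of_int (rel_sign b \<tau> \<sigma> * region_sign j \<sigma>)) = of_int (\<Sum>\<sigma>\<in>?I. rel_sign b \<tau> \<sigma> * region_sign j \<sigma>)"
    by simp
  also have "(\<Sum>\<sigma>\<in>?I. rel_sign b \<tau> \<sigma> * region_sign j \<sigma>) = 0"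
    unfolding I using \<tau> Suc_fan_dim assms by (intro region_boundary_is_cycle) auto
  finally show "BM_boundary \<Sigma> b 0 d (region_chain j) \<tau> = tensor_rels (F_Z \<Sigma> 0 \<tau>)"
    by (simp add: pure_tensor_zero)
qed

lemma no_cones_above: "cones \<Sigma> (Suc d) = {}"
  using dim_cone_less Suc_fan_dim by (fastforce simp: cones_def)

lemma top_degree_boundaries:
  assumes "x \<in> BM_boundaries \<Sigma> b p d" "\<sigma> \<in> cones \<Sigma> d"
  shows "x \<sigma> = tensor_rels (F_Z \<Sigma> p \<sigma>)"
proof -
  have empty: "{\<rho>\<in>cones \<Sigma> (Suc d). \<sigma> face_of \<rho>} = {}" using no_cones_above by blast
  obtain c where "x = BM_boundary \<Sigma> b p (Suc d) c" using assms(1) unfolding BM_boundaries_def by blast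
  moreover have "\<sigma> \<in> \<Sigma>" "dim \<sigma> = d" using assms(2) by (auto simp: cones_def)
  ultimately show ?thesis unfolding BM_boundary_def tensor_sum_def by (simp add: empty)
qed

lemma zero_boundary: obtains x where "x \<in> BM_boundaries \<Sigma> b p d"
proof -
  have "(\<lambda>_. {}) \<in> BM_chains \<Sigma> p (Suc d)" by (simp add: BM_chains_def no_cones_above)
  then show ?thesis using that unfolding BM_boundaries_def by blast
qed

text \<open>
  In the sum defining the cap product for \<open>p = d\<close> and \<open>q = 0\<close> only the vertex and \<open>\<alpha>\<close> itself
  contribute, and contracting the volume element of \<open>\<alpha>\<close> with \<open>u\<close> is evaluating \<open>u\<close>, up to a sign.
\<close>

lemma cap_top:
  assumes \<alpha>: "\<alpha> \<in> cones \<Sigma> d"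
    and u: "u \<in> cochains \<Sigma> d 0"
  shows "cap \<Sigma> b w d 0 u \<alpha> = pure_tensor (F_Z \<Sigma> 0 \<alpha>) (wedge [])
    (w \<alpha> * ((-1) ^ (d * (d - 1) div 2) * u {0} (pure_tensor (F_Z \<Sigma> d {0}) (wedge (b \<alpha>)) 1)))"
proof -
  let ?M = "F_Z \<Sigma> 0 \<alpha>"
  let ?u = "u {0} (pure_tensor (F_Z \<Sigma> d {0}) (wedge (b \<alpha>)) 1)"
  let ?sgn = "(-1) ^ (d * (d - 1) div 2)"
  have \<alpha>\<Sigma>: "\<alpha> \<in> \<Sigma>" "dim \<alpha> = d" using \<alpha> by (auto simp: cones_def)
  have I: "{(\<gamma>, \<alpha>'). \<gamma> \<in> compact_cones \<Sigma> 0 \<and> \<alpha>' \<in> cones \<Sigma> d \<and> \<gamma> face_of \<alpha>' \<and> \<alpha> face_of \<alpha>'} = {({0}, \<alpha>)}"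
  proof -
    have "\<alpha>' = \<alpha>" if "\<alpha>' \<in> cones \<Sigma> d" "\<alpha> face_of \<alpha>'" for \<alpha>'
      using face_eq_if_dim_eq[OF \<alpha>\<Sigma>(1) _ that(2)] that(1) \<alpha>\<Sigma>(2) by (simp add: cones_def)
    moreover have "\<alpha> face_of \<alpha>" using cone_convex[OF \<alpha>\<Sigma>(1)] by (rule face_of_refl)
    ultimately show ?thesis unfolding compact_cones_0 using \<alpha> vertex_face[OF \<alpha>\<Sigma>(1)] by auto
  qed
  have "rho \<Sigma> d {0} \<alpha> (u {0}) (pure_tensor (F_Z \<Sigma> d \<alpha>) (wedge (b \<alpha>)) 1) = ?u"
    using wedge_basis_in_F_Z[OF \<alpha>]
    by (simp add: rho_def F_R_def pure_tensor_in_tensor iota_def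
        tensor_incl_pure F_Z_subset_vertex[OF \<alpha>\<Sigma>(1)])
  moreover have "map (\<lambda>i. b \<alpha> ! i) [0..<d] = b \<alpha>"
    using basis(5)[OF \<alpha>\<Sigma>(1)] \<alpha>\<Sigma>(2) map_nth[of "b \<alpha>"] by simp
  ultimately have contract: "contract_Lambda \<Sigma> b d \<alpha> (rho \<Sigma> d {0} \<alpha> (u {0})) = pure_tensor ?M (wedge []) (?sgn * ?u)"
    by (simp add: contract_Lambda_def Let_def shuffle_perms_all tensor_sum_singleton_pure sign_id)
  have "cap \<Sigma> b w d 0 u \<alpha> = tensor_sum ?M (\<lambda>(\<gamma>, \<alpha>'). tensor_scale ?M (w \<alpha>')
        (iota \<Sigma> 0 \<alpha>' \<alpha> (contract_Lambda \<Sigma> b d \<alpha>' (rho \<Sigma> d \<gamma> \<alpha>' (u \<gamma>))))) {({0}, \<alpha>)}"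
    using \<alpha> by (simp add: cap_def Let_def I)
  also have "\<dots> = tensor_sum ?M (\<lambda>_. pure_tensor ?M (wedge []) (w \<alpha> * (?sgn * ?u)))
      {({0} :: (real^'n) set, \<alpha>)}"
    by (rule tensor_sum_cong) (simp add: contract iota_def tensor_incl_pure tensor_scale_pure)
  finally show ?thesis by (simp add: tensor_sum_singleton_pure)
qed

text \<open>
  Duality for \<open>p = d\<close> and \<open>q = 0\<close> makes the boundary of the region of \<open>j\<close> a cap product. There are no
  cones of dimension \<open>d + 1\<close>, so this is an equality of chains, not only of homology classes. The
  sign from the contraction is absorbed into \<open>U\<close>.
\<close>

lemma region_potential:
  fixes w :: "(real^'n) set \<Rightarrow> 'r::comm_ring_1"
  assumes TPD: "tropical_Poincare_duality \<Sigma> b w" and j: "j \<in> V"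
  obtains U :: "'n ext \<Rightarrow> 'r"
  where "\<And>x y. x \<in> F_Z \<Sigma> d {0} \<Longrightarrow> y \<in> F_Z \<Sigma> d {0} \<Longrightarrow> U (x + y) = U x + U y"
    and "\<And>\<sigma>. facet \<sigma> \<Longrightarrow> w \<sigma> * U (wedge (b \<sigma>)) = of_int (region_sign j \<sigma>)"
proof -
  let ?cycles = "BM_cycles \<Sigma> b 0 d :: ('n, 'r) chain set"
  let ?r = "mod_rel ?cycles (BM_boundaries \<Sigma> b 0 d)"
  let ?c = "region_chain j :: ('n, 'r) chain"
  have bij: "bij_betw (cap_class \<Sigma> b w d 0) (cohomology \<Sigma> b d 0) (BM_homology \<Sigma> b 0 d)"
    using TPD unfolding tropical_Poincare_duality_def by (metis diff_self_eq_0 diff_zero le0 order_refl)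
  have cycle: "?c \<in> ?cycles" using region_chain_cycle[OF j] .
  then have "?r `` {?c} \<in> BM_homology \<Sigma> b 0 d" unfolding BM_homology_def by (rule quotientI)
  then have "?r `` {?c} \<in> cap_class \<Sigma> b w d 0 ` cohomology \<Sigma> b d 0"
    using bij_betw_imp_surj_on[OF bij] by simp
  then obtain K where K: "?r `` {?c} = cap_class \<Sigma> b w d 0 K" "K \<in> cohomology \<Sigma> b d 0"
    by (rule imageE)
  have "(?c, ?c) \<in> ?r"
  proof -
    obtain x where x: "x \<in> (BM_boundaries \<Sigma> b 0 d :: ('n, 'r) chain set)" by (rule zero_boundary)
    have "?c = ?c + x"
    proof
      fix \<sigma>
      show "?c \<sigma> = (?c + x) \<sigma>"
      proof (cases "\<sigma> \<in> cones \<Sigma> d")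
        case True
        then show ?thesis
          using top_degree_boundaries[OF x True] by (simp add: region_chain_def pure_tensor_def coset_plus_rels)
      qed (simp add: region_chain_def)
    qed
    then show ?thesis using cycle x unfolding mod_rel_def by blast
  qed
  then have "?c \<in> cap_class \<Sigma> b w d 0 K" using K(1) by blast
  then obtain u x where u: "u \<in> K" and x: "x \<in> (BM_boundaries \<Sigma> b 0 d :: ('n, 'r) chain set)"
    and eq: "?c = cap \<Sigma> b w d 0 u + x"
    unfolding cap_class_def mod_rel_def by (auto simp: Let_def)
  have "u \<in> cocycles \<Sigma> b d 0"
    using u K(2) unfolding cohomology_def mod_rel_def by (auto elim!: quotientE)
  then have cochain: "u \<in> cochains \<Sigma> d 0" by (simp add: cocycles_def)
  then have dual: "u {0} \<in> tensor_dual (F_Z \<Sigma> d {0})"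
    by (auto simp: cochains_def compact_cones_0 F_dual_def)
  define U where "U x = (-1) ^ (d * (d - 1) div 2) * u {0} (pure_tensor (F_Z \<Sigma> d {0}) x 1)" for x
  show ?thesis
  proof (rule that[of U])
    show "U (x + y) = U x + U y" if "x \<in> F_Z \<Sigma> d {0}" "y \<in> F_Z \<Sigma> d {0}" for x y
      using tensor_dual_additive[OF dual that] by (simp add: U_def distrib_left)
    fix \<sigma> assume "facet \<sigma>"
    then have \<sigma>: "\<sigma> \<in> cones \<Sigma> d" "\<sigma> \<in> \<Sigma>" by (simp_all add: facet_iff_cones) (simp add: cones_def)
    have "?c \<sigma> = cap \<Sigma> b w d 0 u \<sigma> + x \<sigma>" using eq by (metis plus_fun_apply)
    then have "pure_tensor (F_Z \<Sigma> 0 \<sigma>) (wedge []) (of_int (region_sign j \<sigma>))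
        = pure_tensor (F_Z \<Sigma> 0 \<sigma>) (wedge []) (w \<sigma> * U (wedge (b \<sigma>)))"
      using top_degree_boundaries[OF x \<sigma>(1)] \<sigma>(1) cap_top[OF \<sigma>(1) cochain, of w]
      by (simp add: region_chain_def U_def pure_tensor_def coset_plus_rels)
    then show "w \<sigma> * U (wedge (b \<sigma>)) = of_int (region_sign j \<sigma>)"
      using F_Z_0_inject[OF \<sigma>(2)] by metis
  qed
qed

end

section \<open>Primitive integral affine relations\<close>

text \<open>
  The reals are a vector space over the rationals, with a basis that contains \<open>u\<close>.
\<close>

lemma rational_functional:
  assumes "u \<noteq> (0::real)"
  obtains \<phi> :: "real \<Rightarrow> rat" where "\<And>x y. \<phi> (x + y) = \<phi> x + \<phi> y"
    "\<And>q x. \<phi> (of_rat q * x) = q * \<phi> x" "\<phi> u \<noteq> 0"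
proof -
  interpret vector_space_pair "\<lambda>(q::rat) (x::real). of_rat q * x" "(*) :: rat \<Rightarrow> rat \<Rightarrow> rat"
    by unfold_locales (simp_all add: algebra_simps of_rat_add of_rat_mult)
  have "vs1.independent {u}" using assms by (simp add: vs1.independent_insert)
  then obtain \<phi> where "Vector_Spaces.linear (\<lambda>(q::rat) (x::real). of_rat q * x) (*) \<phi>" "\<phi> u = 1"
    using linear_independent_extend[of "{u}" "\<lambda>_. 1"] by auto
  then show ?thesis using that[of \<phi>] linear_add linear_scale by (metis zero_neq_one)
qed

lemma common_denominator:
  assumes "finite V" obtains N :: int where "N > 0" "\<And>v. v \<in> V \<Longrightarrow> of_int N * (q v :: rat) \<in> \<int>"
proof -
  have "\<exists>N::int. N > 0 \<and> (\<forall>v\<in>V. of_int N * q v \<in> \<int>)"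
    using assms
  proof (induction rule: finite_induct)
    case (insert v V)
    obtain N :: int where N: "N > 0" "\<forall>v\<in>V. of_int N * q v \<in> \<int>" using insert by blast
    obtain a c where ac: "q v = Rat.Fract a c" "c > 0" by (rule Rat_cases) blast
    have "of_int (N * c) * q x \<in> \<int>" if "x \<in> insert v V" for x
    proof (cases "x = v")
      case True
      have "of_int c * q v = of_int a" using ac by (simp add: Rat.Fract_of_int_quotient)
      then have "of_int (N * c) * q v = of_int (N * a)" by (simp add: mult.assoc)
      then show ?thesis using True by (metis Ints_of_int)
    next
      case False
      then have "of_int N * q x \<in> \<int>" using N that by blast
      then have "of_int c * (of_int N * q x) \<in> \<int>" by (rule Ints_mult[OF Ints_of_int])
      then show ?thesis by (simp add: mult_ac)
    qed
    then show ?case using N(1) ac(2) by (intro exI[of _ "N * c"]) simp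
  qed (auto intro: exI[of _ 1])
  then show ?thesis using that by blast
qed

text \<open>
  A \<open>\<rat>\<close>-linear functional on the reals, applied to the coefficients of a real affine relation
  between integral points, gives a rational one. It is chosen to be nonzero on a nonzero
  coefficient. Then the denominators are cleared and the greatest common divisor is divided out.
\<close>

lemma primitive_integer_affine_relation:
  fixes V :: "(real^'n) set"
  assumes "finite V" "V \<subseteq> int_lattice" "affine_dependent V"
  obtains c :: "real^'n \<Rightarrow> int"
  where "(\<Sum>v\<in>V. c v) = 0" "(\<Sum>v\<in>V. of_int (c v) *\<^sub>R v) = 0" "Gcd (c ` V) = 1"
proof -
  obtain u v\<^sub>0 where u: "sum u V = 0" "v\<^sub>0 \<in> V" "u v\<^sub>0 \<noteq> 0" "(\<Sum>v\<in>V. u v *\<^sub>R v) = 0"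
    using affine_dependent_explicit_finite[OF assms(1)] assms(3) by blast
  (* A rational relation that is still nontrivial at v0. *)
  obtain \<phi> :: "real \<Rightarrow> rat" where add: "\<And>x y. \<phi> (x + y) = \<phi> x + \<phi> y"
    and scale: "\<And>q x. \<phi> (of_rat q * x) = q * \<phi> x" and nz: "\<phi> (u v\<^sub>0) \<noteq> 0"
    using rational_functional[OF u(3)] by blast
  have zero: "\<phi> 0 = 0" using add[of 0 0] by simp
  have sum: "\<phi> (\<Sum>v\<in>I. h v) = (\<Sum>v\<in>I. \<phi> (h v))" if "finite I" for I and h :: "real^'n \<Rightarrow> real"
    using that by (induction rule: finite_induct) (simp_all add: add zero)
  have int: "\<phi> (x * of_int z) = \<phi> x * of_int z" for x z
    using scale[of "of_int z" x] by (simp add: mult.commute)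
  define q where "q v = \<phi> (u v)" for v
  obtain N where N: "N > 0" "\<And>v. v \<in> V \<Longrightarrow> of_int N * q v \<in> \<int>"
    using common_denominator[OF assms(1), of q] by blast
  have "\<exists>z. of_int N * q v = of_int z" if "v \<in> V" for v
    using N(2)[OF that] unfolding Ints_def by blast
  then obtain z where z: "\<And>v. v \<in> V \<Longrightarrow> of_int N * q v = of_int (z v)"
    by metis
  have rel: "(\<Sum>v\<in>V. z v * a v) = 0" if "(\<Sum>v\<in>V. u v * of_int (a v)) = 0" for a
  proof -
    have "of_int (\<Sum>v\<in>V. z v * a v) = (\<Sum>v\<in>V. of_int N * (\<phi> (u v) * of_int (a v)))"
      unfolding of_int_sum by (intro sum.cong refl) (simp add: z[symmetric] q_def mult.assoc)
    also have "\<dots> = of_int N * \<phi> (\<Sum>v\<in>V. u v * of_int (a v))"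
      by (simp add: sum[OF assms(1)] int sum_distrib_left)
    also have "\<dots> = (0::rat)" using that zero by simp
    finally show ?thesis by (simp only: of_int_eq_0_iff)
  qed
  define g where "g = Gcd (z ` V)"
  have "z v\<^sub>0 \<noteq> 0" using z[OF u(2)] nz N(1) by (auto simp: q_def)
  then have g: "g \<noteq> 0" using u(2) by (auto simp: g_def)
  define c where "c v = z v div g" for v
  have zc: "z v = g * c v" if "v \<in> V" for v using that by (simp add: c_def g_def)
  have rel': "(\<Sum>v\<in>V. c v * a v) = 0" if "(\<Sum>v\<in>V. u v * of_int (a v)) = 0" for a
  proof -
    have "g * (\<Sum>v\<in>V. c v * a v) = (\<Sum>v\<in>V. z v * a v)"
      unfolding sum_distrib_left by (intro sum.cong refl) (simp add: zc mult.assoc)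
    then show ?thesis using rel[OF that] g by simp
  qed
  show ?thesis
  proof (rule that)
    show "(\<Sum>v\<in>V. c v) = 0" using rel'[of "\<lambda>_. 1"] u(1) by simp
    show "(\<Sum>v\<in>V. of_int (c v) *\<^sub>R v) = 0"
    proof (rule iffD2[OF Finite_Cartesian_Product.vec_eq_iff], rule allI)
      fix i
      have "\<exists>a::int. v $ i = of_int a" if "v \<in> V" for v
      proof -
        have "v $ i \<in> \<int>" using assms(2) that unfolding int_lattice_def by blast
        then show ?thesis unfolding Ints_def by blast
      qed
      then obtain a where a: "\<And>v. v \<in> V \<Longrightarrow> v $ i = of_int (a v)" by metis
      have "(\<Sum>v\<in>V. u v * of_int (a v)) = (\<Sum>v\<in>V. u v *\<^sub>R v) $ i" by (simp add: a)
      then have "(\<Sum>v\<in>V. c v * a v) = 0" using rel' u(4) by simp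
      then have "of_int (\<Sum>v\<in>V. c v * a v) = (0::real)" by simp
      then show "(\<Sum>v\<in>V. of_int (c v) *\<^sub>R v) $ i = 0 $ i" by (simp add: a)
    qed
    have "z ` V = (*) g ` (c ` V)" using zc by (force simp: image_iff)
    then have "g = \<bar>g * Gcd (c ` V)\<bar>" unfolding g_def by (metis Gcd_mult normalize_int_def)
    then show "Gcd (c ` V) = 1" using g by (simp add: abs_mult g_def)
  qed
qed

section \<open>Conical hypersurfaces\<close>

text \<open>
  The hypersurface is the translate by \<open>x\<^sub>0\<close> of the support of a fan. Coordinates are centered at
  \<open>x\<^sub>0\<close> throughout.
\<close>

locale conical_hypersurface = rational_fan \<Sigma>
  for \<Sigma> :: "(real^'n) set set" +
  fixes f :: "int^'n \<Rightarrow> ereal" and x\<^sub>0 :: "real^'n"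
  assumes polynomial: "tropical_Laurent_polynomial f"
    and hypersurface: "trop_hypersurface f = (\<lambda>y. x\<^sub>0 + y) ` \<Union>\<Sigma>"
begin

definition value_at :: "int^'n \<Rightarrow> real^'n \<Rightarrow> real"
  where "value_at j y = trop_term f j (x\<^sub>0 + y)"

definition tops :: "real^'n \<Rightarrow> (int^'n) set"
  where "tops y = maximizers f (x\<^sub>0 + y)"

text \<open>
  The exponents that are dual to the connected components of the complement of the hypersurface.
\<close>

definition vertex_exponents :: "(int^'n) set"
  where "vertex_exponents = {j. \<exists>y. tops y = {j}}"

definition vertices :: "(real^'n) set"
  where "vertices = real_vec ` vertex_exponents"

lemma value_at_eq: "value_at j y = value_at j 0 + real_vec j \<bullet> y"
  by (simp add: value_at_def trop_term_def inner_add_right)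

lemma inj_real_vec: "inj real_vec"
  by (auto simp: inj_def real_vec_def Finite_Cartesian_Product.vec_eq_iff)

lemma finite_exponents: "finite (exponents f)"
  using polynomial by (simp add: tropical_Laurent_polynomial_def exponents_def)

lemma support_iff: "y \<in> \<Union>\<Sigma> \<longleftrightarrow> 2 \<le> card (tops y)"
proof -
  have "y \<in> \<Union>\<Sigma> \<longleftrightarrow> x\<^sub>0 + y \<in> trop_hypersurface f" unfolding hypersurface by (auto simp: image_iff)
  then show ?thesis by (simp add: trop_hypersurface_def tops_def)
qed

lemma exponents_nonempty: "exponents f \<noteq> {}"
proof
  assume "exponents f = {}"
  then have "tops 0 = {}" by (simp add: tops_def maximizers_def)
  moreover have "0 \<in> \<Union>\<Sigma>" using vertex_in_fan by blast
  then have "2 \<le> card (tops 0)" using support_iff by blast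
  ultimately show False by simp
qed

lemma tops_eq: "tops y = {j\<in>exponents f. \<forall>i\<in>exponents f. value_at i y \<le> value_at j y}"
proof -
  have "value_at j y = trop_eval f (x\<^sub>0 + y) \<longleftrightarrow> (\<forall>i\<in>exponents f. value_at i y \<le> value_at j y)"
    if "j \<in> exponents f" for j
    unfolding trop_eval_def using finite_exponents that
    by (subst eq_commute, subst Max_eq_iff) (auto simp: value_at_def)
  then show ?thesis by (auto simp: tops_def maximizers_def value_at_def)
qed

lemma finite_tops: "finite (tops y)"
  using finite_exponents by (simp add: tops_eq)

lemma tops_nonempty: "tops y \<noteq> {}"
proof -
  have "trop_eval f (x\<^sub>0 + y) \<in> (\<lambda>j. trop_term f j (x\<^sub>0 + y)) ` exponents f"
    unfolding trop_eval_def using finite_exponents exponents_nonempty by (intro Max_in) auto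
  then show ?thesis by (force simp: tops_def maximizers_def)
qed

lemma off_support_iff: "y \<notin> \<Union>\<Sigma> \<longleftrightarrow> (\<exists>j. tops y = {j})"
proof -
  have "card (tops y) \<noteq> 0" using finite_tops tops_nonempty by simp
  then have "y \<notin> \<Union>\<Sigma> \<longleftrightarrow> card (tops y) = 1" unfolding support_iff by linarith
  then show ?thesis by (simp add: card_1_singleton_iff)
qed

text \<open>
  Off the hypersurface the unique maximizer is locally constant.
\<close>

lemma tops_constant:
  assumes "connected S" "S \<inter> \<Union>\<Sigma> = {}" "a \<in> S" "y \<in> S" "tops a = {j}"
  shows "tops y = {j}"
proof (rule connected_induction_simple[OF assms(1,3,4), where P = "\<lambda>y. tops y = {j}"])
  fix z assume z: "z \<in> S"
  then obtain i where i: "tops z = {i}" using assms(2) off_support_iff by blast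
  have cont: "continuous_on UNIV (value_at i)" for i
    unfolding value_at_def trop_term_def by (intro continuous_intros)
  obtain N where N: "open N" "z \<in> N" "\<And>x. x \<in> N \<Longrightarrow> tops x \<subseteq> tops z"
    by (rule maximizers_near[where g = value_at, OF finite_exponents cont, of z, folded tops_eq]) (rule that)
  have "openin (top_of_set S) (S \<inter> N)" using N(1) by (simp add: openin_open_Int)
  moreover have "tops x = {i}" if "x \<in> N" for x
    using N(3)[OF that] tops_nonempty[of x] i by (simp add: subset_singleton_iff)
  ultimately show "\<exists>T. openin (top_of_set S) T \<and> z \<in> T \<and>
      (\<forall>x\<in>T. \<forall>y\<in>T. tops x = {j} \<longrightarrow> tops y = {j})"
    using z N(2) by (intro exI[of _ "S \<inter> N"]) simp
qed (rule assms(5))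

text \<open>
  The support is a cone, so \<open>j\<close> stays the unique maximizer along the open ray from 0 through a point
  where it is, and by continuity it attains the maximum at 0. So all vertex exponents have the same
  value at 0, and on them \<open>f\<close> is a support function up to a constant.
\<close>

lemma vertex_exponent_top_at_0:
  assumes "j \<in> vertex_exponents" "i \<in> exponents f" shows "value_at i 0 \<le> value_at j 0"
proof -
  obtain y where y: "tops y = {j}" using assms(1) by (auto simp: vertex_exponents_def)
  let ?S = "(\<lambda>r. r *\<^sub>R y) ` {0<..}"
  have "connected ?S"
    by (intro connected_continuous_image continuous_intros) (simp add: convex_connected)
  moreover have "?S \<inter> \<Union>\<Sigma> = {}"
  proof -
    have False if "r > 0" "r *\<^sub>R y \<in> \<sigma>" "\<sigma> \<in> \<Sigma>" for r \<sigma>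
    proof -
      have "(1 / r) *\<^sub>R (r *\<^sub>R y) \<in> \<sigma>"
        using conicD[OF cone_conic[OF that(3)] that(2), of "1 / r"] that(1) by simp
      then have "y \<in> \<Union>\<Sigma>" using that by auto
      then show False using y off_support_iff by blast
    qed
    then show ?thesis by auto
  qed
  moreover have "y \<in> ?S" by (rule image_eqI[of _ _ 1]) auto
  ultimately have "tops (r *\<^sub>R y) = {j}" if "r > 0" for r
    using tops_constant[of ?S y "r *\<^sub>R y" j] y that by blast
  then have le: "value_at i (r *\<^sub>R y) \<le> value_at j (r *\<^sub>R y)" if "r > 0" for r
    using that assms(2) by (auto simp: tops_eq)
  have "value_at i 0 - value_at j 0 \<le> 0"
  proof (rule eventually_nonpos_at_0)
    show "value_at i 0 - value_at j 0 + t * ((real_vec i - real_vec j) \<bullet> y) \<le> 0" if "0 < t" "t < 1" for t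
      using le[OF that(1)] value_at_eq[of i "t *\<^sub>R y"] value_at_eq[of j "t *\<^sub>R y"]
      by (simp add: inner_diff_left algebra_simps)
  qed simp
  then show ?thesis by simp
qed

lemma vertex_exponents_subset: "vertex_exponents \<subseteq> exponents f"
  by (auto simp: vertex_exponents_def tops_eq)

lemma vertex_exponents_equal_at_0:
  "j \<in> vertex_exponents \<Longrightarrow> i \<in> vertex_exponents \<Longrightarrow> value_at i 0 = value_at j 0"
  using vertex_exponent_top_at_0 vertex_exponents_subset by (meson antisym subsetD)

text \<open>
  The hypersurface lies in finitely many hyperplanes, so its complement is dense. The points at
  which some vertex exponent attains the maximum form a closed set that contains this complement.
\<close>

lemma some_vertex_on_top: "\<exists>j\<in>vertex_exponents. j \<in> tops y"
proof -
  let ?C = "\<Union>j\<in>vertex_exponents. \<Inter>i\<in>exponents f. {y. value_at i y \<le> value_at j y}"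
  let ?H = "\<Union>i\<in>exponents f. \<Union>j\<in>exponents f - {i}.
    {y. (real_vec i - real_vec j) \<bullet> y = value_at j 0 - value_at i 0}"
  have "negligible ?H"
  proof (rule negligible_Union, goal_cases)
    case 1
    then show ?case using finite_exponents by simp
  next
    case (2 S)
    then obtain i where i: "i \<in> exponents f" "S = (\<Union>j\<in>exponents f - {i}.
      {y. (real_vec i - real_vec j) \<bullet> y = value_at j 0 - value_at i 0})" by blast
    have "real_vec i - real_vec j \<noteq> 0" if "j \<noteq> i" for j
      using that inj_real_vec by (auto simp: inj_def)
    then show ?case unfolding i(2) using finite_exponents
      by (intro negligible_Union) (auto intro!: negligible_hyperplane)
  qed
  moreover have "\<Union>\<Sigma> \<subseteq> ?H"
  proof
    fix y assume "y \<in> \<Union>\<Sigma>"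
    then have "2 \<le> card (tops y)" using support_iff by blast
    then obtain i j where ij: "i \<in> tops y" "j \<in> tops y" "j \<noteq> i"
      by (metis card_le_Suc0_iff_eq finite_tops not_less_eq_eq numeral_2_eq_2)
    then have "value_at i y = value_at j y" by (auto simp: tops_eq intro: antisym)
    then have "(real_vec i - real_vec j) \<bullet> y = value_at j 0 - value_at i 0"
      using value_at_eq[of i y] value_at_eq[of j y] by (simp add: inner_diff_left)
    then show "y \<in> ?H" using ij by (auto simp: tops_eq)
  qed
  ultimately have "negligible (\<Union>\<Sigma>)" by (rule negligible_subset)
  then have "interior (\<Union>\<Sigma>) = {}"
    using open_not_negligible interior_subset negligible_subset open_interior by metis
  then have dense: "closure (- \<Union>\<Sigma>) = UNIV" by (simp add: closure_complement)
  have "closed ?C"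
    unfolding value_at_def trop_term_def
    using finite_subset[OF vertex_exponents_subset finite_exponents]
    by (intro closed_UN closed_INT closed_Collect_le ballI continuous_intros)
  moreover have "- \<Union>\<Sigma> \<subseteq> ?C"
  proof
    fix y assume "y \<in> - \<Union>\<Sigma>"
    then obtain j where j: "tops y = {j}" using off_support_iff by blast
    then have "j \<in> vertex_exponents" "j \<in> tops y" by (auto simp: vertex_exponents_def)
    then show "y \<in> ?C" by (auto simp: tops_eq)
  qed
  ultimately have "y \<in> ?C" using dense closure_minimal by blast
  then show ?thesis using vertex_exponents_subset by (auto simp: tops_eq)
qed

lemma dominated_by_vertices:
  assumes "i \<in> exponents f" "v \<in> vertex_exponents"
  shows "\<exists>l\<in>vertices. (value_at i 0 - value_at v 0) + real_vec i \<bullet> y \<le> l \<bullet> y"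
proof -
  obtain j where j: "j \<in> vertex_exponents" "j \<in> tops y" using some_vertex_on_top by blast
  then have "value_at i y \<le> value_at j y" using assms(1) by (auto simp: tops_eq)
  then have "(value_at i 0 - value_at v 0) + real_vec i \<bullet> y \<le> real_vec j \<bullet> y"
    using value_at_eq[of i y] value_at_eq[of j y] vertex_exponents_equal_at_0[OF j(1) assms(2)] by simp
  then show ?thesis using j(1) by (auto simp: vertices_def)
qed

lemma finite_vertices: "finite vertices"
  using finite_subset[OF vertex_exponents_subset finite_exponents] by (simp add: vertices_def)

lemma top_face_iff_tops:
  assumes j: "j \<in> vertex_exponents" shows "real_vec j \<in> top_face vertices y \<longleftrightarrow> j \<in> tops y"
proof
  assume top: "real_vec j \<in> top_face vertices y"
  obtain i where i: "i \<in> vertex_exponents" "i \<in> tops y" using some_vertex_on_top by blast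
  have "real_vec i \<bullet> y \<le> real_vec j \<bullet> y" using top i(1) by (auto simp: top_face_def vertices_def)
  then have "value_at i y \<le> value_at j y"
    using value_at_eq[of i y] value_at_eq[of j y] vertex_exponents_equal_at_0[OF j i(1)] by simp
  then show "j \<in> tops y" using i(2) j vertex_exponents_subset by (auto simp: tops_eq intro: order_trans)
next
  assume "j \<in> tops y"
  have "real_vec i \<bullet> y \<le> real_vec j \<bullet> y" if i: "i \<in> vertex_exponents" for i
  proof -
    have "value_at i y \<le> value_at j y"
      using \<open>j \<in> tops y\<close> i vertex_exponents_subset by (auto simp: tops_eq)
    then show ?thesis
      using value_at_eq[of i y] value_at_eq[of j y] vertex_exponents_equal_at_0[OF j i] by simp
  qed
  then show "real_vec j \<in> top_face vertices y" using j by (auto simp: top_face_def vertices_def)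
qed

lemma region_of_vertex_nonempty:
  assumes "j \<in> vertex_exponents" shows "region vertices (real_vec j) \<noteq> {}"
proof -
  obtain y where y: "tops y = {j}" using assms by (auto simp: vertex_exponents_def)
  have "y \<in> region vertices (real_vec j)"
    unfolding region_def
  proof (rule CollectI, rule ballI, rule ccontr)
    fix k assume k: "k \<in> vertices - {real_vec j}" "\<not> k \<bullet> y < real_vec j \<bullet> y"
    then obtain i where i: "i \<in> vertex_exponents" "k = real_vec i" "i \<noteq> j" by (auto simp: vertices_def)
    have "real_vec j \<in> top_face vertices y" using top_face_iff_tops[OF assms] y by simp
    then have "real_vec i \<in> top_face vertices y"
      using k i by (auto simp: top_face_def intro: order_trans)
    then show False using top_face_iff_tops[OF i(1)] y i(3) by simp
  qed
  then show ?thesis by blast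
qed

text \<open>
  The interesting inclusion is that two vertices attain the maximum at every point \<open>y\<close> of the
  support. If \<open>j\<close> were the only one, then it would be so near \<open>y\<close>, and another exponent \<open>i\<close> attaining
  the maximum of \<open>f\<close> at \<open>y\<close> would exceed \<open>j\<close> after a small step in the direction \<open>i - j\<close>.
\<close>

lemma max_fan_vertices: "max_fan \<Sigma> vertices"
proof unfold_locales
  show "finite vertices" by (rule finite_vertices)
  show "region vertices j \<noteq> {}" if "j \<in> vertices" for j
    using that region_of_vertex_nonempty by (auto simp: vertices_def)
  show "\<Union>\<Sigma> = {y. \<exists>j\<in>top_face vertices y. \<exists>k\<in>top_face vertices y. j \<noteq> k}"
  proof (intro Set.set_eqI iffI)
    fix y assume "y \<in> {y. \<exists>j\<in>top_face vertices y. \<exists>k\<in>top_face vertices y. j \<noteq> k}"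
    then obtain j k where jk: "j \<in> top_face vertices y" "k \<in> top_face vertices y" "j \<noteq> k" by blast
    then obtain j' k' where jk': "j' \<in> vertex_exponents" "k' \<in> vertex_exponents" "j = real_vec j'" "k = real_vec k'"
      by (auto simp: top_face_def vertices_def)
    then have "j' \<in> tops y" "k' \<in> tops y" "j' \<noteq> k'" using jk top_face_iff_tops by auto
    then have "\<nexists>i. tops y = {i}" by auto
    then show "y \<in> \<Union>\<Sigma>" using off_support_iff[of y] by blast
  next
    fix y assume y: "y \<in> \<Union>\<Sigma>"
    obtain j where j: "j \<in> vertex_exponents" "j \<in> tops y" using some_vertex_on_top by blast
    moreover have "tops y \<noteq> {j}" using y off_support_iff[of y] by blast
    ultimately obtain i where i: "i \<in> tops y" "i \<noteq> j" by blast
    have "y \<notin> region vertices (real_vec j)"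
    proof
      assume "y \<in> region vertices (real_vec j)"
      then obtain \<epsilon> where \<epsilon>: "\<epsilon> > 0" "ball y \<epsilon> \<subseteq> region vertices (real_vec j)"
        using open_region[OF finite_vertices] open_contains_ball by blast
      define D where "D = real_vec i - real_vec j"
      have D: "D \<noteq> 0" using i(2) inj_real_vec by (auto simp: D_def inj_def)
      define t where "t = \<epsilon> / (2 * norm D)"
      have t: "t > 0" "dist y (y + t *\<^sub>R D) < \<epsilon>" using D \<epsilon>(1) by (simp_all add: t_def dist_norm)
      then have reg: "y + t *\<^sub>R D \<in> region vertices (real_vec j)" using \<epsilon>(2) by (auto simp: subset_iff)
      have "i \<in> exponents f" using i(1) by (simp add: tops_eq)
      then obtain l where "l \<in> vertices"
        "(value_at i 0 - value_at j 0) + real_vec i \<bullet> (y + t *\<^sub>R D) \<le> l \<bullet> (y + t *\<^sub>R D)"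
        using dominated_by_vertices[OF _ j(1)] by blast
      moreover have "l \<bullet> (y + t *\<^sub>R D) \<le> real_vec j \<bullet> (y + t *\<^sub>R D)"
        using reg \<open>l \<in> vertices\<close> by (rule region_le)
      ultimately have "(value_at i 0 - value_at j 0) + D \<bullet> y + t * (D \<bullet> D) \<le> 0"
        by (simp add: D_def inner_diff_left inner_add_right algebra_simps)
      moreover have "value_at i y = value_at j y" using i(1) j(2) by (auto simp: tops_eq intro: antisym)
      then have "(value_at i 0 - value_at j 0) + D \<bullet> y = 0"
        using value_at_eq[of i y] value_at_eq[of j y] by (simp add: D_def inner_diff_left)
      ultimately have "t * (D \<bullet> D) \<le> 0" by simp
      moreover have "t * (D \<bullet> D) > 0" using t(1) D by simp
      ultimately show False by simp
    qed
    then obtain k where k: "k \<in> vertices" "k \<noteq> real_vec j" "real_vec j \<bullet> y \<le> k \<bullet> y"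
      by (auto simp: region_def not_less)
    have "real_vec j \<in> top_face vertices y" using top_face_iff_tops j by blast
    moreover from this have "k \<in> top_face vertices y" using k by (auto simp: top_face_def intro: order_trans)
    ultimately show "y \<in> {y. \<exists>j\<in>top_face vertices y. \<exists>k\<in>top_face vertices y. j \<noteq> k}" using k(2) by blast
  qed
qed

lemma vertices_int: "vertices \<subseteq> int_lattice"
  by (auto simp: vertices_def int_lattice_def real_vec_def)

text \<open>
  An exponent outside the convex hull of the vertices can be separated from them by a linear form,
  along which it would eventually exceed all of them by more than any constant.
\<close>

lemma Newton_polytope_eq: "Newton_polytope f = convex hull vertices"
proof
  show "convex hull vertices \<subseteq> Newton_polytope f"
    unfolding Newton_polytope_def vertices_def using vertex_exponents_subset by (intro hull_mono) blast
  have "real_vec i \<in> convex hull vertices" if i: "i \<in> exponents f" for i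
  proof (rule ccontr)
    assume "real_vec i \<notin> convex hull vertices"
    moreover have "closed (convex hull vertices)"
      using finite_vertices by (simp add: compact_convex_hull compact_imp_closed finite_imp_compact)
    ultimately obtain a b where ab: "a \<bullet> real_vec i < b" "\<And>x. x \<in> convex hull vertices \<Longrightarrow> a \<bullet> x > b"
      using separating_hyperplane_closed_point[OF convex_convex_hull] by blast
    obtain v where v: "v \<in> vertex_exponents" using some_vertex_on_top by blast
    define e where "e = b - a \<bullet> real_vec i"
    have e: "e > 0" using ab(1) by (simp add: e_def)
    define \<beta> where "\<beta> = value_at i 0 - value_at v 0"
    define r where "r = (\<bar>\<beta>\<bar> + 1) / e"
    have r: "r > 0" "r * e = \<bar>\<beta>\<bar> + 1" using e by (simp_all add: r_def)
    obtain l where l: "l \<in> vertices" "\<beta> + real_vec i \<bullet> (r *\<^sub>R (- a)) \<le> l \<bullet> (r *\<^sub>R (- a))"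
      using dominated_by_vertices[OF i v] unfolding \<beta>_def by blast
    have "b < a \<bullet> l" by (rule ab(2)[OF hull_inc[OF l(1)]])
    then have "r * b < r * (a \<bullet> l)" using r(1) by simp
    then have "\<beta> + r * e < 0" using l(2) by (simp add: e_def inner_commute algebra_simps)
    then show False using r(2) by linarith
  qed
  then show "Newton_polytope f \<subseteq> convex hull vertices"
    unfolding Newton_polytope_def by (intro hull_minimal) (auto simp: convex_convex_hull)
qed

text \<open>
  By \<open>facet_sides\<close> all exponents that attain the maximum at a relative interior point of \<open>\<sigma>\<close> lie
  between the vertices \<open>j\<close> and \<open>k\<close> on its two sides. So the cell of the regular subdivision at that
  point is the edge from \<open>j\<close> to \<open>k\<close>. Any other edge whose dual cell contains \<open>\<sigma>\<close> is a part of this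
  edge, and it contains two vertices, which can only be \<open>j\<close> and \<open>k\<close>.
\<close>

lemma weight_eq_lattice_length:
  assumes facet: "max_fan.facet \<Sigma> \<sigma>" and s: "s \<in> rel_interior \<sigma>"
    and jk: "j \<in> top_face vertices s" "k \<in> top_face vertices s" "j \<noteq> k"
  shows "trop_weight f ((\<lambda>y. x\<^sub>0 + y) ` \<sigma>) = lattice_length (closed_segment j k)"
proof -
  interpret max_fan \<Sigma> vertices by (rule max_fan_vertices)
  obtain j' k' where sides: "j' \<in> vertices" "k' \<in> vertices" "j' \<noteq> k'"
    "\<And>s. s \<in> rel_interior \<sigma> \<Longrightarrow> top_face vertices s = {j', k'}"
    "\<And>s. s \<in> \<sigma> \<Longrightarrow> j' \<in> top_face vertices s \<and> k' \<in> top_face vertices s"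
    "span \<sigma> = {v. (j' - k') \<bullet> v = 0}"
    "\<forall>i \<beta>. (\<forall>y. \<exists>l\<in>vertices. \<beta> + i \<bullet> y \<le> l \<bullet> y) \<longrightarrow>
      (\<forall>s\<in>rel_interior \<sigma>. \<beta> + i \<bullet> s = j' \<bullet> s \<longrightarrow> i \<in> closed_segment j' k')"
    by (rule facet_sides[OF facet]) (rule that)
  have "{j, k} \<subseteq> {j', k'}" using jk(1,2) sides(4)[OF s] by blast
  then have pair: "{j, k} = {j', k'}" using jk(3) by auto
  let ?E = "closed_segment j' k'"
  have seg: "closed_segment j k = ?E" using pair closed_segment_commute by (metis doubleton_eq_iff)
  have E_sub: "?E \<subseteq> convex hull (real_vec ` tops y)" if tops: "j' \<in> top_face vertices y" "k' \<in> top_face vertices y" for y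
  proof -
    obtain p q where pq: "p \<in> vertex_exponents" "q \<in> vertex_exponents" "j' = real_vec p" "k' = real_vec q"
      using sides(1,2) by (auto simp: vertices_def)
    then have "p \<in> tops y" "q \<in> tops y" using tops top_face_iff_tops by auto
    then show ?thesis unfolding segment_convex_hull pq(3,4) by (intro hull_mono) auto
  qed
  have sub_E: "convex hull (real_vec ` tops s) \<subseteq> ?E"
  proof (rule hull_minimal)
    obtain p where p: "p \<in> vertex_exponents" "j' = real_vec p" using sides(1) by (auto simp: vertices_def)
    have "j' \<in> top_face vertices s" using sides(4)[OF s] by blast
    then have ps: "p \<in> tops s" using p top_face_iff_tops by blast
    show "real_vec ` tops s \<subseteq> ?E"
    proof
      fix x assume "x \<in> real_vec ` tops s"
      then obtain i where i: "i \<in> tops s" "x = real_vec i" by blast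
      let ?\<beta> = "value_at i 0 - value_at p 0"
      have "value_at i s = value_at p s" using i(1) ps by (auto simp: tops_eq intro: antisym)
      then have "?\<beta> + x \<bullet> s = j' \<bullet> s"
        using value_at_eq[of i s] value_at_eq[of p s] i(2) p(2) by simp
      moreover have "\<forall>y. \<exists>l\<in>vertices. ?\<beta> + x \<bullet> y \<le> l \<bullet> y"
        using dominated_by_vertices[OF _ p(1)] i by (auto simp: tops_eq)
      ultimately show "x \<in> ?E" using sides(7) s by blast
    qed
  qed (rule convex_closed_segment)
  have conv_s: "convex hull (real_vec ` tops s) = ?E"
    using sub_E E_sub[of s] sides(4)[OF s] by blast
  have dual: "x\<^sub>0 + y \<in> dual_cell f E \<longleftrightarrow> E \<subseteq> convex hull (real_vec ` tops y)" for y E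
    by (simp add: dual_cell_def tops_def)
  have "(THE E. E \<in> regular_subdivision f \<and> aff_dim E = 1 \<and> (\<lambda>y. x\<^sub>0 + y) ` \<sigma> \<subseteq> dual_cell f E) = ?E"
  proof (rule the_equality)
    have "?E \<in> regular_subdivision f"
      unfolding regular_subdivision_def using conv_s[symmetric] by (auto simp: tops_def)
    moreover have "aff_dim ?E = 1"
      using sides(3) by (simp add: segment_convex_hull aff_dim_convex_hull aff_dim_2)
    moreover have "(\<lambda>y. x\<^sub>0 + y) ` \<sigma> \<subseteq> dual_cell f ?E" using dual E_sub sides(5) by blast
    ultimately show "?E \<in> regular_subdivision f \<and> aff_dim ?E = 1 \<and> (\<lambda>y. x\<^sub>0 + y) ` \<sigma> \<subseteq> dual_cell f ?E" by blast
  next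
    fix E assume E: "E \<in> regular_subdivision f \<and> aff_dim E = 1 \<and> (\<lambda>y. x\<^sub>0 + y) ` \<sigma> \<subseteq> dual_cell f E"
    then obtain x where x: "E = convex hull (real_vec ` maximizers f x)" unfolding regular_subdivision_def by blast
    define y where "y = x - x\<^sub>0"
    have Ey: "E = convex hull (real_vec ` tops y)" by (simp add: x tops_def y_def)
    have "s \<in> \<sigma>" using s rel_interior_subset by blast
    then have "E \<subseteq> ?E" using E dual conv_s by blast
    have "y \<in> \<Union>\<Sigma>"
    proof (rule ccontr)
      assume "y \<notin> \<Union>\<Sigma>"
      then obtain i where "tops y = {i}" using off_support_iff by blast
      then show False using E Ey by simp
    qed
    then obtain v v' where v: "v \<in> top_face vertices y" "v' \<in> top_face vertices y" "v \<noteq> v'"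
      unfolding support by blast
    have mem: "u \<in> {j', k'}" if u: "u \<in> top_face vertices y" for u
    proof -
      have uV: "u \<in> vertices" using u by (simp add: top_face_def)
      then obtain i where i: "i \<in> vertex_exponents" "u = real_vec i" by (auto simp: vertices_def)
      then have "i \<in> tops y" using u top_face_iff_tops by blast
      then have "u \<in> E" unfolding Ey i(2) by (intro hull_inc imageI)
      then have "u \<in> ?E" using \<open>E \<subseteq> ?E\<close> by blast
      then show ?thesis using vertex_in_segment[OF uV sides(1,2)] by blast
    qed
    then have "{v, v'} = {j', k'}" using v by blast
    then have "?E \<subseteq> E" unfolding Ey using v by (intro E_sub) (auto simp: doubleton_eq_iff)
    then show "E = ?E" using \<open>E \<subseteq> ?E\<close> by blast
  qed
  then show ?thesis unfolding trop_weight_def seg by simp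
qed

end

lemma affine_independent_simplex:
  assumes "finite V" "V \<noteq> {}" "\<not> affine_dependent V"
  shows "\<exists>k::nat. int k simplex (convex hull V)"
proof -
  have "card V > 0" using assms by (simp add: card_gt_0_iff)
  then have "int (card V) = int (card V - 1) + 1" by simp
  then have "int (card V - 1) simplex (convex hull V)"
    unfolding simplex using assms(1,3) by blast
  then show ?thesis by blast
qed

theorem proposition4p11:
  fixes f :: "int^'n \<Rightarrow> ereal"
    and x\<^sub>0 :: "real^'n"
    and \<Sigma> :: "(real^'n) set set"
    and b :: "(real^'n) set \<Rightarrow> (real^'n) list"
    and w :: "(real^'n) set \<Rightarrow> 'r::comm_ring_1"
  assumes "tropical_Laurent_polynomial f"
    and "pure_fan \<Sigma>"
    and "trop_hypersurface f = (\<lambda>y. x\<^sub>0 + y) ` \<Union>\<Sigma>"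
    and "fan_orientation \<Sigma> b"
    and "\<And>\<alpha>. w \<alpha> = of_nat (trop_weight f ((\<lambda>y. x\<^sub>0 + y) ` \<alpha>))"
    and "tropical_Poincare_duality \<Sigma> b w"
  shows "\<exists>k::nat. int k simplex Newton_polytope f"
proof -
  interpret conical_hypersurface \<Sigma> f x\<^sub>0
    using assms(1-3) by unfold_locales (auto simp: pure_fan_def)
  interpret max_fan \<Sigma> vertices by (rule max_fan_vertices)
  interpret oriented_max_fan \<Sigma> vertices b using assms(4) by unfold_locales
  let ?M = "F_Z \<Sigma> d {0}"
  have vanish: "of_int (c i) = (0 :: 'r)"
    if c: "(\<Sum>v\<in>vertices. c v) = 0" "(\<Sum>v\<in>vertices. of_int (c v) *\<^sub>R v) = 0" and i: "i \<in> vertices" for c i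
  proof -
    obtain U :: "'n ext \<Rightarrow> 'r"
      where U: "\<And>x y. x \<in> ?M \<Longrightarrow> y \<in> ?M \<Longrightarrow> U (x + y) = U x + U y"
        "\<And>\<sigma>. facet \<sigma> \<Longrightarrow> w \<sigma> * U (wedge (b \<sigma>)) = of_int (region_sign i \<sigma>)"
      by (rule region_potential[OF assms(6) i]) (rule that)
    show ?thesis
    proof (rule integer_affine_relation_vanishes[where M = ?M and U = U and w = w])
      show "0 \<in> ?M" "\<And>x y. x \<in> ?M \<Longrightarrow> y \<in> ?M \<Longrightarrow> x - y \<in> ?M"
        unfolding F_Z_def by (simp_all add: group_closure.diff)
      show "wedge (b \<sigma>) \<in> ?M" if "facet \<sigma>" for \<sigma>
      proof -
        have "\<sigma> \<in> cones \<Sigma> d" "\<sigma> \<in> \<Sigma>" using that facet_iff_cones by (auto simp: facet_def)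
        then show ?thesis using wedge_basis_in_F_Z F_Z_subset_vertex by blast
      qed
      show "\<omega> js = 0" if "\<omega> \<in> ?M" "Suc (length js) \<noteq> CARD('n)" for \<omega> js
      proof (rule F_Z_degree[OF that(1)])
        show "length js \<noteq> d" using that(2) Suc_fan_dim by auto
      qed
      show "w \<sigma> = of_nat (lattice_length (closed_segment j k))"
        if "facet \<sigma>" "j \<noteq> k" "bounds j \<sigma>" "bounds k \<sigma>" for \<sigma> j k
      proof -
        have "\<sigma> \<in> \<Sigma>" using that(1) by (simp add: facet_def)
        then obtain s where s: "s \<in> rel_interior \<sigma>" "s \<in> \<sigma>" by (rule rel_interior_point)
        then show ?thesis
          using weight_eq_lattice_length[OF that(1) s(1) _ _ that(2)] that(3,4) assms(5)
          by (simp add: bounds_def)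
      qed
    qed (use U vertices_int i c in auto)
  qed
  have "\<not> affine_dependent vertices"
  proof
    assume "affine_dependent vertices"
    then obtain c where c: "(\<Sum>v\<in>vertices. c v) = 0" "(\<Sum>v\<in>vertices. of_int (c v) *\<^sub>R v) = 0"
      "Gcd (c ` vertices) = 1"
      by (rule primitive_integer_affine_relation[OF finite_vertices vertices_int])
    (* The integers that vanish in the ring form a subgroup, so with all coefficients of a
       primitive relation they contain 1. *)
    have zero: "of_int z = (0 :: 'r)" if "z \<in> group_closure (c ` vertices)" for z
      using that by (induction rule: group_closure.induct) (use vanish[OF c(1,2)] in auto)
    have "1 \<in> group_closure (c ` vertices)"
      using Gcd_group_closure_in_group_closure[of "c ` vertices"] c(3) by (simp add: Gcd_group_closure_eq_Gcd)
    from zero[OF this] show False by simp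
  qed
  then show ?thesis
    unfolding Newton_polytope_eq using finite_vertices V_nonempty by (intro affine_independent_simplex)
qed

end
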